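(* Assume A1–A5 (stated in the context). Let $f_n=\sum_{j=1}^\infty\theta_{nj}\phi_j$ be a sequence of alternatives with $cn^{-r}\le\|f_n\|\le Cn^{-r}$ for all $n$, where $0<c<C<\infty$. Then $f_n$ is purely $n^{-r}$-consistent if and only if for any $\varepsilon>0$ there are $C_1=C_1(\varepsilon)$ and $n_0(\varepsilon)$ such that $$\sum_{j>C_1k_n}\theta_{nj}^2\le\varepsilon n^{-2r}\qquad\text{for all } n>n_0(\varepsilon).$$
   Context: Setting. Fix $0<r<1/2$ and $\sigma>0$. One observes $dY_n(t)=f(t)\,dt+\frac{\sigma}{\sqrt n}\,dw(t)$, $t\in[0,1]$, with unknown signal $f\in L_2(0,1)$ and Gaussian white noise $dw$. Let $(\phi_j)_{j\ge1}$ be an orthonormal basis of $L_2(0,1)$; then $y_j=\int_0^1\phi_j\,dY_n=\theta_j+\frac{\sigma}{\sqrt n}\xi_j$ with $\theta_j=\int_0^1f\phi_j\,dt$ and $\xi_j$ i.i.d. standard Gaussian. The hypothesis is $f=0$; alternatives are $f=f_n$. The test statistics are $$T_n=\sum_{j=1}^\infty\kappa_{nj}^2y_j^2-\sigma^2n^{-1}\rho_n,\qquad \rho_n=\sum_{j=1}^\infty\kappa_{nj}^2 .$$ Assumptions on the coefficients. $[\cdot]$ is the integer part; $a_n\asymp b_n$ means that $a_n/b_n$ is bounded between two positive constants. A1: for each $n$ the sequence $\kappa_{nj}^2$, $j\ge1$, is decreasing. A2: there are positive constants $C_1,C_2$ such that $C_1<A_n=\sigma^{-4}n^2\sum_{j=1}^\infty\kappa_{nj}^4<C_2$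 for each $n$. A3: there are positive constants $c_1,c_2$ such that $c_1n^{-2r}\le\rho_n\le c_2n^{-2r}$. Put $k_n=\sup\{k:\sum_{j<k}\kappa_{nj}^2\le\frac12\rho_n\}$ and $\kappa_n^2=\kappa_{nk_n}^2$. A4: there are $C_1$ and $\lambda>1$ such that $\kappa^2_{n,[(1+\delta)k_n]}<C_1(1+\delta)^{-\lambda}\kappa_n^2$ for any $\delta>0$ and each $n$. A5: $\kappa_{n1}^2\asymp\kappa_n^2$ as $n\to\infty$, and for any $c>1$ there is $C>0$ such that $\kappa_{n,[ck_n]}^2\ge C\kappa_n^2$ for all $n$. Tests. A test $K_n$ generated by $T_n$ rejects the hypothesis when $T_n$ exceeds a threshold; $\alpha(K_n)$ and $\beta(K_n,f)$ are its type I error probability and its type II error probability at $f$. A sequence $f_n$ is consistent if for any $\alpha\in(0,1)$, for tests $K_n$ generated by $T_n$ with $\alpha(K_n)=\alpha(1+o(1))$, one has $\limsup_{n}\beta(K_n,f_n)<1-\alpha$; it is $n^{-r}$-consistent if additionally $\|f_n\|\asymp n^{-r}$. It is inconsistent if for each sequence of tests $K_n$ generated by $T_n$ one has $\liminf_{n}(\alpha(K_n)+\beta(K_n,f_n))\ge1$. For alternatives given only along a subsequence $n_i\to\infty$ the limits are taken along $n_i$. An $n^{-r}$-consistent sequence $f_n$ is purely $n^{-r}$-consistent if there does not exist a subsequence $f_{n_i}$ such that $f_{n_i}=f_{1n_i}+f_{2n_i}$, where $f_{2n_i}$ is orthogonal to $f_{1n_i}$, $\|f_{2n_i}\|>c_1n_i^{-r}$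 for some $c_1>0$, and the sequence $f_{2n_i}$ is inconsistent. *)

theory Defs
  imports "HOL-Probability.Probability" "HOL-Library.Landau_Symbols"
begin

text \<open>The index \<open>j\<close> of basis functions, coefficients and noise variables, and the index
  \<open>n\<close> of the noise level, run over the integers \<open>\<ge> 1\<close>; values at \<open>0\<close> are never used.\<close>

subsection \<open>The space $L_2(0,1)$ and its orthonormal bases\<close>

text \<open>Elements of $L_2(0,1)$ are represented by functions; equality is equality almost everywhere.\<close>

abbreviation unit_leb :: "real measure" where
  "unit_leb \<equiv> lebesgue_on {0<..<1}"

definition L2 :: "(real \<Rightarrow> real) set" where
  "L2 = {f. f \<in> borel_measurable unit_leb \<and> integrable unit_leb (\<lambda>t. (f t)\<^sup>2)}"

definition l2_inner :: "(real \<Rightarrow> real) \<Rightarrow> (real \<Rightarrow> real) \<Rightarrow> real" where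
  "l2_inner f g = (LINT t|unit_leb. f t * g t)"

definition l2_norm :: "(real \<Rightarrow> real) \<Rightarrow> real" where
  "l2_norm f = sqrt (l2_inner f f)"

definition orthonormal_basis :: "(nat \<Rightarrow> real \<Rightarrow> real) \<Rightarrow> bool" where
  "orthonormal_basis \<phi> \<longleftrightarrow>
     (\<forall>j\<ge>1. \<phi> j \<in> L2) \<and>
     (\<forall>i\<ge>1. \<forall>j\<ge>1. l2_inner (\<phi> i) (\<phi> j) = (if i = j then 1 else 0)) \<and>
     (\<forall>f\<in>L2. (\<lambda>N. l2_norm (\<lambda>t. f t - (\<Sum>j=1..N. l2_inner f (\<phi> j) * \<phi> j t))) \<longlonglongrightarrow> 0)"

subsection \<open>Observations and tests\<close>

definition iid_standard_normal :: "'w measure \<Rightarrow> (nat \<Rightarrow> 'w \<Rightarrow> real) \<Rightarrow> bool" where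
  "iid_standard_normal M \<xi> \<longleftrightarrow>
     prob_space M \<and>
     prob_space.indep_vars M (\<lambda>_. borel) \<xi> {1..} \<and>
     (\<forall>j\<ge>1. distributed M lborel (\<xi> j) std_normal_density)"

text \<open>The \<open>j\<close>-th observed coefficient $y_j = \int_0^1 \phi_j\,dY_n$ when the signal is \<open>f\<close>;
  \<open>\<xi> j\<close> stands for $\int_0^1 \phi_j\,dw$.\<close>

definition obs ::
  "real \<Rightarrow> (nat \<Rightarrow> real \<Rightarrow> real) \<Rightarrow> (nat \<Rightarrow> 'w \<Rightarrow> real) \<Rightarrow> nat \<Rightarrow> (real \<Rightarrow> real) \<Rightarrow> 'w \<Rightarrow> nat \<Rightarrow> real" where
  "obs \<sigma> \<phi> \<xi> n f \<omega> j = l2_inner f (\<phi> j) + \<sigma> / sqrt (real n) * \<xi> j \<omega>"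

definition rho :: "(nat \<Rightarrow> nat \<Rightarrow> real) \<Rightarrow> nat \<Rightarrow> real" where
  "rho \<kappa> n = (\<Sum>\<^sub>\<infinity>j\<in>{1..}. (\<kappa> n j)\<^sup>2)"

text \<open>Under the assumptions below the series converges almost surely for every signal.\<close>

definition test_stat :: "real \<Rightarrow> (nat \<Rightarrow> nat \<Rightarrow> real) \<Rightarrow> nat \<Rightarrow> (nat \<Rightarrow> real) \<Rightarrow> real" where
  "test_stat \<sigma> \<kappa> n y = (\<Sum>\<^sub>\<infinity>j\<in>{1..}. (\<kappa> n j)\<^sup>2 * (y j)\<^sup>2) - \<sigma>\<^sup>2 / real n * rho \<kappa> n"

text \<open>The test generated by $T_n$ with threshold \<open>x\<close> rejects when $T_n > x$, so a sequence of
  generated tests is given by a sequence of thresholds.\<close>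

definition type1_error ::
  "'w measure \<Rightarrow> (nat \<Rightarrow> 'w \<Rightarrow> real) \<Rightarrow> real \<Rightarrow> (nat \<Rightarrow> real \<Rightarrow> real) \<Rightarrow> (nat \<Rightarrow> nat \<Rightarrow> real) \<Rightarrow>
    nat \<Rightarrow> real \<Rightarrow> real" where
  "type1_error M \<xi> \<sigma> \<phi> \<kappa> n x =
     measure M {\<omega> \<in> space M. test_stat \<sigma> \<kappa> n (obs \<sigma> \<phi> \<xi> n (\<lambda>_. 0) \<omega>) > x}"

definition type2_error ::
  "'w measure \<Rightarrow> (nat \<Rightarrow> 'w \<Rightarrow> real) \<Rightarrow> real \<Rightarrow> (nat \<Rightarrow> real \<Rightarrow> real) \<Rightarrow> (nat \<Rightarrow> nat \<Rightarrow> real) \<Rightarrow>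
    nat \<Rightarrow> real \<Rightarrow> (real \<Rightarrow> real) \<Rightarrow> real" where
  "type2_error M \<xi> \<sigma> \<phi> \<kappa> n x f =
     measure M {\<omega> \<in> space M. test_stat \<sigma> \<kappa> n (obs \<sigma> \<phi> \<xi> n f \<omega>) \<le> x}"

subsection \<open>Consistency\<close>

definition consistent ::
  "'w measure \<Rightarrow> (nat \<Rightarrow> 'w \<Rightarrow> real) \<Rightarrow> real \<Rightarrow> (nat \<Rightarrow> real \<Rightarrow> real) \<Rightarrow> (nat \<Rightarrow> nat \<Rightarrow> real) \<Rightarrow>
    (nat \<Rightarrow> real \<Rightarrow> real) \<Rightarrow> bool" where
  "consistent M \<xi> \<sigma> \<phi> \<kappa> f \<longleftrightarrow>
     (\<forall>\<alpha> x. 0 < \<alpha> \<and> \<alpha> < 1 \<and>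
        (\<lambda>n. type1_error M \<xi> \<sigma> \<phi> \<kappa> n (x n)) \<sim>[sequentially] (\<lambda>_. \<alpha>) \<longrightarrow>
        limsup (\<lambda>n. ereal (type2_error M \<xi> \<sigma> \<phi> \<kappa> n (x n) (f n))) < ereal (1 - \<alpha>))"

definition rate_consistent ::
  "'w measure \<Rightarrow> (nat \<Rightarrow> 'w \<Rightarrow> real) \<Rightarrow> real \<Rightarrow> (nat \<Rightarrow> real \<Rightarrow> real) \<Rightarrow> (nat \<Rightarrow> nat \<Rightarrow> real) \<Rightarrow>
    real \<Rightarrow> (nat \<Rightarrow> real \<Rightarrow> real) \<Rightarrow> bool" where
  "rate_consistent M \<xi> \<sigma> \<phi> \<kappa> r f \<longleftrightarrow>
     consistent M \<xi> \<sigma> \<phi> \<kappa> f \<and>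
     (\<lambda>n. l2_norm (f n)) \<in> \<Theta>(\<lambda>n. real n powr (- r))"

text \<open>Inconsistency of alternatives given along indices $n_i =$ \<open>m i\<close> only: \<open>g i\<close> is the
  alternative and \<open>x i\<close> the threshold at index \<open>m i\<close>.\<close>

definition inconsistent_along ::
  "'w measure \<Rightarrow> (nat \<Rightarrow> 'w \<Rightarrow> real) \<Rightarrow> real \<Rightarrow> (nat \<Rightarrow> real \<Rightarrow> real) \<Rightarrow> (nat \<Rightarrow> nat \<Rightarrow> real) \<Rightarrow>
    (nat \<Rightarrow> nat) \<Rightarrow> (nat \<Rightarrow> real \<Rightarrow> real) \<Rightarrow> bool" where
  "inconsistent_along M \<xi> \<sigma> \<phi> \<kappa> m g \<longleftrightarrow>
     (\<forall>x. liminf (\<lambda>i. ereal (type1_error M \<xi> \<sigma> \<phi> \<kappa> (m i) (x i)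
                            + type2_error M \<xi> \<sigma> \<phi> \<kappa> (m i) (x i) (g i))) \<ge> 1)"

definition purely_rate_consistent ::
  "'w measure \<Rightarrow> (nat \<Rightarrow> 'w \<Rightarrow> real) \<Rightarrow> real \<Rightarrow> (nat \<Rightarrow> real \<Rightarrow> real) \<Rightarrow> (nat \<Rightarrow> nat \<Rightarrow> real) \<Rightarrow>
    real \<Rightarrow> (nat \<Rightarrow> real \<Rightarrow> real) \<Rightarrow> bool" where
  "purely_rate_consistent M \<xi> \<sigma> \<phi> \<kappa> r f \<longleftrightarrow>
     rate_consistent M \<xi> \<sigma> \<phi> \<kappa> r f \<and>
     \<not> (\<exists>m f1 f2. strict_mono m \<and> (\<forall>i. 1 \<le> m i) \<and>
          (\<forall>i. f1 i \<in> L2 \<and> f2 i \<in> L2 \<and>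
               (AE t in unit_leb. f (m i) t = f1 i t + f2 i t) \<and>
               l2_inner (f2 i) (f1 i) = 0) \<and>
          (\<exists>c1>0. \<forall>i. l2_norm (f2 i) > c1 * real (m i) powr (- r)) \<and>
          inconsistent_along M \<xi> \<sigma> \<phi> \<kappa> m f2)"

subsection \<open>Assumptions on the coefficients\<close>

text \<open>An infinite sum over a non-summable family is \<open>0\<close>, so the positive lower bounds in
  \<open>cond_A2\<close> and \<open>cond_A3\<close> entail convergence of the series.\<close>

definition cond_A1 :: "(nat \<Rightarrow> nat \<Rightarrow> real) \<Rightarrow> bool" where
  "cond_A1 \<kappa> \<longleftrightarrow> (\<forall>n\<ge>1. antimono_on {1..} (\<lambda>j. (\<kappa> n j)\<^sup>2))"

definition A_coef :: "real \<Rightarrow> (nat \<Rightarrow> nat \<Rightarrow> real) \<Rightarrow> nat \<Rightarrow> real" where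
  "A_coef \<sigma> \<kappa> n = (real n)\<^sup>2 / \<sigma> ^ 4 * (\<Sum>\<^sub>\<infinity>j\<in>{1..}. (\<kappa> n j) ^ 4)"

definition cond_A2 :: "real \<Rightarrow> (nat \<Rightarrow> nat \<Rightarrow> real) \<Rightarrow> bool" where
  "cond_A2 \<sigma> \<kappa> \<longleftrightarrow> (\<exists>C1>0. \<exists>C2>0. \<forall>n\<ge>1. C1 < A_coef \<sigma> \<kappa> n \<and> A_coef \<sigma> \<kappa> n < C2)"

definition cond_A3 :: "real \<Rightarrow> (nat \<Rightarrow> nat \<Rightarrow> real) \<Rightarrow> bool" where
  "cond_A3 r \<kappa> \<longleftrightarrow> (\<exists>c1>0. \<exists>c2>0. \<forall>n\<ge>1.
     c1 * real n powr (- 2 * r) \<le> rho \<kappa> n \<and> rho \<kappa> n \<le> c2 * real n powr (- 2 * r))"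

definition k_idx :: "(nat \<Rightarrow> nat \<Rightarrow> real) \<Rightarrow> nat \<Rightarrow> nat" where
  "k_idx \<kappa> n = Sup {k. (\<Sum>j\<in>{1..<k}. (\<kappa> n j)\<^sup>2) \<le> rho \<kappa> n / 2}"

definition kappa_sq :: "(nat \<Rightarrow> nat \<Rightarrow> real) \<Rightarrow> nat \<Rightarrow> real" where
  "kappa_sq \<kappa> n = (\<kappa> n (k_idx \<kappa> n))\<^sup>2"

definition cond_A4 :: "(nat \<Rightarrow> nat \<Rightarrow> real) \<Rightarrow> bool" where
  "cond_A4 \<kappa> \<longleftrightarrow> (\<exists>C1. \<exists>l>1. \<forall>\<delta>>0. \<forall>n\<ge>1.
     (\<kappa> n (nat \<lfloor>(1 + \<delta>) * real (k_idx \<kappa> n)\<rfloor>))\<^sup>2 < C1 * (1 + \<delta>) powr (- l) * kappa_sq \<kappa> n)"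

definition cond_A5 :: "(nat \<Rightarrow> nat \<Rightarrow> real) \<Rightarrow> bool" where
  "cond_A5 \<kappa> \<longleftrightarrow>
     (\<lambda>n. (\<kappa> n 1)\<^sup>2) \<in> \<Theta>(kappa_sq \<kappa>) \<and>
     (\<forall>c>1. \<exists>C>0. \<forall>n\<ge>1. (\<kappa> n (nat \<lfloor>c * real (k_idx \<kappa> n)\<rfloor>))\<^sup>2 \<ge> C * kappa_sq \<kappa> n)"

end

theory Submission
  imports Defs
begin

text \<open>
  Write \<open>\<theta>\<^sub>j\<close> for the coefficients of an alternative \<open>g\<close> of norm \<open>O(n powr - r)\<close>. Expanding the squares
  of the observations splits the statistic as \<open>n\<^sup>2 T\<^sub>n = V + L + d\<close>, where
  \<open>V = (\<Sum>j. n \<sigma>\<^sup>2 \<kappa>\<^sub>j\<^sup>2 (\<xi>\<^sub>j\<^sup>2 - 1))\<close> is pure noise, \<open>L\<close> is linear in the noise, and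
  \<open>d = n\<^sup>2 (\<Sum>j. \<kappa>\<^sub>j\<^sup>2 \<theta>\<^sub>j\<^sup>2)\<close> is the deterministic shift caused by \<open>g\<close> (\<open>scaled_signal\<close> below).
  The assumptions force \<open>\<kappa>\<^sub>1\<^sup>2\<close> and \<open>\<kappa>\<^sub>k\<^sup>2\<close>, \<open>k\<close> being the effective dimension, to have the order
  \<open>n powr (2 r - 2)\<close> (\<open>kappa_sq_rate\<close>). Hence the weights in \<open>V\<close> are uniformly small while the
  variance of \<open>V\<close> stays between two positive constants, so \<open>V\<close> is asymptotically normal, and the
  variance of \<open>L\<close> is \<open>O(n powr (2 r - 1))\<close>, which vanishes. The outcome is a normal approximation
  of the type II error, uniform in the threshold and in the alternative
  (\<open>normal_approximation\<close>): detectability depends on the shift \<open>d\<close> alone. Alternatives with \<open>d\<close>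
  bounded away from zero are consistent (\<open>consistent_if_signal_bounded_below\<close>), and alternatives
  along a subsequence are inconsistent exactly when \<open>d\<close> tends to zero
  (\<open>inconsistent_along_iff\<close>).

  The theorem is then Hilbert space geometry. On the indices \<open>j \<le> C1 k\<close> the weights \<open>\<kappa>\<^sub>j\<^sup>2\<close> are
  comparable to \<open>\<kappa>\<^sub>k\<^sup>2\<close>, so \<open>d\<close> dominates \<open>n powr (2 r)\<close> times the energy of \<open>g\<close> in those
  coordinates (\<open>signal_ge_head\<close>). If the tails of \<open>f\<close> are uniformly small, a fixed share of the
  energy of \<open>f\<close> is visible and \<open>f\<close> is consistent. An inconsistent orthogonal summand \<open>f2\<close> has almost
  all of its energy in the tail; but \<open>\<parallel>f2\<parallel>\<^sup>2\<close> is the inner product of \<open>f2\<close> with \<open>f\<close>, and \<open>f\<close> has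
  almost no energy there, so \<open>f2\<close> is small compared with \<open>n powr - r\<close>
  (\<open>no_inconsistent_component\<close>). Conversely, if the tails are not uniformly small, the parts
  of \<open>f\<close> beyond \<open>(i + 2) k\<close>, along suitable \<open>n = m i\<close>, keep a fixed share of the energy, while the
  decay of the weights in \<open>cond_A4\<close> drives their shift \<open>d\<close> to zero: they are
  inconsistent orthogonal summands (\<open>small_tails_if_pure\<close>).
\<close>

section \<open>Coordinates in $L_2(0,1)$\<close>

lemma L2D [dest]:
  assumes "f \<in> L2"
  shows "f \<in> borel_measurable unit_leb" "integrable unit_leb (\<lambda>t. (f t)\<^sup>2)"
  using assms by (auto simp: L2_def)

lemma L2_integrable_mult:
  assumes "f \<in> L2" "g \<in> L2"
  shows "integrable unit_leb (\<lambda>t. f t * g t)"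
proof (rule Bochner_Integration.integrable_bound)
  show "integrable unit_leb (\<lambda>t. (f t)\<^sup>2 + (g t)\<^sup>2)"
    using assms by auto
  show "(\<lambda>t. f t * g t) \<in> borel_measurable unit_leb"
    using L2D(1)[OF assms(1)] L2D(1)[OF assms(2)] by measurable
  have "\<bar>a * b\<bar> \<le> a\<^sup>2 + b\<^sup>2" for a b :: real
  proof -
    have "2 * (\<bar>a\<bar> * \<bar>b\<bar>) \<le> a\<^sup>2 + b\<^sup>2" "0 \<le> \<bar>a\<bar> * \<bar>b\<bar>"
      using sum_squares_bound[of "\<bar>a\<bar>" "\<bar>b\<bar>"] by (simp_all add: mult.assoc)
    then show ?thesis unfolding abs_mult by linarith
  qed
  then show "AE t in unit_leb. norm (f t * g t) \<le> norm ((f t)\<^sup>2 + (g t)\<^sup>2)"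
    by (intro AE_I2) (metis abs_ge_self order_trans real_norm_def)
qed

lemma L2_add: "(\<lambda>t. f t + g t) \<in> L2" if "f \<in> L2" "g \<in> L2"
  using that L2_integrable_mult[OF that] by (auto simp: L2_def power2_sum mult.assoc)

lemma L2_scale: "(\<lambda>t. a * f t) \<in> L2" if "f \<in> L2"
  using that by (auto simp: L2_def power_mult_distrib)

lemma L2_zero: "(\<lambda>t. 0) \<in> L2"
  by (auto simp: L2_def)

lemma L2_sum: "(\<lambda>t. \<Sum>j\<in>J. h j t) \<in> L2" if "\<And>j. j \<in> J \<Longrightarrow> h j \<in> L2"
  using that by (induction J rule: infinite_finite_induct) (auto intro: L2_zero L2_add)

lemma L2_diff: "(\<lambda>t. f t - g t) \<in> L2" if "f \<in> L2" "g \<in> L2"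
  using L2_add[OF that(1) L2_scale[OF that(2), of "-1"]] by simp

lemma l2_inner_commute: "l2_inner f g = l2_inner g f"
  by (simp add: l2_inner_def mult.commute)

lemma l2_inner_add:
  assumes "f \<in> L2" "g \<in> L2" "h \<in> L2"
  shows "l2_inner (\<lambda>t. f t + g t) h = l2_inner f h + l2_inner g h"
  using L2_integrable_mult[of f h] L2_integrable_mult[of g h] assms
  by (simp add: l2_inner_def distrib_right)

lemma l2_inner_diff:
  assumes "f \<in> L2" "g \<in> L2" "h \<in> L2"
  shows "l2_inner (\<lambda>t. f t - g t) h = l2_inner f h - l2_inner g h"
  using L2_integrable_mult[of f h] L2_integrable_mult[of g h] assms
  by (simp add: l2_inner_def left_diff_distrib)

lemma l2_inner_sum:
  assumes "\<And>j. j \<in> J \<Longrightarrow> h j \<in> L2" "g \<in> L2"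
  shows "l2_inner (\<lambda>t. \<Sum>j\<in>J. c j * h j t) g = (\<Sum>j\<in>J. c j * l2_inner (h j) g)"
proof -
  have "integrable unit_leb (\<lambda>t. c j * (h j t * g t))" if "j \<in> J" for j
    using L2_integrable_mult[OF assms(1)[OF that] assms(2)] by simp
  then show ?thesis
    by (simp add: l2_inner_def sum_distrib_right mult.assoc Bochner_Integration.integral_sum)
qed

lemma l2_inner_zero [simp]: "l2_inner (\<lambda>_. 0) g = 0"
  by (simp add: l2_inner_def)

lemma l2_norm_square: "(l2_norm f)\<^sup>2 = l2_inner f f"
  by (simp add: l2_norm_def l2_inner_def)

lemma l2_norm_nonneg: "0 \<le> l2_norm f"
  by (simp add: l2_norm_def l2_inner_def)

lemma orthonormal_basis_L2: "\<phi> j \<in> L2" if "orthonormal_basis \<phi>" "1 \<le> j"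
  using that by (auto simp: orthonormal_basis_def)

lemma l2_inner_basis_sum:
  assumes "orthonormal_basis \<phi>" "finite J" "J \<subseteq> {1..}" "1 \<le> i"
  shows "l2_inner (\<lambda>t. \<Sum>j\<in>J. b j * \<phi> j t) (\<phi> i) = (if i \<in> J then b i else 0)"
proof -
  have "l2_inner (\<lambda>t. \<Sum>j\<in>J. b j * \<phi> j t) (\<phi> i) = (\<Sum>j\<in>J. b j * l2_inner (\<phi> j) (\<phi> i))"
    using assms by (intro l2_inner_sum) (auto intro!: orthonormal_basis_L2)
  also have "\<dots> = (\<Sum>j\<in>J. if j = i then b i else 0)"
    using assms by (intro sum.cong) (auto simp: orthonormal_basis_def subset_iff)
  finally show ?thesis
    using assms by simp
qed

text \<open>
  Unordered sums over \<open>{1..}\<close> of nonnegative terms are limits of partial sums. This is the bridge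
  between the set-indexed sums in the definitions and truncation at a finite index.
\<close>

lemma has_sum_from_1_iff_tendsto:
  fixes h :: "nat \<Rightarrow> real"
  assumes "\<And>j. 1 \<le> j \<Longrightarrow> 0 \<le> h j"
  shows "(h has_sum S) {1..} \<longleftrightarrow> (\<lambda>N. \<Sum>j=1..N. h j) \<longlonglongrightarrow> S"
proof -
  have "(h has_sum S) {1..} \<longleftrightarrow> (h has_sum S) (Suc ` UNIV)"
    by (metis One_nat_def atLeast_Suc_greaterThan greaterThan_0)
  also have "\<dots> \<longleftrightarrow> ((\<lambda>j. h (Suc j)) has_sum S) UNIV"
    by (subst has_sum_reindex) (auto simp: o_def)
  also have "\<dots> \<longleftrightarrow> (\<lambda>j. h (Suc j)) sums S"
    using assms by (auto intro: has_sum_imp_sums sums_nonneg_imp_has_sum)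
  also have "\<dots> \<longleftrightarrow> (\<lambda>N. \<Sum>j=1..N. h j) \<longlonglongrightarrow> S"
    by (simp add: sums_def sum.atLeast1_atMost_eq)
  finally show ?thesis .
qed

text \<open>
  The truncation of \<open>g\<close> to coordinates beyond \<open>N\<close>. It plays two roles: its norm tends to zero, which
  gives Parseval's identity, and with \<open>N\<close> beyond the effective dimension it is the component of an
  alternative that the test cannot see.
\<close>

definition remainder_after :: "(nat \<Rightarrow> real \<Rightarrow> real) \<Rightarrow> nat \<Rightarrow> (real \<Rightarrow> real) \<Rightarrow> real \<Rightarrow> real" where
  "remainder_after \<phi> N g = (\<lambda>t. g t - (\<Sum>j=1..N. l2_inner g (\<phi> j) * \<phi> j t))"

lemma partial_sum_L2:
  assumes "orthonormal_basis \<phi>"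
  shows "(\<lambda>t. \<Sum>j=1..N. b j * \<phi> j t) \<in> L2"
  using assms by (intro L2_sum L2_scale orthonormal_basis_L2) auto

lemma remainder_after_L2:
  assumes "orthonormal_basis \<phi>" "g \<in> L2"
  shows "remainder_after \<phi> N g \<in> L2"
  unfolding remainder_after_def using assms by (intro L2_diff partial_sum_L2)

lemma remainder_after_coeff:
  assumes "orthonormal_basis \<phi>" "g \<in> L2" "1 \<le> i"
  shows "l2_inner (remainder_after \<phi> N g) (\<phi> i) = (if i \<le> N then 0 else l2_inner g (\<phi> i))"
  using assms partial_sum_L2[OF assms(1), of "\<lambda>j. l2_inner g (\<phi> j)" N]
    l2_inner_basis_sum[OF assms(1), of "{1..N}" i "\<lambda>j. l2_inner g (\<phi> j)"]
  unfolding remainder_after_def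
  by (subst l2_inner_diff) (auto intro: orthonormal_basis_L2)

lemma remainder_after_orthogonal:
  assumes "orthonormal_basis \<phi>" "g \<in> L2"
  shows "l2_inner (\<lambda>t. \<Sum>j=1..N. b j * \<phi> j t) (remainder_after \<phi> N g) = 0"
proof -
  have "l2_inner (\<lambda>t. \<Sum>j=1..N. b j * \<phi> j t) (remainder_after \<phi> N g) =
      (\<Sum>j=1..N. b j * l2_inner (\<phi> j) (remainder_after \<phi> N g))"
    using assms by (intro l2_inner_sum remainder_after_L2) (auto intro: orthonormal_basis_L2)
  also have "\<dots> = 0"
    using assms remainder_after_coeff[OF assms, of _ N]
    by (intro sum.neutral) (auto simp: l2_inner_commute[of "\<phi> j" for j])
  finally show ?thesis .
qed

lemma remainder_after_norm:
  assumes "orthonormal_basis \<phi>" "g \<in> L2"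
  shows "(l2_norm (remainder_after \<phi> N g))\<^sup>2 = (l2_norm g)\<^sup>2 - (\<Sum>j=1..N. (l2_inner g (\<phi> j))\<^sup>2)"
proof -
  let ?R = "remainder_after \<phi> N g" and ?P = "\<lambda>t. \<Sum>j=1..N. l2_inner g (\<phi> j) * \<phi> j t"
  have P: "?P \<in> L2" using assms by (intro partial_sum_L2)
  have "l2_inner ?R ?R = l2_inner g ?R - l2_inner ?P ?R"
    by (subst (1) remainder_after_def)
       (use assms P in \<open>intro l2_inner_diff remainder_after_L2, auto\<close>)
  also have "\<dots> = l2_inner ?R g"
    using remainder_after_orthogonal[OF assms, of "\<lambda>j. l2_inner g (\<phi> j)" N]
    by (simp add: l2_inner_commute[of g ?R])
  also have "\<dots> = l2_inner g g - l2_inner ?P g"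
    unfolding remainder_after_def using assms P by (intro l2_inner_diff)
  also have "l2_inner ?P g = (\<Sum>j=1..N. l2_inner g (\<phi> j) * l2_inner (\<phi> j) g)"
    using assms by (intro l2_inner_sum) (auto intro: orthonormal_basis_L2)
  finally show ?thesis
    unfolding l2_norm_square by (simp add: l2_inner_commute[of "\<phi> j" g for j] power2_eq_square)
qed

text \<open>
  The basis property says that \<open>remainder_after \<phi> N g\<close> tends to zero in norm; by orthogonality its
  squared norm is the squared norm of \<open>g\<close> minus a partial sum of squared coefficients.
\<close>

lemma parseval:
  assumes "orthonormal_basis \<phi>" "g \<in> L2"
  shows "((\<lambda>j. (l2_inner g (\<phi> j))\<^sup>2) has_sum (l2_norm g)\<^sup>2) {1..}"
proof -
  have "(\<lambda>N. l2_norm (remainder_after \<phi> N g)) \<longlonglongrightarrow> 0"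
    using assms unfolding remainder_after_def by (auto simp: orthonormal_basis_def)
  then have "(\<lambda>N. (l2_norm g)\<^sup>2 - (l2_norm (remainder_after \<phi> N g))\<^sup>2) \<longlonglongrightarrow> (l2_norm g)\<^sup>2 - 0\<^sup>2"
    by (intro tendsto_intros)
  then show ?thesis
    using assms by (subst has_sum_from_1_iff_tendsto) (auto simp: remainder_after_norm)
qed

lemma l2_inner_cong_AE:
  assumes "AE t in unit_leb. f t = g t" "f \<in> L2" "g \<in> L2" "h \<in> L2"
  shows "l2_inner f h = l2_inner g h"
  unfolding l2_inner_def
  using assms(1) L2_integrable_mult[OF assms(2,4)] L2_integrable_mult[OF assms(3,4)]
  by (intro integral_cong_AE) auto

text \<open>
  For \<open>g = g1 + g2\<close> with orthogonal summands, \<open>\<langle>g, g2\<rangle>\<close> is the squared norm of \<open>g2\<close>. Its expansion in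
  the basis is obtained from Parseval's identity alone by polarisation:
  twice the product of the coefficients of \<open>g\<close> and \<open>g2\<close> is the square of the former plus the square
  of the latter minus the square of the coefficient of \<open>g1\<close>.
\<close>

lemma orthogonal_decomposition_coeffs:
  assumes "orthonormal_basis \<phi>" "g \<in> L2" "g1 \<in> L2" "g2 \<in> L2"
    and eq: "AE t in unit_leb. g t = g1 t + g2 t" and orth: "l2_inner g2 g1 = 0"
  shows "(l2_norm g2)\<^sup>2 \<le> (l2_norm g)\<^sup>2"
    and "((\<lambda>j. l2_inner g (\<phi> j) * l2_inner g2 (\<phi> j)) has_sum (l2_norm g2)\<^sup>2) {1..}"
proof -
  note L2 = assms(2-4) L2_add[OF assms(3,4)]
  have g: "l2_inner g h = l2_inner g1 h + l2_inner g2 h" if "h \<in> L2" for h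
    using l2_inner_cong_AE[OF eq] l2_inner_add[OF assms(3,4) that] L2 that by auto
  have "l2_inner g g = l2_inner g1 g + l2_inner g2 g" using L2 by (intro g)
  also have "\<dots> = l2_inner g1 g1 + l2_inner g2 g2"
    using g[of g1] g[of g2] L2 orth by (simp add: l2_inner_commute[of _ g] l2_inner_commute[of g1 g2])
  finally have norm: "(l2_norm g)\<^sup>2 = (l2_norm g1)\<^sup>2 + (l2_norm g2)\<^sup>2"
    by (simp add: l2_norm_square)
  then show "(l2_norm g2)\<^sup>2 \<le> (l2_norm g)\<^sup>2" by simp
  let ?a = "\<lambda>j. l2_inner g (\<phi> j)" and ?a1 = "\<lambda>j. l2_inner g1 (\<phi> j)" and ?a2 = "\<lambda>j. l2_inner g2 (\<phi> j)"
  have "((\<lambda>j. ((?a j)\<^sup>2 + (?a2 j)\<^sup>2 - (?a1 j)\<^sup>2) / 2) has_sum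
      ((l2_norm g)\<^sup>2 + (l2_norm g2)\<^sup>2 - (l2_norm g1)\<^sup>2) / 2) {1..}"
    unfolding divide_inverse diff_conv_add_uminus
    by (intro has_sum_cmult_left has_sum_add has_sum_uminusI parseval assms)
  moreover have "((?a j)\<^sup>2 + (?a2 j)\<^sup>2 - (?a1 j)\<^sup>2) / 2 = ?a j * ?a2 j" if "j \<in> {1..}" for j
    using g[of "\<phi> j"] orthonormal_basis_L2[OF assms(1)] that
    by (simp add: power2_eq_square field_simps)
  ultimately have "((\<lambda>j. ?a j * ?a2 j) has_sum
      ((l2_norm g)\<^sup>2 + (l2_norm g2)\<^sup>2 - (l2_norm g1)\<^sup>2) / 2) {1..}"
    by (subst (asm) has_sum_cong) auto
  then show "((\<lambda>j. ?a j * ?a2 j) has_sum (l2_norm g2)\<^sup>2) {1..}"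
    using norm by simp
qed

section \<open>Order of magnitude of the weights\<close>

lemma rho_has_sum:
  assumes "cond_A3 r \<kappa>" "1 \<le> n"
  shows "((\<lambda>j. (\<kappa> n j)\<^sup>2) has_sum rho \<kappa> n) {1..}" "0 < rho \<kappa> n"
proof -
  show pos: "0 < rho \<kappa> n"
  proof -
    obtain a where "0 < a" "a * real n powr (-2 * r) \<le> rho \<kappa> n"
      using assms unfolding cond_A3_def by blast
    then show ?thesis using assms(2) by (smt (verit) mult_pos_pos of_nat_0_less_iff powr_gt_zero less_le_trans zero_less_one)
  qed
  then have "(\<lambda>j. (\<kappa> n j)\<^sup>2) summable_on {1..}"
    unfolding rho_def by (metis infsum_not_exists less_irrefl)
  then show "((\<lambda>j. (\<kappa> n j)\<^sup>2) has_sum rho \<kappa> n) {1..}"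
    unfolding rho_def by (rule has_sum_infsum)
qed

lemma A_coef_has_sum:
  assumes "cond_A2 \<sigma> \<kappa>" "1 \<le> n" "0 < \<sigma>"
  shows "((\<lambda>j. \<kappa> n j ^ 4) has_sum (\<sigma> ^ 4 * A_coef \<sigma> \<kappa> n / (real n)\<^sup>2)) {1..}" "0 < A_coef \<sigma> \<kappa> n"
proof -
  show pos: "0 < A_coef \<sigma> \<kappa> n"
    using assms unfolding cond_A2_def by (meson less_trans)
  then have "(\<Sum>\<^sub>\<infinity>j\<in>{1..}. \<kappa> n j ^ 4) \<noteq> 0"
    unfolding A_coef_def by auto
  then have "(\<lambda>j. \<kappa> n j ^ 4) summable_on {1..}"
    by (metis infsum_not_exists)
  then show "((\<lambda>j. \<kappa> n j ^ 4) has_sum (\<sigma> ^ 4 * A_coef \<sigma> \<kappa> n / (real n)\<^sup>2)) {1..}"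
    unfolding A_coef_def using assms by (simp add: has_sum_infsum)
qed

lemma kappa_sq_antimono:
  assumes "cond_A1 \<kappa>" "1 \<le> n" "1 \<le> i" "i \<le> j"
  shows "(\<kappa> n j)\<^sup>2 \<le> (\<kappa> n i)\<^sup>2"
  using assms unfolding cond_A1_def monotone_on_def by auto

text \<open>
  The supremum defining \<open>k_idx\<close> ranges over a nonempty bounded set: the partial sums tend to \<open>rho\<close>,
  which is positive, and so they eventually exceed half of it. The supremum is therefore attained, and
  one more term crosses the level \<open>rho \<kappa> n / 2\<close>.
\<close>

lemma k_idx_properties:
  assumes "cond_A3 r \<kappa>" "1 \<le> n"
  shows "1 \<le> k_idx \<kappa> n" "rho \<kappa> n / 2 < (\<Sum>j=1..k_idx \<kappa> n. (\<kappa> n j)\<^sup>2)"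
proof -
  note sum = rho_has_sum[OF assms]
  let ?S = "{k. (\<Sum>j\<in>{1..<k}. (\<kappa> n j)\<^sup>2) \<le> rho \<kappa> n / 2}"
  have "(\<lambda>N. \<Sum>j=1..N. (\<kappa> n j)\<^sup>2) \<longlonglongrightarrow> rho \<kappa> n"
    using sum(1) by (subst (asm) has_sum_from_1_iff_tendsto) auto
  then have "\<forall>\<^sub>F N in sequentially. rho \<kappa> n / 2 < (\<Sum>j=1..N. (\<kappa> n j)\<^sup>2)"
    using sum(2) by (intro order_tendstoD) auto
  then obtain N where N: "rho \<kappa> n / 2 < (\<Sum>j=1..N. (\<kappa> n j)\<^sup>2)"
    using eventually_happens by fastforce
  have bound: "k \<le> N" if "k \<in> ?S" for k
  proof (rule ccontr)
    assume "\<not> k \<le> N"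
    then have "(\<Sum>j=1..N. (\<kappa> n j)\<^sup>2) \<le> (\<Sum>j\<in>{1..<k}. (\<kappa> n j)\<^sup>2)"
      by (intro sum_mono2) auto
    with N that show False by simp
  qed
  then have bdd: "bdd_above ?S" by (intro bdd_aboveI)
  have "1 \<in> ?S" using sum(2) by simp
  then show "1 \<le> k_idx \<kappa> n" unfolding k_idx_def by (intro cSup_upper bdd)
  have "Suc (k_idx \<kappa> n) \<notin> ?S"
    using cSup_upper[OF _ bdd, of "Suc (k_idx \<kappa> n)"] unfolding k_idx_def by auto
  then show "rho \<kappa> n / 2 < (\<Sum>j=1..k_idx \<kappa> n. (\<kappa> n j)\<^sup>2)"
    by (simp add: atLeastLessThanSuc_atLeastAtMost)
qed

text \<open>
  Both bounds compare \<open>\<Sum>\<kappa>\<^sup>4\<close>, of order \<open>n powr - 2\<close>, with \<open>rho\<close>, of order \<open>n powr (- 2 r)\<close>.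
  Since \<open>\<Sum>\<kappa>\<^sup>4 \<le> \<kappa>\<^sub>1\<^sup>2 rho\<close>, the largest weight \<open>\<kappa>\<^sub>1\<^sup>2\<close> is at least of order \<open>n powr (2 r - 2)\<close>.
  With \<open>k = k_idx \<kappa> n\<close>, monotonicity gives \<open>k \<kappa>\<^sub>k\<^sup>4 \<le> \<Sum>\<kappa>\<^sup>4\<close> and \<open>rho / 2 \<le> k \<kappa>\<^sub>1\<^sup>2\<close>; as \<open>\<kappa>\<^sub>1\<^sup>2\<close> is at most a
  constant times \<open>\<kappa>\<^sub>k\<^sup>2\<close>, dividing the first inequality by the second bounds \<open>\<kappa>\<^sub>k\<^sup>2\<close> from above by the
  same order. The unknown \<open>k\<close> cancels.
\<close>

lemma kappa_sq_rate:
  assumes "cond_A1 \<kappa>" "cond_A2 \<sigma> \<kappa>" "cond_A3 r \<kappa>" "cond_A5 \<kappa>" "0 < \<sigma>"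
  obtains b B where "0 < b" "0 < B"
    "\<forall>\<^sub>F n in sequentially. b * real n powr (2 * r - 2) \<le> kappa_sq \<kappa> n"
    "\<forall>\<^sub>F n in sequentially. kappa_sq \<kappa> n \<le> (\<kappa> n 1)\<^sup>2 \<and> (\<kappa> n 1)\<^sup>2 \<le> B * real n powr (2 * r - 2)"
proof -
  obtain d e where d: "0 < d" and e: "0 < e"
    and de: "\<And>n. 1 \<le> n \<Longrightarrow> d * real n powr (-2 * r) \<le> rho \<kappa> n \<and> rho \<kappa> n \<le> e * real n powr (-2 * r)"
    using assms(3) unfolding cond_A3_def by blast
  obtain a A where a: "0 < a" and A: "0 < A"
    and aA: "\<And>n. 1 \<le> n \<Longrightarrow> a < A_coef \<sigma> \<kappa> n \<and> A_coef \<sigma> \<kappa> n < A"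
    using assms(2) unfolding cond_A2_def by blast
  obtain Q where Q: "0 < Q"
    and qQ: "\<forall>\<^sub>F n in sequentially. (\<kappa> n 1)\<^sup>2 \<le> Q * kappa_sq \<kappa> n"
  proof -
    from assms(4) have "(\<lambda>n. (\<kappa> n 1)\<^sup>2) \<in> O(kappa_sq \<kappa>)"
      unfolding cond_A5_def by (auto simp: bigtheta_def)
    then obtain Q where "0 < Q" "\<forall>\<^sub>F n in sequentially. norm ((\<kappa> n 1)\<^sup>2) \<le> Q * norm (kappa_sq \<kappa> n)"
      by (elim landau_o.bigE) blast
    then show ?thesis using that[of Q] by (simp add: kappa_sq_def)
  qed
  define K4 where "K4 n = \<sigma> ^ 4 * A_coef \<sigma> \<kappa> n / (real n)\<^sup>2" for n
  have K4: "((\<lambda>j. \<kappa> n j ^ 4) has_sum K4 n) {1..}" if "1 \<le> n" for n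
    unfolding K4_def using A_coef_has_sum(1)[OF assms(2) that assms(5)] .
  have pow: "real n powr (2 * r - 2) = real n powr (2 * r) / (real n)\<^sup>2"
     "real n powr (-2 * r) = inverse (real n powr (2 * r))" "0 < real n powr (2 * r)" "0 < real n" 
    if "1 \<le> n" for n
    using that by (simp_all add: powr_diff powr_minus flip: powr_numeral)
  have lower: "\<sigma> ^ 4 * a / e * real n powr (2 * r - 2) \<le> (\<kappa> n 1)\<^sup>2" if n: "1 \<le> n" for n
  proof -
    have "K4 n \<le> (\<kappa> n 1)\<^sup>2 * rho \<kappa> n"
    proof (rule has_sum_mono[OF K4[OF n]])
      show "((\<lambda>j. (\<kappa> n 1)\<^sup>2 * (\<kappa> n j)\<^sup>2) has_sum (\<kappa> n 1)\<^sup>2 * rho \<kappa> n) {1..}"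
        by (intro has_sum_cmult_right rho_has_sum[OF assms(3) n])
      show "\<kappa> n j ^ 4 \<le> (\<kappa> n 1)\<^sup>2 * (\<kappa> n j)\<^sup>2" if "j \<in> {1..}" for j
        using kappa_sq_antimono[OF assms(1) n, of 1 j] that
        by (metis atLeast_iff le_refl mult_right_mono power2_eq_square power4_eq_xxxx mult.assoc zero_le_power2)
    qed
    also have "\<dots> \<le> (\<kappa> n 1)\<^sup>2 * (e * real n powr (-2 * r))"
      using de[OF n] by (intro mult_left_mono) auto
    finally have "K4 n \<le> (\<kappa> n 1)\<^sup>2 * (e * real n powr (-2 * r))" .
    moreover have "\<sigma> ^ 4 * a / (real n)\<^sup>2 \<le> K4 n"
      unfolding K4_def using aA[OF n] assms(5) by (intro divide_right_mono mult_left_mono) auto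
    ultimately have "\<sigma> ^ 4 * a / (real n)\<^sup>2 \<le> (\<kappa> n 1)\<^sup>2 * (e * real n powr (-2 * r))" by linarith
    then show ?thesis unfolding pow(1,2)[OF n] using e pow(3)[OF n] pow(4)[OF n]
      by (simp add: field_simps)
  qed
  have upper: "kappa_sq \<kappa> n \<le> (2 * Q * \<sigma> ^ 4 * A / d) * real n powr (2 * r - 2)" 
    if n: "1 \<le> n" and Qn: "(\<kappa> n 1)\<^sup>2 \<le> Q * kappa_sq \<kappa> n" for n
  proof -
    define k where "k = k_idx \<kappa> n"
    note k = k_idx_properties[OF assms(3) n, folded k_def]
    have pos: "0 < kappa_sq \<kappa> n"
    proof -
      have "0 < (\<kappa> n 1)\<^sup>2" using lower[OF n] pow[OF n] a e assms(5)
        by (smt (verit) divide_pos_pos mult_pos_pos zero_less_power)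
      with Qn Q show ?thesis by (metis less_le_trans zero_less_mult_pos)
    qed
    have "d * real n powr (-2 * r) / 2 \<le> rho \<kappa> n / 2" using de[OF n] by simp
    also have "\<dots> \<le> (\<Sum>j=1..k. (\<kappa> n j)\<^sup>2)" using k(2) by simp
    also have "\<dots> \<le> (\<Sum>j=1..k. (\<kappa> n 1)\<^sup>2)"
      by (intro sum_mono kappa_sq_antimono[OF assms(1) n]) auto
    also have "\<dots> \<le> real k * (Q * kappa_sq \<kappa> n)"
      using Qn by (simp add: mult_left_mono)
    finally have 1: "d * real n powr (-2 * r) / 2 \<le> real k * (Q * kappa_sq \<kappa> n)" .
    have "real k * (kappa_sq \<kappa> n)\<^sup>2 = (\<Sum>j=1..k. (kappa_sq \<kappa> n)\<^sup>2)" by simp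
    also have "\<dots> \<le> (\<Sum>j=1..k. \<kappa> n j ^ 4)"
    proof (rule sum_mono)
      fix j assume "j \<in> {1..k}"
      then have "kappa_sq \<kappa> n \<le> (\<kappa> n j)\<^sup>2"
        unfolding kappa_sq_def k_def[symmetric] by (intro kappa_sq_antimono[OF assms(1) n]) auto
      then have "(kappa_sq \<kappa> n)\<^sup>2 \<le> ((\<kappa> n j)\<^sup>2)\<^sup>2" using pos by (intro power_mono) auto
      then show "(kappa_sq \<kappa> n)\<^sup>2 \<le> \<kappa> n j ^ 4" by simp
    qed
    also have "\<dots> \<le> K4 n"
      by (rule finite_sum_le_has_sum[OF K4[OF n]]) auto
    also have "\<dots> \<le> \<sigma> ^ 4 * A / (real n)\<^sup>2"
      unfolding K4_def using aA[OF n] assms(5) by (intro divide_right_mono mult_left_mono) auto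
    finally have 2: "real k * (kappa_sq \<kappa> n)\<^sup>2 \<le> \<sigma> ^ 4 * A / (real n)\<^sup>2" .
    have "kappa_sq \<kappa> n * (d * real n powr (-2 * r) / 2) \<le> kappa_sq \<kappa> n * (real k * (Q * kappa_sq \<kappa> n))"
      using 1 pos by (intro mult_left_mono) auto
    also have "\<dots> = Q * (real k * (kappa_sq \<kappa> n)\<^sup>2)" by (simp add: power2_eq_square)
    also have "\<dots> \<le> Q * (\<sigma> ^ 4 * A / (real n)\<^sup>2)" using 2 Q by (intro mult_left_mono) auto
    finally show ?thesis unfolding pow(1,2)[OF n] using d pow(3)[OF n] pow(4)[OF n]
      by (simp add: field_simps)
  qed
  define U where "U = 2 * Q * \<sigma> ^ 4 * A / d"
  show ?thesis
  proof
    show "0 < \<sigma> ^ 4 * a / e / Q" using assms(5) a e Q by simp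
    show "0 < Q * U" using assms(5) A d Q by (simp add: U_def)
    show "\<forall>\<^sub>F n in sequentially. \<sigma> ^ 4 * a / e / Q * real n powr (2 * r - 2) \<le> kappa_sq \<kappa> n"
      using qQ eventually_ge_at_top[of 1]
    proof eventually_elim
      case (elim n)
      then have "\<sigma> ^ 4 * a / e * real n powr (2 * r - 2) \<le> Q * kappa_sq \<kappa> n"
        using lower[of n] by linarith
      then have "\<sigma> ^ 4 * a / e * real n powr (2 * r - 2) / Q \<le> kappa_sq \<kappa> n"
        by (subst pos_divide_le_eq[OF Q]) (simp add: mult.commute)
      then show ?case by simp
    qed
    show "\<forall>\<^sub>F n in sequentially. kappa_sq \<kappa> n \<le> (\<kappa> n 1)\<^sup>2 \<and> (\<kappa> n 1)\<^sup>2 \<le> Q * U * real n powr (2 * r - 2)"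
      using qQ eventually_ge_at_top[of 1]
    proof eventually_elim
      case (elim n)
      have "(\<kappa> n 1)\<^sup>2 \<le> Q * kappa_sq \<kappa> n" by fact
      also have "\<dots> \<le> Q * (U * real n powr (2 * r - 2))"
        using upper[of n] elim Q by (intro mult_left_mono) (auto simp: U_def)
      finally have "(\<kappa> n 1)\<^sup>2 \<le> Q * U * real n powr (2 * r - 2)" by (simp add: mult.assoc)
      moreover have "kappa_sq \<kappa> n \<le> (\<kappa> n 1)\<^sup>2"
        unfolding kappa_sq_def using elim k_idx_properties(1)[OF assms(3), of n]
        by (intro kappa_sq_antimono[OF assms(1)]) auto
      ultimately show ?case by simp
    qed
  qed
qed

section \<open>A central limit theorem for weighted sums, uniformly on the line\<close>

lemma exp_neg_quadratic_approx:
  fixes u :: real assumes "0 \<le> u"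
  shows "\<bar>exp (- u) - (1 - u)\<bar> \<le> u\<^sup>2"
proof -
  have lower: "1 - u \<le> exp (- u)" using exp_ge_add_one_self[of "- u"] by simp
  have "exp (-u) \<le> 1 - u + u\<^sup>2"
  proof (cases "u \<le> 1")
    case True
    have "exp (- u) * (1 + u) \<le> exp (-u) * exp u"
      by (intro mult_left_mono) auto
    also have "\<dots> = 1" by (simp flip: exp_add)
    finally have "exp (- u) \<le> 1 / (1 + u)" using assms by (simp add: field_simps)
    also have "\<dots> \<le> 1 - u + u\<^sup>2"
      using assms by (simp add: field_simps power2_eq_square)
    finally show ?thesis .
  next
    case False
    have "exp (- u) \<le> 1" using assms by simp
    also have "1 \<le> 1 - u + u\<^sup>2" using False by (simp add: power2_eq_square)
    finally show ?thesis .
  qed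
  with lower show ?thesis by simp
qed

text \<open>
  A Lyapunov central limit theorem for triangular arrays of the form \<open>b n j * X j\<close> with third moments
  of \<open>X j\<close> bounded by \<open>B\<close>. Each characteristic function differs from the Gaussian one with the same
  variance by at most a constant times \<open>\<epsilon> n * (b n j)\<^sup>2\<close>; the product over \<open>j\<close> then differs by at most a
  constant times \<open>\<epsilon> n\<close>, because the squared weights add up to one. Levy's continuity theorem concludes.
\<close>

lemma (in prob_space) weighted_clt:
  fixes X :: "nat \<Rightarrow> 'a \<Rightarrow> real" and b :: "nat \<Rightarrow> nat \<Rightarrow> real" and J :: "nat \<Rightarrow> nat set" and B :: real
  assumes indep: "indep_vars (\<lambda>_. borel) X I" and J: "\<And>n. J n \<subseteq> I" "\<And>n. finite (J n)"
    and int: "\<And>j. j \<in> I \<Longrightarrow> integrable M (\<lambda>\<omega>. (X j \<omega>)\<^sup>2)"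
      "\<And>j. j \<in> I \<Longrightarrow> integrable M (\<lambda>\<omega>. \<bar>X j \<omega>\<bar> ^ 3)"
    and mean: "\<And>j. j \<in> I \<Longrightarrow> expectation (X j) = 0"
    and var: "\<And>j. j \<in> I \<Longrightarrow> expectation (\<lambda>\<omega>. (X j \<omega>)\<^sup>2) = 1"
    and third: "\<And>j. j \<in> I \<Longrightarrow> expectation (\<lambda>\<omega>. \<bar>X j \<omega>\<bar> ^ 3) \<le> B"
    and norm: "\<And>n. (\<Sum>j\<in>J n. (b n j)\<^sup>2) = 1"
    and small: "\<And>n j. j \<in> J n \<Longrightarrow> \<bar>b n j\<bar> \<le> \<epsilon> n" and \<epsilon>: "\<epsilon> \<longlonglongrightarrow> 0"
  shows "weak_conv_m (\<lambda>n. distr M borel (\<lambda>\<omega>. \<Sum>j\<in>J n. b n j * X j \<omega>)) std_normal_distribution"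
proof (rule levy_continuity)
  have rv [measurable]: "random_variable borel (X j)" if "j \<in> I" for j
    using indep that by (auto simp: indep_vars_def2)
  have integrable_X: "integrable M (X j)" if "j \<in> I" for j
    by (rule square_integrable_imp_integrable) (use that int rv in auto)
  show "real_distribution (distr M borel (\<lambda>\<omega>. \<Sum>j\<in>J n. b n j * X j \<omega>))" for n
    by (intro real_distribution_distr borel_measurable_sum borel_measurable_times)
       (use J(1)[of n] rv in auto)
  show "real_distribution std_normal_distribution" by (rule real_dist_normal_dist)
  fix t :: real
  let ?c = "\<lambda>n j. char (distr M borel (\<lambda>\<omega>. b n j * X j \<omega>)) t"
  let ?e = "\<lambda>n j. complex_of_real (exp (- ((t * b n j)\<^sup>2 / 2)))"
  have B: "0 \<le> B" if "j \<in> I" for j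
    by (rule order_trans[OF _ third[OF that]]) (auto intro: integral_nonneg_AE)
  have factor: "norm (?c n j - ?e n j) \<le> (\<bar>t\<bar> ^ 3 * B * \<epsilon> n + t ^ 4 * (\<epsilon> n)\<^sup>2) * (b n j)\<^sup>2"
    if j: "j \<in> J n" for n j
  proof -
    have I: "j \<in> I" using j J by auto
    let ?Y = "\<lambda>\<omega>. b n j * X j \<omega>"
    have Y: "integrable M ?Y" "integrable M (\<lambda>\<omega>. (?Y \<omega>)\<^sup>2)" "expectation ?Y = 0"
      using integrable_X[OF I] int[OF I] mean[OF I] by (auto simp: power_mult_distrib)
    have varY: "variance ?Y = (b n j)\<^sup>2"
      unfolding Y(3) using var[OF I] by (simp add: power_mult_distrib)
    have cube: "integrable M (\<lambda>\<omega>. \<bar>t\<bar> * (\<bar>b n j\<bar> ^ 3 * \<bar>X j \<omega>\<bar> ^ 3))"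
      using int(2)[OF I] by auto
    have "norm (?c n j - (1 - t\<^sup>2 * (b n j)\<^sup>2 / 2)) \<le>
        t\<^sup>2 / 6 * expectation (\<lambda>\<omega>. min (6 * (?Y \<omega>)\<^sup>2) (\<bar>t\<bar> * \<bar>?Y \<omega>\<bar> ^ 3))"
      by (rule char_approx3'[OF _ Y varY refl]) (use rv[OF I] in measurable)
    also have "\<dots> \<le> t\<^sup>2 / 6 * expectation (\<lambda>\<omega>. \<bar>t\<bar> * (\<bar>b n j\<bar> ^ 3 * \<bar>X j \<omega>\<bar> ^ 3))"
    proof (intro mult_left_mono integral_mono cube)
      show "integrable M (\<lambda>\<omega>. min (6 * (?Y \<omega>)\<^sup>2) (\<bar>t\<bar> * \<bar>?Y \<omega>\<bar> ^ 3))"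
        by (rule Bochner_Integration.integrable_bound[OF cube])
           (use rv[OF I] in \<open>auto simp: abs_mult power_mult_distrib\<close>)
    qed (auto simp: abs_mult power_mult_distrib)
    also have "\<dots> = t\<^sup>2 / 6 * (\<bar>t\<bar> * (\<bar>b n j\<bar> ^ 3 * expectation (\<lambda>\<omega>. \<bar>X j \<omega>\<bar> ^ 3)))"
      by simp
    also have "\<dots> \<le> t\<^sup>2 * (\<bar>t\<bar> * ((\<epsilon> n * (b n j)\<^sup>2) * B))"
    proof (intro mult_mono)
      have "\<bar>b n j\<bar> ^ 3 = \<bar>b n j\<bar> * (b n j)\<^sup>2"
        by (simp add: power3_eq_cube power2_eq_square flip: abs_mult)
      then show "\<bar>b n j\<bar> ^ 3 \<le> \<epsilon> n * (b n j)\<^sup>2"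
        using small[OF j] by (simp add: mult_right_mono)
    qed (use third[OF I] B[OF I] small[OF j] in auto)
    also have "t\<^sup>2 * (\<bar>t\<bar> * ((\<epsilon> n * (b n j)\<^sup>2) * B)) = \<bar>t\<bar> ^ 3 * B * \<epsilon> n * (b n j)\<^sup>2"
      by (simp add: power3_eq_cube power2_eq_square flip: abs_mult)
    finally have 1: "norm (?c n j - (1 - t\<^sup>2 * (b n j)\<^sup>2 / 2)) \<le> \<bar>t\<bar> ^ 3 * B * \<epsilon> n * (b n j)\<^sup>2" .
    let ?u = "(t * b n j)\<^sup>2 / 2"
    have "norm (?e n j - (1 - t\<^sup>2 * (b n j)\<^sup>2 / 2)) = \<bar>exp (- ?u) - (1 - ?u)\<bar>"
    proof -
      have "?e n j - (1 - t\<^sup>2 * (b n j)\<^sup>2 / 2) = complex_of_real (exp (- ?u) - (1 - ?u))"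
        by (simp add: power_mult_distrib)
      then show ?thesis by (simp only: norm_of_real)
    qed
    also have "\<dots> \<le> ?u\<^sup>2" by (intro exp_neg_quadratic_approx) auto
    also have "\<dots> = t ^ 4 * ((b n j)\<^sup>2 * (b n j)\<^sup>2) / 4"
      by (simp add: power2_eq_square power4_eq_xxxx)
    also have "\<dots> \<le> t ^ 4 * ((\<epsilon> n)\<^sup>2 * (b n j)\<^sup>2)"
    proof -
      have "(b n j)\<^sup>2 \<le> (\<epsilon> n)\<^sup>2"
        using small[OF j] by (metis abs_ge_zero power2_abs power_mono)
      then have "t ^ 4 * ((b n j)\<^sup>2 * (b n j)\<^sup>2) \<le> t ^ 4 * ((\<epsilon> n)\<^sup>2 * (b n j)\<^sup>2)"
        by (intro mult_left_mono mult_right_mono) auto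
      moreover have "0 \<le> t ^ 4 * ((b n j)\<^sup>2 * (b n j)\<^sup>2)" by simp
      ultimately show ?thesis by linarith
    qed
    finally have 2: "norm (?e n j - (1 - t\<^sup>2 * (b n j)\<^sup>2 / 2)) \<le> t ^ 4 * (\<epsilon> n)\<^sup>2 * (b n j)\<^sup>2"
      by (simp add: mult.assoc)
    show ?thesis
      using norm_triangle_ineq4[of "?c n j - (1 - t\<^sup>2 * (b n j)\<^sup>2 / 2)" "?e n j - (1 - t\<^sup>2 * (b n j)\<^sup>2 / 2)"] 1 2
      by (simp add: distrib_right)
  qed
  have main: "norm (char (distr M borel (\<lambda>\<omega>. \<Sum>j\<in>J n. b n j * X j \<omega>)) t -
      char std_normal_distribution t) \<le> \<bar>t\<bar> ^ 3 * B * \<epsilon> n + t ^ 4 * (\<epsilon> n)\<^sup>2" for n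
  proof -
    have c: "char (distr M borel (\<lambda>\<omega>. \<Sum>j\<in>J n. b n j * X j \<omega>)) t = (\<Prod>j\<in>J n. ?c n j)"
      by (rule char_distr_sum, rule indep_vars_compose2[where X=X])
         (auto intro: indep_vars_subset[OF indep J(1)])
    have "(\<Prod>j\<in>J n. exp (- ((t * b n j)\<^sup>2 / 2))) = exp (\<Sum>j\<in>J n. - ((t * b n j)\<^sup>2 / 2))"
      using J by (simp add: exp_sum)
    also have "(\<Sum>j\<in>J n. - ((t * b n j)\<^sup>2 / 2)) = - (t\<^sup>2 / 2) * (\<Sum>j\<in>J n. (b n j)\<^sup>2)"
      by (simp add: sum_distrib_left power_mult_distrib sum_negf)
    finally have e: "char std_normal_distribution t = (\<Prod>j\<in>J n. ?e n j)"
      by (simp add: char_std_normal_distribution norm flip: of_real_prod)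
    have "norm ((\<Prod>j\<in>J n. ?c n j) - (\<Prod>j\<in>J n. ?e n j)) \<le> (\<Sum>j\<in>J n. norm (?c n j - ?e n j))"
    proof (intro norm_prod_diff)
      fix j assume "j \<in> J n"
      then have "j \<in> I" using J(1) by auto
      then have [measurable]: "random_variable borel (X j)" by (rule rv)
      have "real_distribution (distr M borel (\<lambda>\<omega>. b n j * X j \<omega>))"
        by (intro real_distribution_distr) measurable
      then show "norm (?c n j) \<le> 1" by (rule real_distribution.cmod_char_le_1)
    qed auto
    also have "\<dots> \<le> (\<Sum>j\<in>J n. (\<bar>t\<bar> ^ 3 * B * \<epsilon> n + t ^ 4 * (\<epsilon> n)\<^sup>2) * (b n j)\<^sup>2)"
      by (intro sum_mono factor)
    also have "\<dots> = \<bar>t\<bar> ^ 3 * B * \<epsilon> n + t ^ 4 * (\<epsilon> n)\<^sup>2"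
      by (simp add: norm flip: sum_distrib_left)
    finally show ?thesis unfolding c e .
  qed
  have "(\<lambda>n. \<bar>t\<bar> ^ 3 * B * \<epsilon> n + t ^ 4 * (\<epsilon> n)\<^sup>2) \<longlonglongrightarrow> \<bar>t\<bar> ^ 3 * B * 0 + t ^ 4 * 0\<^sup>2"
    by (intro tendsto_intros \<epsilon>)
  then have "(\<lambda>n. \<bar>t\<bar> ^ 3 * B * \<epsilon> n + t ^ 4 * (\<epsilon> n)\<^sup>2) \<longlonglongrightarrow> 0" by simp
  then show "(\<lambda>n. char (distr M borel (\<lambda>\<omega>. \<Sum>j\<in>J n. b n j * X j \<omega>)) t) \<longlonglongrightarrow>
      char std_normal_distribution t"
    by (rule LIM_zero_cancel[OF Lim_null_comparison[OF eventuallyI[OF main]]])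
qed

text \<open>
  Polya's theorem: pointwise convergence of distribution functions to a continuous one is uniform.
  The quantiles \<open>p k\<close> with \<open>G (p k) = k / K\<close> form a finite grid on which convergence is uniform, and by
  monotonicity the values at \<open>x\<close> are trapped between those at neighbouring grid points.
\<close>

lemma weak_limit_uniform:
  assumes conv: "\<And>x. (\<lambda>n. F n x) \<longlonglongrightarrow> (G x :: real)"
    and F: "\<And>n. mono (F n)" "\<And>n x. 0 \<le> F n x" "\<And>n x. F n x \<le> 1"
    and G: "mono G" "\<And>x. isCont G x" "(G \<longlongrightarrow> 0) at_bot" "(G \<longlongrightarrow> 1) at_top"
    and \<epsilon>: "0 < \<epsilon>"
  shows "\<forall>\<^sub>F n in sequentially. \<forall>x::real. \<bar>F n x - G x\<bar> \<le> \<epsilon>"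
proof -
  obtain K :: nat where K: "0 < K" "1 / real K < \<epsilon> / 3"
    using nat_approx_posE[of "\<epsilon> / 3"] \<epsilon> by (metis divide_pos_pos zero_less_numeral zero_less_Suc)
  have "\<exists>x. G x = real k / real K" if k: "k \<in> {1..<K}" for k
  proof -
    have "\<forall>\<^sub>F x in at_bot. G x < real k / real K"
      using G(3) k K by (intro order_tendstoD(2)) auto
    then obtain a where a: "G a < real k / real K" 
      using eventually_happens by fastforce
    have "\<forall>\<^sub>F x in at_top. real k / real K < G x"
      using G(4) k K by (intro order_tendstoD(1)) auto
    then obtain c where c: "real k / real K < G c" 
      using eventually_happens by fastforce
    have "a \<le> c" using a c monoD[OF G(1), of c a] by linarith
    then show ?thesis using IVT[of G a "real k / real K" c] a c G(2) by auto
  qed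
  then obtain p where p: "\<And>k. k \<in> {1..<K} \<Longrightarrow> G (p k) = real k / real K" by metis
  have "\<forall>\<^sub>F n in sequentially. \<forall>k\<in>{1..<K}. \<bar>F n (p k) - G (p k)\<bar> < \<epsilon> / 3"
  proof (intro eventually_ball_finite ballI)
    fix k
    have "\<forall>\<^sub>F n in sequentially. dist (F n (p k)) (G (p k)) < \<epsilon> / 3"
      using conv[of "p k"] \<epsilon> by (intro tendstoD) auto
    then show "\<forall>\<^sub>F n in sequentially. \<bar>F n (p k) - G (p k)\<bar> < \<epsilon> / 3"
      by (simp add: dist_real_def)
  qed auto
  then show ?thesis
  proof eventually_elim
    case (elim n)
    show ?case
    proof
      fix x
      have G01: "0 \<le> G x" "G x \<le> 1"
        using LIMSEQ_le_const[OF conv[of x]] LIMSEQ_le_const2[OF conv[of x]] F by blast+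
      define k where "k = nat \<lfloor>G x * real K\<rfloor>"
      have k: "real k \<le> G x * real K" "G x * real K < real k + 1"
        using G01 K unfolding k_def by (auto simp: of_nat_nat)
      have k': "real k / real K \<le> G x" "G x < (real k + 1) / real K"
        using k K by (simp_all add: field_simps)
      have up: "F n x \<le> G x + \<epsilon>"
      proof (cases "k + 1 < K")
        case True
        then have Gp: "G (p (k + 1)) = (real k + 1) / real K" using p[of "k+1"] by simp
        have "x \<le> p (k + 1)" using Gp k' monoD[OF G(1), of "p (k + 1)" x] by linarith
        then have "F n x \<le> F n (p (k + 1))" using F(1) by (simp add: monoD)
        also have "\<dots> < G (p (k + 1)) + \<epsilon> / 3" using elim[rule_format, of "k+1"] True unfolding abs_less_iff by auto
        also have "G (p (k + 1)) \<le> G x + 1 / real K" using Gp k' by (simp add: add_divide_distrib)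
        finally show ?thesis using K(2) \<epsilon> by linarith
      next
        case False
        then have "real K \<le> real k + 1" by linarith
        then have "real K / real K \<le> (real k + 1) / real K" by (intro divide_right_mono) auto
        then have "1 - 1 / real K \<le> real k / real K" using K(1) by (simp add: add_divide_distrib)
        then show ?thesis using F(3)[of n x] k' K \<epsilon> by linarith
      qed
      have lo: "G x - \<epsilon> \<le> F n x"
      proof (cases "2 \<le> k")
        case True
        have "G x * real K \<le> 1 * real K" using G01 by (intro mult_right_mono) auto
        then have "real k \<le> real K" using k(1) by linarith
        then have mem: "k - 1 \<in> {1..<K}" using True by auto
        then have Gp: "G (p (k - 1)) = real k / real K - 1 / real K" 
          using p[of "k-1"] True by (simp add: of_nat_diff diff_divide_distrib)
        \<comment> \<open>The grid point \<open>p k\<close> itself may lie to the right of \<open>x\<close>, since \<open>G\<close> may be constant around \<open>x\<close>;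
            a strict inequality between the values of \<open>G\<close> is needed, hence the step back to \<open>k - 1\<close>.\<close>
        have "p (k - 1) \<le> x" using Gp k' K monoD[OF G(1), of x "p (k - 1)"]
          by (smt (verit) zero_less_divide_1_iff of_nat_0_less_iff)
        then have "F n (p (k - 1)) \<le> F n x" using F(1) by (simp add: monoD)
        moreover have "G (p (k - 1)) - \<epsilon> / 3 < F n (p (k - 1))" using elim[rule_format, OF mem] unfolding abs_less_iff by linarith
        moreover have "G x \<le> real k / real K + 1 / real K" using k' by (simp add: add_divide_distrib)
        ultimately show ?thesis using K Gp by linarith
      next
        case False
        then have "(real k + 1) / real K \<le> 2 * (1 / real K)" using K by (simp add: field_simps)
        then show ?thesis using F(2)[of n x] k' K \<epsilon> by linarith
      qed
      show "\<bar>F n x - G x\<bar> \<le> \<epsilon>" using up lo by linarith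
    qed
  qed
qed

abbreviation std_normal_cdf :: "real \<Rightarrow> real" where
  "std_normal_cdf \<equiv> cdf std_normal_distribution"

interpretation std_normal: real_distribution std_normal_distribution
  by (rule real_dist_normal_dist)

lemma std_normal_cdf_diff:
  assumes "x \<le> y"
  shows "std_normal_cdf y - std_normal_cdf x = (LBINT t:{x<..y}. std_normal_density t)"
proof (cases "x < y")
  case True
  then have "std_normal_cdf y - std_normal_cdf x = measure std_normal_distribution {x<..y}"
    by (rule std_normal.cdf_diff_eq)
  also have "\<dots> = (LINT t|std_normal_distribution. indicator {x<..y} t)"
    by simp
  also have "\<dots> = (LBINT t:{x<..y}. std_normal_density t)"
    by (subst integral_density) (auto simp: set_lebesgue_integral_def mult.commute)
  finally show ?thesis .
qed (use assms in \<open>auto simp: set_lebesgue_integral_def\<close>)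

lemma std_normal_density_le_1: "std_normal_density t \<le> 1"
proof -
  have "std_normal_density t = (1 / sqrt (2 * pi)) * exp (- t\<^sup>2 / 2)"
    by (simp add: std_normal_density_def)
  also have "\<dots> \<le> 1 * 1"
    using pi_gt3 by (intro mult_mono) auto
  finally show ?thesis by simp
qed

lemma std_normal_cdf_lipschitz:
  assumes "x \<le> y"
  shows "std_normal_cdf y - std_normal_cdf x \<le> y - x"
proof -
  have "(LBINT t:{x<..y}. std_normal_density t) \<le> (LBINT t:{x<..y}. 1)"
    unfolding set_lebesgue_integral_def
  proof (intro integral_mono)
    show "integrable lborel (\<lambda>t. indicator {x<..y} t *\<^sub>R std_normal_density t)"
      by (intro integrable_mult_indicator) auto
    show "integrable lborel (\<lambda>t. indicator {x<..y} t *\<^sub>R (1::real))"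
      using assms by (auto intro!: integrable_real_indicator)
  qed (auto split: split_indicator simp: std_normal_density_le_1)
  then show ?thesis using assms by (simp add: std_normal_cdf_diff set_lebesgue_integral_def)
qed

lemma std_normal_cdf_strict:
  assumes "x < y"
  shows "std_normal_cdf x < std_normal_cdf y"
proof -
  have "std_normal_cdf x \<noteq> std_normal_cdf y"
  proof
    assume "std_normal_cdf x = std_normal_cdf y"
    then have "measure std_normal_distribution {x<..y} = 0"
      using std_normal.cdf_diff_eq[OF assms] by simp
    then have "emeasure std_normal_distribution {x<..y} = 0"
      by (simp add: std_normal.emeasure_eq_measure)
    then have "AE t in lborel. t \<in> {x<..y} \<longrightarrow> ennreal (std_normal_density t) = 0"
      by (subst (asm) emeasure_density) (auto simp: nn_integral_0_iff_AE indicator_def)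
    then have "AE t in lborel. t \<notin> {x<..y}"
    proof eventually_elim
      case (elim t)
      moreover have "0 < std_normal_density t" by (simp add: normal_density_pos)
      ultimately show ?case by (metis ennreal_eq_0_iff not_le)
    qed
    then have "emeasure lborel {x<..y} = 0"
      by (subst (asm) AE_iff_measurable[of "{x<..y}"]) auto
    with assms show False by simp
  qed
  then show ?thesis using std_normal.cdf_nondecreasing[of x y] assms by simp
qed

lemma isCont_std_normal_cdf: "isCont std_normal_cdf x"
proof -
  have "\<bar>std_normal_cdf y - std_normal_cdf z\<bar> \<le> 1 * \<bar>y - z\<bar>" for y z
    using std_normal_cdf_lipschitz[of y z] std_normal_cdf_lipschitz[of z y]
      std_normal.cdf_nondecreasing[of y z] std_normal.cdf_nondecreasing[of z y]
    by (cases "y \<le> z") auto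
  then have "1-lipschitz_on UNIV std_normal_cdf"
    by (intro lipschitz_onI) (auto simp: dist_real_def)
  then have "continuous_on UNIV std_normal_cdf" by (rule lipschitz_on_continuous_on)
  then show ?thesis by (simp add: continuous_on_eq_continuous_at)
qed

text \<open>
  Uniformity in the argument is what permits arbitrary thresholds, varying with the noise level, in
  the definitions of consistency and inconsistency.
\<close>

lemma weak_conv_std_normal_uniform:
  assumes "weak_conv_m D std_normal_distribution" "\<And>n. real_distribution (D n)" "0 < \<epsilon>"
  shows "\<forall>\<^sub>F n in sequentially. \<forall>x. \<bar>cdf (D n) x - std_normal_cdf x\<bar> \<le> \<epsilon>"
proof (rule weak_limit_uniform)
  show "(\<lambda>n. cdf (D n) x) \<longlonglongrightarrow> std_normal_cdf x" for x
    using assms(1) isCont_std_normal_cdf by (auto simp: weak_conv_m_def weak_conv_def)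
  show "mono (cdf (D n))" "0 \<le> cdf (D n) x" "cdf (D n) x \<le> 1" for n x
  proof -
    interpret real_distribution "D n" by fact
    show "mono (cdf (D n))" "0 \<le> cdf (D n) x" "cdf (D n) x \<le> 1"
      by (auto intro: monoI cdf_nondecreasing cdf_nonneg cdf_bounded_prob)
  qed
  show "mono std_normal_cdf" by (intro monoI std_normal.cdf_nondecreasing)
qed (use assms isCont_std_normal_cdf std_normal.cdf_lim_at_bot std_normal.cdf_lim_at_top_prob in auto)

section \<open>Nonnegative series and Gaussian quadratic forms\<close>

text \<open>
  For nonnegative terms the set-indexed real sum is a function of a series in the extended reals
  \<open>[0, \<infinity>]\<close>, where measurability and monotone convergence are available; the value \<open>0\<close> of a divergent
  sum agrees with \<open>enn2real \<top>\<close>.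
\<close>

lemma infsum_from_1_eq_enn2real:
  fixes h :: "nat \<Rightarrow> real"
  assumes "\<And>j. 0 \<le> h j"
  shows "(\<Sum>\<^sub>\<infinity>j\<in>{1..}. h j) = enn2real (\<Sum>j. ennreal (h (Suc j)))"
    and "(\<Sum>j. ennreal (h (Suc j))) \<noteq> \<top> \<Longrightarrow> h summable_on {1..}"
proof -
  have iff: "(h has_sum S) {1..} \<longleftrightarrow> (\<lambda>j. h (Suc j)) sums S" for S
    using assms by (subst has_sum_from_1_iff_tendsto) (auto simp: sums_def sum.atLeast1_atMost_eq)
  show *: "h summable_on {1..}" if "(\<Sum>j. ennreal (h (Suc j))) \<noteq> \<top>"
    using summable_suminf_not_top[OF _ that] assms iff by (auto simp: summable_on_def summable_def)
  show "(\<Sum>\<^sub>\<infinity>j\<in>{1..}. h j) = enn2real (\<Sum>j. ennreal (h (Suc j)))"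
  proof (cases "h summable_on {1..}")
    case True
    then have s: "(\<lambda>j. h (Suc j)) sums (\<Sum>\<^sub>\<infinity>j\<in>{1..}. h j)"
      using iff has_sum_infsum by blast
    then have "(\<Sum>j. ennreal (h (Suc j))) = ennreal (\<Sum>\<^sub>\<infinity>j\<in>{1..}. h j)"
      using assms by (subst suminf_ennreal2) (auto simp: sums_iff)
    then show ?thesis using assms by (simp add: infsum_nonneg)
  next
    case False
    then have "(\<Sum>j. ennreal (h (Suc j))) = \<top>" using * by blast
    with False show ?thesis by (simp add: infsum_not_exists)
  qed
qed

text \<open>
  Monotone convergence for a series of nonnegative random terms. Applied to the test statistic, it yields
  its measurability, its almost sure convergence and its expectation.
\<close>

lemma nonneg_series_expectation:
  fixes h :: "nat \<Rightarrow> 'a \<Rightarrow> real"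
  assumes int: "\<And>j. 1 \<le> j \<Longrightarrow> integrable M (h j)" and nonneg: "\<And>j \<omega>. 0 \<le> h j \<omega>"
    and sum: "((\<lambda>j. integral\<^sup>L M (h j)) has_sum S) {1..}"
  shows "(\<lambda>\<omega>. \<Sum>\<^sub>\<infinity>j\<in>{1..}. h j \<omega>) \<in> borel_measurable M"
    and "AE \<omega> in M. (\<lambda>j. h j \<omega>) summable_on {1..}"
    and "has_bochner_integral M (\<lambda>\<omega>. \<Sum>\<^sub>\<infinity>j\<in>{1..}. h j \<omega>) S"
proof -
  have meas [measurable]: "h (Suc j) \<in> borel_measurable M" for j
    using int[of "Suc j"] by auto
  let ?W = "\<lambda>\<omega>. \<Sum>j. ennreal (h (Suc j) \<omega>)"
  show measurable [measurable]: "(\<lambda>\<omega>. \<Sum>\<^sub>\<infinity>j\<in>{1..}. h j \<omega>) \<in> borel_measurable M"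
    by (subst infsum_from_1_eq_enn2real(1)) (auto simp: nonneg)
  have "(\<lambda>j. integral\<^sup>L M (h (Suc j))) sums S"
    using sum nonneg by (subst (asm) has_sum_from_1_iff_tendsto) (auto simp: sums_def sum.atLeast1_atMost_eq)
  then have S: "(\<Sum>j. ennreal (integral\<^sup>L M (h (Suc j)))) = ennreal S" and S0: "0 \<le> S"
    using nonneg by (auto simp: sums_iff suminf_ennreal2 intro!: suminf_nonneg)
  have "(\<integral>\<^sup>+\<omega>. ?W \<omega> \<partial>M) = (\<Sum>j. \<integral>\<^sup>+\<omega>. ennreal (h (Suc j) \<omega>) \<partial>M)"
    by (rule nn_integral_suminf) measurable
  also have "\<dots> = ennreal S"
    unfolding S[symmetric] using int nonneg by (intro suminf_cong nn_integral_eq_integral) auto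
  finally have W: "(\<integral>\<^sup>+\<omega>. ?W \<omega> \<partial>M) = ennreal S" .
  have "AE \<omega> in M. ?W \<omega> \<noteq> \<infinity>"
    by (rule nn_integral_PInf_AE) (auto simp: W)
  then have fin: "AE \<omega> in M. ?W \<omega> \<noteq> \<top>" by simp
  then show "AE \<omega> in M. (\<lambda>j. h j \<omega>) summable_on {1..}"
    by eventually_elim (rule infsum_from_1_eq_enn2real(2), auto simp: nonneg)
  have "(\<integral>\<^sup>+\<omega>. ennreal (\<Sum>\<^sub>\<infinity>j\<in>{1..}. h j \<omega>) \<partial>M) = ennreal S"
    unfolding W[symmetric]
  proof (intro nn_integral_cong_AE)
    show "AE \<omega> in M. ennreal (\<Sum>\<^sub>\<infinity>j\<in>{1..}. h j \<omega>) = ?W \<omega>"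
      using fin
    proof eventually_elim
      case (elim \<omega>)
      then have "?W \<omega> < \<top>" by (simp add: less_top)
      then show ?case unfolding infsum_from_1_eq_enn2real(1)[of "\<lambda>j. h j \<omega>", OF nonneg]
        by (rule ennreal_enn2real)
    qed
  qed
  then show "has_bochner_integral M (\<lambda>\<omega>. \<Sum>\<^sub>\<infinity>j\<in>{1..}. h j \<omega>) S"
    by (intro has_bochner_integral_nn_integral measurable) (auto simp: S0 nonneg infsum_nonneg)
qed

text \<open>
  A quantitative Slutsky argument: the events \<open>Z \<le> x\<close> and \<open>V \<le> x - d\<close> differ, up to a set of probability
  at most \<open>\<eta>\<close>, only by a shift of the threshold by at most \<open>\<delta>\<close>, and the standard normal distribution
  function is 1-Lipschitz.
\<close>

lemma (in prob_space) cdf_perturbation: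
  assumes [measurable]: "random_variable borel Z" "random_variable borel V"
    and s: "0 < s" and \<delta>: "0 \<le> \<delta>"
    and close: "prob {\<omega>\<in>space M. \<delta> < \<bar>Z \<omega> - (V \<omega> + d)\<bar>} \<le> \<eta>"
    and V: "\<And>y. \<bar>prob {\<omega>\<in>space M. V \<omega> \<le> y} - std_normal_cdf (y / s)\<bar> \<le> \<epsilon>"
  shows "\<bar>prob {\<omega>\<in>space M. Z \<omega> \<le> x} - std_normal_cdf ((x - d) / s)\<bar> \<le> \<epsilon> + \<eta> + \<delta> / s"
proof -
  let ?E = "{\<omega>\<in>space M. \<delta> < \<bar>Z \<omega> - (V \<omega> + d)\<bar>}" and ?V = "\<lambda>y. {\<omega>\<in>space M. V \<omega> \<le> y}"
  have "prob {\<omega>\<in>space M. Z \<omega> \<le> x} \<le> prob (?V (x - d + \<delta>) \<union> ?E)"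
    by (intro finite_measure_mono) auto
  also have "\<dots> \<le> prob (?V (x - d + \<delta>)) + prob ?E"
    by (intro measure_Un_le) measurable
  finally have up: "prob {\<omega>\<in>space M. Z \<omega> \<le> x} \<le> prob (?V (x - d + \<delta>)) + prob ?E" .
  have "prob (?V (x - d - \<delta>)) \<le> prob ({\<omega>\<in>space M. Z \<omega> \<le> x} \<union> ?E)"
    by (intro finite_measure_mono) auto
  also have "\<dots> \<le> prob {\<omega>\<in>space M. Z \<omega> \<le> x} + prob ?E"
    by (intro measure_Un_le) measurable
  finally have lo: "prob (?V (x - d - \<delta>)) \<le> prob {\<omega>\<in>space M. Z \<omega> \<le> x} + prob ?E" .
  have "std_normal_cdf ((x - d + \<delta>) / s) - std_normal_cdf ((x - d) / s) \<le> \<delta> / s"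
    using std_normal_cdf_lipschitz[of "(x - d) / s" "(x - d + \<delta>) / s"] s \<delta>
    by (simp add: divide_right_mono add_divide_distrib)
  moreover have "std_normal_cdf ((x - d) / s) - std_normal_cdf ((x - d - \<delta>) / s) \<le> \<delta> / s"
    using std_normal_cdf_lipschitz[of "(x - d - \<delta>) / s" "(x - d) / s"] s \<delta>
    by (simp add: divide_right_mono diff_divide_distrib)
  ultimately show ?thesis
    using up lo close V[of "x - d + \<delta>"] V[of "x - d - \<delta>"] by (simp only: abs_le_iff) linarith
qed

locale gaussian_sequence = prob_space M for M :: "'w measure" +
  fixes \<xi> :: "nat \<Rightarrow> 'w \<Rightarrow> real"
  assumes iid: "iid_standard_normal M \<xi>"
begin

lemma normal: "1 \<le> j \<Longrightarrow> distributed M lborel (\<xi> j) std_normal_density"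
  and indep: "indep_vars (\<lambda>_. borel) \<xi> {1..}"
  using iid by (auto simp: iid_standard_normal_def)

lemma xi_measurable: "1 \<le> j \<Longrightarrow> random_variable borel (\<xi> j)"
  using indep by (auto simp: indep_vars_def2)

lemma xi_expectation:
  fixes g :: "real \<Rightarrow> real"
  assumes "1 \<le> j" "g \<in> borel_measurable borel"
  shows "expectation (\<lambda>\<omega>. g (\<xi> j \<omega>)) = (LINT x|std_normal_distribution. g x)"
    and "integrable M (\<lambda>\<omega>. g (\<xi> j \<omega>)) \<longleftrightarrow> integrable std_normal_distribution g"
  using distributed_integral[OF normal[OF assms(1)], of g] distributed_integrable[OF normal[OF assms(1)], of g] assms(2)
  by (auto simp: integral_density integrable_density)

lemma xi_power_integrable: "1 \<le> j \<Longrightarrow> integrable M (\<lambda>\<omega>. \<xi> j \<omega> ^ k)"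
  by (subst xi_expectation(2)[where g = "\<lambda>x. x ^ k"]) (auto intro: integrable_std_normal_distribution_moment)

lemma xi_integrable: "1 \<le> j \<Longrightarrow> integrable M (\<xi> j)"
  using xi_power_integrable[of j 1] by simp

lemma xi_moments:
  assumes "1 \<le> j"
  shows "expectation (\<xi> j) = 0" "expectation (\<lambda>\<omega>. (\<xi> j \<omega>)\<^sup>2) = 1" "expectation (\<lambda>\<omega>. \<xi> j \<omega> ^ 4) = 3"
  using xi_expectation(1)[OF assms, of "\<lambda>x. x ^ 1"] xi_expectation(1)[OF assms, of "\<lambda>x. x ^ 2"]
    xi_expectation(1)[OF assms, of "\<lambda>x. x ^ 4"]
    integral_std_normal_distribution_moment_odd[of 1] std_normal_distribution_even_moments(1)[of 1]
    std_normal_distribution_even_moments(1)[of 2]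
  by (simp_all add: fact_numeral)

text \<open>
  Independent centred variables are orthogonal, so only the diagonal of the double sum survives.
\<close>

lemma xi_linear_second_moment:
  assumes "finite J" "J \<subseteq> {1..}"
  shows "integrable M (\<lambda>\<omega>. (\<Sum>j\<in>J. b j * \<xi> j \<omega>)\<^sup>2)"
    and "expectation (\<lambda>\<omega>. (\<Sum>j\<in>J. b j * \<xi> j \<omega>)\<^sup>2) = (\<Sum>j\<in>J. (b j)\<^sup>2)"
proof -
  have prod: "integrable M (\<lambda>\<omega>. \<xi> i \<omega> * \<xi> j \<omega>)"
    "expectation (\<lambda>\<omega>. \<xi> i \<omega> * \<xi> j \<omega>) = (if i = j then 1 else 0)" if "i \<in> J" "j \<in> J" for i j
  proof -
    have ij: "1 \<le> i" "1 \<le> j" using that assms by auto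
    have "integrable M (\<lambda>\<omega>. \<xi> i \<omega> * \<xi> j \<omega>) \<and>
      expectation (\<lambda>\<omega>. \<xi> i \<omega> * \<xi> j \<omega>) = (if i = j then 1 else 0)"
    proof (cases "i = j")
      case True
      then show ?thesis using xi_power_integrable[OF ij(1), of 2] xi_moments(2)[OF ij(1)]
        by (simp add: power2_eq_square)
    next
      case False
      have pair: "indep_vars (\<lambda>_. borel) \<xi> {i, j}"
        using ij by (intro indep_vars_subset[OF indep]) auto
      have int: "integrable M (\<xi> k)" if "k \<in> {i, j}" for k
        using that ij xi_integrable by auto
      show ?thesis
        using indep_vars_integrable[OF _ pair int] indep_vars_lebesgue_integral[OF _ pair int]
          xi_moments(1) ij False by simp
    qed
    then show "integrable M (\<lambda>\<omega>. \<xi> i \<omega> * \<xi> j \<omega>)"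
      "expectation (\<lambda>\<omega>. \<xi> i \<omega> * \<xi> j \<omega>) = (if i = j then 1 else 0)" by auto
  qed
  have eq: "(\<Sum>j\<in>J. b j * \<xi> j \<omega>)\<^sup>2 = (\<Sum>i\<in>J. \<Sum>j\<in>J. b i * b j * (\<xi> i \<omega> * \<xi> j \<omega>))" for \<omega>
    by (simp add: power2_eq_square sum_product mult_ac)
  have int: "integrable M (\<lambda>\<omega>. b i * b j * (\<xi> i \<omega> * \<xi> j \<omega>))" if "i \<in> J" "j \<in> J" for i j
    using prod(1)[OF that] by simp
  show "integrable M (\<lambda>\<omega>. (\<Sum>j\<in>J. b j * \<xi> j \<omega>)\<^sup>2)"
    unfolding eq by (intro Bochner_Integration.integrable_sum int)
  have "expectation (\<lambda>\<omega>. (\<Sum>j\<in>J. b j * \<xi> j \<omega>)\<^sup>2) =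
      (\<Sum>i\<in>J. \<Sum>j\<in>J. b i * b j * expectation (\<lambda>\<omega>. \<xi> i \<omega> * \<xi> j \<omega>))"
    unfolding eq using int by (simp add: Bochner_Integration.integral_sum)
  also have "\<dots> = (\<Sum>i\<in>J. \<Sum>j\<in>J. if i = j then (b i)\<^sup>2 else 0)"
    using prod(2) by (intro sum.cong) (auto simp: power2_eq_square)
  also have "\<dots> = (\<Sum>j\<in>J. (b j)\<^sup>2)"
    using assms by simp
  finally show "expectation (\<lambda>\<omega>. (\<Sum>j\<in>J. b j * \<xi> j \<omega>)\<^sup>2) = (\<Sum>j\<in>J. (b j)\<^sup>2)" .
qed

text \<open>
  The noise part of the statistic is a weighted sum of the standardised variables \<open>(\<xi>\<^sub>j\<^sup>2 - 1) / sqrt 2\<close>,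
  which have mean zero, variance one (as the fourth Gaussian moment is 3) and a common finite third
  absolute moment.
\<close>

lemma chi_square_uniform_clt:
  fixes a :: "nat \<Rightarrow> nat \<Rightarrow> real" and N :: "nat \<Rightarrow> nat"
  assumes pos: "\<And>n. 0 < (\<Sum>j=1..N n. (a n j)\<^sup>2)"
    and small: "\<And>n j. j \<in> {1..N n} \<Longrightarrow> \<bar>a n j\<bar> / sqrt (\<Sum>j=1..N n. (a n j)\<^sup>2) \<le> \<epsilon> n" and \<epsilon>: "\<epsilon> \<longlonglongrightarrow> 0"
    and \<delta>: "0 < \<delta>"
  shows "\<forall>\<^sub>F n in sequentially. \<forall>y. \<bar>prob {\<omega>\<in>space M. (\<Sum>j=1..N n. a n j * ((\<xi> j \<omega>)\<^sup>2 - 1)) \<le> y}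
    - std_normal_cdf (y / sqrt (2 * (\<Sum>j=1..N n. (a n j)\<^sup>2)))\<bar> \<le> \<delta>"
proof -
  define v where "v n = (\<Sum>j=1..N n. (a n j)\<^sup>2)" for n
  define X where "X j \<omega> = ((\<xi> j \<omega>)\<^sup>2 - 1) / sqrt 2" for j \<omega>
  define b where "b n j = a n j / sqrt (v n)" for n j
  define D where "D n = distr M borel (\<lambda>\<omega>. \<Sum>j=1..N n. b n j * X j \<omega>)" for n
  have v: "0 < v n" for n using pos by (simp add: v_def)
  have X [measurable]: "random_variable borel (X j)" if "1 \<le> j" for j
    unfolding X_def using xi_measurable[OF that] by measurable
  have X2: "(X j \<omega>)\<^sup>2 = (\<xi> j \<omega> ^ 4 - 2 * (\<xi> j \<omega>)\<^sup>2 + 1) / 2" for j \<omega>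
    by (simp add: X_def power_divide power2_diff)
  have cube_int: "integrable M (\<lambda>\<omega>. \<bar>X j \<omega>\<bar> ^ 3)" if j: "1 \<le> j" for j
  proof (rule Bochner_Integration.integrable_bound)
    show "integrable M (\<lambda>\<omega>. \<xi> j \<omega> ^ 6 + 3 * \<xi> j \<omega> ^ 4 + 3 * (\<xi> j \<omega>)\<^sup>2 + 1)"
      using xi_power_integrable[OF j] by simp
    show "random_variable borel (\<lambda>\<omega>. \<bar>X j \<omega>\<bar> ^ 3)" using X[OF j] by measurable
    have "\<bar>X j \<omega>\<bar> ^ 3 \<le> \<xi> j \<omega> ^ 6 + 3 * \<xi> j \<omega> ^ 4 + 3 * (\<xi> j \<omega>)\<^sup>2 + 1" for \<omega>
    proof -
      have "\<bar>X j \<omega>\<bar> \<le> \<bar>(\<xi> j \<omega>)\<^sup>2 - 1\<bar> / 1"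
        unfolding X_def abs_divide by (intro divide_left_mono) auto
      also have "\<dots> \<le> (\<xi> j \<omega>)\<^sup>2 + 1"
        using zero_le_power2[of "\<xi> j \<omega>"] by (simp add: abs_le_iff)
      finally have "\<bar>X j \<omega>\<bar> ^ 3 \<le> ((\<xi> j \<omega>)\<^sup>2 + 1) ^ 3"
        by (intro power_mono) auto
      also have "\<dots> = \<xi> j \<omega> ^ 6 + 3 * \<xi> j \<omega> ^ 4 + 3 * (\<xi> j \<omega>)\<^sup>2 + 1"
        by (simp add: algebra_simps power2_eq_square eval_nat_numeral)
      finally show ?thesis .
    qed
    then show "AE \<omega> in M. norm (\<bar>X j \<omega>\<bar> ^ 3) \<le> norm (\<xi> j \<omega> ^ 6 + 3 * \<xi> j \<omega> ^ 4 + 3 * (\<xi> j \<omega>)\<^sup>2 + 1)"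
      by (intro AE_I2) (smt (verit) real_norm_def zero_le_power abs_ge_zero)
  qed
  have "weak_conv_m D std_normal_distribution"
    unfolding D_def
  proof (rule weighted_clt[where I = "{1..}" and J = "\<lambda>n. {1..N n}" and \<epsilon> = \<epsilon>
      and B = "LINT x|std_normal_distribution. \<bar>(x\<^sup>2 - 1) / sqrt 2\<bar> ^ 3"])
    show "indep_vars (\<lambda>_. borel) X {1..}"
      unfolding X_def[abs_def] by (rule indep_vars_compose2[OF indep]) auto
    show "integrable M (\<lambda>\<omega>. (X j \<omega>)\<^sup>2)" "integrable M (\<lambda>\<omega>. \<bar>X j \<omega>\<bar> ^ 3)"
      "expectation (X j) = 0" "expectation (\<lambda>\<omega>. (X j \<omega>)\<^sup>2) = 1" 
      "expectation (\<lambda>\<omega>. \<bar>X j \<omega>\<bar> ^ 3) \<le> (LINT x|std_normal_distribution. \<bar>(x\<^sup>2 - 1) / sqrt 2\<bar> ^ 3)"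
      if "j \<in> {1..}" for j
    proof -
      have j: "1 \<le> j" using that by simp
      note int = xi_power_integrable[OF j, of 2] xi_power_integrable[OF j, of 4]
      show "integrable M (\<lambda>\<omega>. (X j \<omega>)\<^sup>2)" unfolding X2 using int by simp
      show "integrable M (\<lambda>\<omega>. \<bar>X j \<omega>\<bar> ^ 3)" by (rule cube_int[OF j])
      show "expectation (X j) = 0"
        unfolding X_def[abs_def] using int xi_moments[OF j] by (simp add: prob_space)
      show "expectation (\<lambda>\<omega>. (X j \<omega>)\<^sup>2) = 1"
        unfolding X2 using int xi_moments[OF j] by (simp add: prob_space)
      show "expectation (\<lambda>\<omega>. \<bar>X j \<omega>\<bar> ^ 3) \<le> (LINT x|std_normal_distribution. \<bar>(x\<^sup>2 - 1) / sqrt 2\<bar> ^ 3)"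
        unfolding X_def using xi_expectation(1)[OF j, of "\<lambda>x. \<bar>(x\<^sup>2 - 1) / sqrt 2\<bar> ^ 3"] by simp
    qed
    show "(\<Sum>j\<in>{1..N n}. (b n j)\<^sup>2) = 1" for n
      using v[of n] by (simp add: b_def power_divide flip: sum_divide_distrib) (simp add: v_def)
    show "\<bar>b n j\<bar> \<le> \<epsilon> n" if "j \<in> {1..N n}" for n j
      using small[OF that] v[of n] by (simp add: b_def) (simp add: v_def)
  qed (use \<epsilon> in auto)
  then have "\<forall>\<^sub>F n in sequentially. \<forall>x. \<bar>cdf (D n) x - std_normal_cdf x\<bar> \<le> \<delta>"
  proof (rule weak_conv_std_normal_uniform)
    show "real_distribution (D n)" for n
      unfolding D_def by (intro real_distribution_distr borel_measurable_sum borel_measurable_times)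
        (auto intro: X)
  qed (rule \<delta>)
  then show ?thesis
  proof eventually_elim
    case (elim n)
    show ?case
    proof
      fix y
      let ?s = "sqrt (2 * v n)"
      have s: "0 < ?s" using v[of n] by simp
      have "(\<Sum>j=1..N n. b n j * X j \<omega>) = (\<Sum>j=1..N n. a n j * ((\<xi> j \<omega>)\<^sup>2 - 1)) / ?s" for \<omega>
        unfolding sum_divide_distrib by (intro sum.cong) (auto simp: b_def X_def real_sqrt_mult mult.commute)
      then have "(\<Sum>j=1..N n. b n j * X j \<omega>) \<le> y / ?s \<longleftrightarrow> (\<Sum>j=1..N n. a n j * ((\<xi> j \<omega>)\<^sup>2 - 1)) \<le> y" for \<omega>
        using s by (simp add: divide_le_cancel)
      then have "cdf (D n) (y / ?s) = prob {\<omega>\<in>space M. (\<Sum>j=1..N n. a n j * ((\<xi> j \<omega>)\<^sup>2 - 1)) \<le> y}"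
        unfolding cdf_def D_def
        by (subst measure_distr)
           (auto intro!: arg_cong[where f=prob] borel_measurable_sum borel_measurable_times X)
      then show "\<bar>prob {\<omega>\<in>space M. (\<Sum>j=1..N n. a n j * ((\<xi> j \<omega>)\<^sup>2 - 1)) \<le> y}
          - std_normal_cdf (y / sqrt (2 * (\<Sum>j=1..N n. (a n j)\<^sup>2)))\<bar> \<le> \<delta>"
        using elim[rule_format, of "y / ?s"] by (simp add: v_def)
    qed
  qed
qed

end

section \<open>Truncating and linearising the test statistic\<close>

text \<open>
  The deterministic shift of \<open>n\<^sup>2 T\<^sub>n\<close> caused by the alternative \<open>g\<close>. Under the assumptions on the
  weights, the noise in \<open>n\<^sup>2 T\<^sub>n\<close> has bounded variance, so this is a signal-to-noise ratio.
\<close>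

definition scaled_signal :: "(nat \<Rightarrow> real \<Rightarrow> real) \<Rightarrow> (nat \<Rightarrow> nat \<Rightarrow> real) \<Rightarrow> nat \<Rightarrow> (real \<Rightarrow> real) \<Rightarrow> real" where
  "scaled_signal \<phi> \<kappa> n g = (real n)\<^sup>2 * (\<Sum>\<^sub>\<infinity>j\<in>{1..}. (\<kappa> n j)\<^sup>2 * (l2_inner g (\<phi> j))\<^sup>2)"

locale white_noise_test = gaussian_sequence M \<xi>
  for M :: "'w measure" and \<xi> :: "nat \<Rightarrow> 'w \<Rightarrow> real" +
  fixes \<sigma> r :: real and \<phi> :: "nat \<Rightarrow> real \<Rightarrow> real" and \<kappa> :: "nat \<Rightarrow> nat \<Rightarrow> real"
  assumes r: "0 < r" "r < 1/2" and sigma: "0 < \<sigma>"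
    and basis: "orthonormal_basis \<phi>"
    and A1: "cond_A1 \<kappa>" and A2: "cond_A2 \<sigma> \<kappa>" and A3: "cond_A3 r \<kappa>" and A5: "cond_A5 \<kappa>"
begin

abbreviation "signal \<equiv> scaled_signal \<phi> \<kappa>"
abbreviation "stat n g \<omega> \<equiv> test_stat \<sigma> \<kappa> n (obs \<sigma> \<phi> \<xi> n g \<omega>)"
abbreviation "coef g j \<equiv> l2_inner g (\<phi> j)"

lemma coef_sq_le: "g \<in> L2 \<Longrightarrow> 1 \<le> j \<Longrightarrow> (coef g j)\<^sup>2 \<le> (l2_norm g)\<^sup>2"
  using finite_sum_le_has_sum[OF parseval[OF basis], of g "{j}"] by auto

lemma signal_has_sum:
  assumes "g \<in> L2" "1 \<le> n"
  shows "((\<lambda>j. (\<kappa> n j)\<^sup>2 * (coef g j)\<^sup>2) has_sum signal n g / (real n)\<^sup>2) {1..}"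
proof -
  have "(\<lambda>j. (\<kappa> n j)\<^sup>2 * (coef g j)\<^sup>2) summable_on {1..}"
  proof (rule summable_on_comparison_test)
    show "(\<lambda>j. (\<kappa> n 1)\<^sup>2 * (coef g j)\<^sup>2) summable_on {1..}"
      using parseval[OF basis assms(1)] by (intro summable_on_cmult_right) (auto simp: summable_on_def)
  qed (use kappa_sq_antimono[OF A1 assms(2)] in \<open>auto intro: mult_right_mono\<close>)
  then show ?thesis
    using assms(2) by (simp add: scaled_signal_def has_sum_infsum)
qed

lemma signal_zero: "signal n (\<lambda>_. 0) = 0"
  by (simp add: scaled_signal_def)

lemma signal_tail_le:
  assumes "g \<in> L2" "1 \<le> n"
  shows "signal n g / (real n)\<^sup>2 - (\<Sum>j=1..N. (\<kappa> n j)\<^sup>2 * (coef g j)\<^sup>2)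
    \<le> (l2_norm g)\<^sup>2 * (rho \<kappa> n - (\<Sum>j=1..N. (\<kappa> n j)\<^sup>2))"
    and "(\<Sum>j=1..N. (\<kappa> n j)\<^sup>2 * (coef g j)\<^sup>2) \<le> signal n g / (real n)\<^sup>2"
proof -
  have "((\<lambda>j. (l2_norm g)\<^sup>2 * (\<kappa> n j)\<^sup>2 + - ((\<kappa> n j)\<^sup>2 * (coef g j)\<^sup>2)) has_sum
      ((l2_norm g)\<^sup>2 * rho \<kappa> n + - (signal n g / (real n)\<^sup>2))) {1..}"
    by (intro has_sum_add has_sum_cmult_right has_sum_uminusI signal_has_sum assms rho_has_sum[OF A3])
  then have "(\<Sum>j=1..N. (l2_norm g)\<^sup>2 * (\<kappa> n j)\<^sup>2 + - ((\<kappa> n j)\<^sup>2 * (coef g j)\<^sup>2)) \<le>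
      (l2_norm g)\<^sup>2 * rho \<kappa> n + - (signal n g / (real n)\<^sup>2)"
  proof (rule finite_sum_le_has_sum)
    show "0 \<le> (l2_norm g)\<^sup>2 * (\<kappa> n j)\<^sup>2 + - ((\<kappa> n j)\<^sup>2 * (coef g j)\<^sup>2)" if "j \<in> {1..} - {1..N}" for j
      using coef_sq_le[OF assms(1), of j] that mult_left_mono[of "(coef g j)\<^sup>2" "(l2_norm g)\<^sup>2" "(\<kappa> n j)\<^sup>2"]
      by (simp add: mult.commute)
  qed auto
  then show "signal n g / (real n)\<^sup>2 - (\<Sum>j=1..N. (\<kappa> n j)\<^sup>2 * (coef g j)\<^sup>2)
    \<le> (l2_norm g)\<^sup>2 * (rho \<kappa> n - (\<Sum>j=1..N. (\<kappa> n j)\<^sup>2))"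
    by (simp add: sum_subtractf sum_distrib_left right_diff_distrib)
  show "(\<Sum>j=1..N. (\<kappa> n j)\<^sup>2 * (coef g j)\<^sup>2) \<le> signal n g / (real n)\<^sup>2"
    by (rule finite_sum_le_has_sum[OF signal_has_sum[OF assms]]) auto
qed

lemma partial_rho_le:
  assumes "1 \<le> n" shows "(\<Sum>j=1..N. (\<kappa> n j)\<^sup>2) \<le> rho \<kappa> n"
  by (rule finite_sum_le_has_sum[OF rho_has_sum(1)[OF A3 assms]]) auto

lemma obs_sq:
  assumes "1 \<le> j"
  shows "integrable M (\<lambda>\<omega>. (\<kappa> n j)\<^sup>2 * (obs \<sigma> \<phi> \<xi> n g \<omega> j)\<^sup>2)"
    and "expectation (\<lambda>\<omega>. (\<kappa> n j)\<^sup>2 * (obs \<sigma> \<phi> \<xi> n g \<omega> j)\<^sup>2) =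
      (\<kappa> n j)\<^sup>2 * (coef g j)\<^sup>2 + \<sigma>\<^sup>2 / real n * (\<kappa> n j)\<^sup>2"
proof -
  define u where "u = \<sigma> / sqrt (real n)"
  have u: "u\<^sup>2 = \<sigma>\<^sup>2 / real n" by (simp add: u_def power_divide)
  have eq: "(\<kappa> n j)\<^sup>2 * (obs \<sigma> \<phi> \<xi> n g \<omega> j)\<^sup>2 =
      (\<kappa> n j)\<^sup>2 * (coef g j)\<^sup>2 + 2 * (\<kappa> n j)\<^sup>2 * coef g j * u * \<xi> j \<omega> + u\<^sup>2 * (\<kappa> n j)\<^sup>2 * (\<xi> j \<omega>)\<^sup>2" for \<omega>
    by (simp add: obs_def u_def[symmetric] power2_eq_square algebra_simps)
  note int = xi_integrable[OF assms] xi_power_integrable[OF assms, of 2]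
  show "integrable M (\<lambda>\<omega>. (\<kappa> n j)\<^sup>2 * (obs \<sigma> \<phi> \<xi> n g \<omega> j)\<^sup>2)"
    unfolding eq using int by simp
  show "expectation (\<lambda>\<omega>. (\<kappa> n j)\<^sup>2 * (obs \<sigma> \<phi> \<xi> n g \<omega> j)\<^sup>2) =
      (\<kappa> n j)\<^sup>2 * (coef g j)\<^sup>2 + \<sigma>\<^sup>2 / real n * (\<kappa> n j)\<^sup>2"
    unfolding eq using int xi_moments[OF assms] by (simp add: prob_space u)
qed

lemma stat_series:
  assumes "g \<in> L2" "1 \<le> n"
  defines "h \<equiv> \<lambda>j \<omega>. (\<kappa> n j)\<^sup>2 * (obs \<sigma> \<phi> \<xi> n g \<omega> j)\<^sup>2"
  shows "(\<lambda>\<omega>. \<Sum>\<^sub>\<infinity>j\<in>{1..}. h j \<omega>) \<in> borel_measurable M"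
    and "AE \<omega> in M. (\<lambda>j. h j \<omega>) summable_on {1..}"
    and "has_bochner_integral M (\<lambda>\<omega>. \<Sum>\<^sub>\<infinity>j\<in>{1..}. h j \<omega>)
      (signal n g / (real n)\<^sup>2 + \<sigma>\<^sup>2 / real n * rho \<kappa> n)"
proof -
  have "((\<lambda>j. expectation (h j)) has_sum (signal n g / (real n)\<^sup>2 + \<sigma>\<^sup>2 / real n * rho \<kappa> n)) {1..}"
  proof (rule has_sum_cong[THEN iffD2])
    show "((\<lambda>j. (\<kappa> n j)\<^sup>2 * (coef g j)\<^sup>2 + \<sigma>\<^sup>2 / real n * (\<kappa> n j)\<^sup>2) has_sum
        (signal n g / (real n)\<^sup>2 + \<sigma>\<^sup>2 / real n * rho \<kappa> n)) {1..}"
      by (intro has_sum_add has_sum_cmult_right signal_has_sum rho_has_sum[OF A3] assms)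
  qed (use obs_sq(2) in \<open>auto simp only: h_def atLeast_iff\<close>)
  moreover have "integrable M (h j)" if "1 \<le> j" for j
    unfolding h_def by (rule obs_sq(1)[OF that])
  moreover have "0 \<le> h j \<omega>" for j \<omega>
    by (simp add: h_def)
  ultimately show "(\<lambda>\<omega>. \<Sum>\<^sub>\<infinity>j\<in>{1..}. h j \<omega>) \<in> borel_measurable M"
    "AE \<omega> in M. (\<lambda>j. h j \<omega>) summable_on {1..}"
    "has_bochner_integral M (\<lambda>\<omega>. \<Sum>\<^sub>\<infinity>j\<in>{1..}. h j \<omega>)
      (signal n g / (real n)\<^sup>2 + \<sigma>\<^sup>2 / real n * rho \<kappa> n)"
    by (blast intro: nonneg_series_expectation)+
qed

lemma stat_measurable [measurable]:
  assumes "g \<in> L2" "1 \<le> n" shows "random_variable borel (stat n g)"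
  unfolding test_stat_def using stat_series(1)[OF assms] by measurable

text \<open>
  Replacing the infinite series by its first \<open>N\<close> terms. The discarded part \<open>R\<close> of the series of squares is
  nonnegative with expectation at most a multiple of the discarded part of \<open>rho\<close>, so Markov's
  inequality applies to \<open>R\<close> itself; the discarded centring is at most \<open>\<delta>\<close> by assumption.
\<close>

lemma stat_truncation:
  assumes g: "g \<in> L2" and n: "1 \<le> n" and \<delta>: "0 < \<delta>"
    and tail: "real n * \<sigma>\<^sup>2 * (rho \<kappa> n - (\<Sum>j=1..N. (\<kappa> n j)\<^sup>2)) \<le> \<delta>"
  shows "prob {\<omega>\<in>space M. \<delta> < \<bar>(real n)\<^sup>2 * stat n g \<omega> -
        (\<Sum>j=1..N. (real n)\<^sup>2 * (\<kappa> n j)\<^sup>2 * ((obs \<sigma> \<phi> \<xi> n g \<omega> j)\<^sup>2 - \<sigma>\<^sup>2 / real n))\<bar>}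
    \<le> real n * (\<sigma>\<^sup>2 + real n * (l2_norm g)\<^sup>2) * (rho \<kappa> n - (\<Sum>j=1..N. (\<kappa> n j)\<^sup>2)) / \<delta>"
proof -
  let ?h = "\<lambda>j \<omega>. (\<kappa> n j)\<^sup>2 * (obs \<sigma> \<phi> \<xi> n g \<omega> j)\<^sup>2"
  let ?t = "rho \<kappa> n - (\<Sum>j=1..N. (\<kappa> n j)\<^sup>2)"
  define R where "R \<omega> = (\<Sum>\<^sub>\<infinity>j\<in>{1..}. ?h j \<omega>) - (\<Sum>j=1..N. ?h j \<omega>)" for \<omega>
  note series = stat_series[OF g n]
  have t: "0 \<le> ?t" using partial_rho_le[OF n, of N] by simp
  have "has_bochner_integral M (\<lambda>\<omega>. \<Sum>j=1..N. ?h j \<omega>)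
      (\<Sum>j=1..N. (\<kappa> n j)\<^sup>2 * (coef g j)\<^sup>2 + \<sigma>\<^sup>2 / real n * (\<kappa> n j)\<^sup>2)"
    using obs_sq by (intro has_bochner_integral_sum) (simp add: has_bochner_integral_iff)
  then have R: "has_bochner_integral M R (signal n g / (real n)\<^sup>2 + \<sigma>\<^sup>2 / real n * rho \<kappa> n -
      (\<Sum>j=1..N. (\<kappa> n j)\<^sup>2 * (coef g j)\<^sup>2 + \<sigma>\<^sup>2 / real n * (\<kappa> n j)\<^sup>2))"
    unfolding R_def by (intro has_bochner_integral_diff series)
  then have intR: "integrable M R" and [measurable]: "R \<in> borel_measurable M" by (auto simp: has_bochner_integral_iff)
  have ER: "expectation R \<le> ((l2_norm g)\<^sup>2 + \<sigma>\<^sup>2 / real n) * ?t"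
    using R signal_tail_le(1)[OF g n, of N]
    by (simp add: has_bochner_integral_iff sum.distrib distrib_right right_diff_distrib sum_distrib_left)
  have R0: "AE \<omega> in M. 0 \<le> R \<omega>"
    using series(2)
  proof eventually_elim
    case (elim \<omega>)
    then show ?case unfolding R_def using finite_sum_le_infsum[of "\<lambda>j. ?h j \<omega>" "{1..}" "{1..N}"] by auto
  qed
  have eq: "(real n)\<^sup>2 * stat n g \<omega> -
        (\<Sum>j=1..N. (real n)\<^sup>2 * (\<kappa> n j)\<^sup>2 * ((obs \<sigma> \<phi> \<xi> n g \<omega> j)\<^sup>2 - \<sigma>\<^sup>2 / real n)) =
      (real n)\<^sup>2 * R \<omega> - real n * \<sigma>\<^sup>2 * ?t" for \<omega>
  proof -
    have "(\<Sum>j=1..N. (real n)\<^sup>2 * (\<kappa> n j)\<^sup>2 * ((obs \<sigma> \<phi> \<xi> n g \<omega> j)\<^sup>2 - \<sigma>\<^sup>2 / real n)) =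
      (real n)\<^sup>2 * ((\<Sum>j=1..N. ?h j \<omega>) - \<sigma>\<^sup>2 / real n * (\<Sum>j=1..N. (\<kappa> n j)\<^sup>2))"
      by (simp add: sum_distrib_left sum_subtractf right_diff_distrib mult_ac)
    then have "(real n)\<^sup>2 * stat n g \<omega> -
        (\<Sum>j=1..N. (real n)\<^sup>2 * (\<kappa> n j)\<^sup>2 * ((obs \<sigma> \<phi> \<xi> n g \<omega> j)\<^sup>2 - \<sigma>\<^sup>2 / real n)) =
        (real n)\<^sup>2 * (R \<omega> - \<sigma>\<^sup>2 / real n * ?t)"
      by (simp add: test_stat_def R_def right_diff_distrib)
    also have "\<dots> = (real n)\<^sup>2 * R \<omega> - real n * \<sigma>\<^sup>2 * ?t"
    proof -
      have "x\<^sup>2 * (u - v / x * w) = x\<^sup>2 * u - x * v * w" if "x \<noteq> 0" for x u v w :: real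
        using that by (simp add: field_simps power2_eq_square)
      then show ?thesis using n by simp
    qed
    finally show ?thesis .
  qed
  have "prob {\<omega>\<in>space M. \<delta> < \<bar>(real n)\<^sup>2 * R \<omega> - real n * \<sigma>\<^sup>2 * ?t\<bar>} \<le> prob {\<omega>\<in>space M. \<delta> \<le> (real n)\<^sup>2 * R \<omega>}"
  proof (rule finite_measure_mono_AE)
    have c: "0 \<le> real n * \<sigma>\<^sup>2 * ?t" using t by (intro mult_nonneg_nonneg) auto
    show "AE \<omega> in M. \<omega> \<in> {\<omega>\<in>space M. \<delta> < \<bar>(real n)\<^sup>2 * R \<omega> - real n * \<sigma>\<^sup>2 * ?t\<bar>} \<longrightarrow>
        \<omega> \<in> {\<omega>\<in>space M. \<delta> \<le> (real n)\<^sup>2 * R \<omega>}"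
      using R0
    proof eventually_elim
      case (elim \<omega>)
      have "0 \<le> (real n)\<^sup>2 * R \<omega>" using elim by simp
      moreover have "\<delta> \<le> p" if "0 \<le> p" "0 \<le> q" "q \<le> \<delta>" "\<delta> < \<bar>p - q\<bar>" for p q
        using that by linarith
      ultimately show ?case using tail c by blast
    qed
  qed measurable
  also have "\<dots> \<le> expectation (\<lambda>\<omega>. (real n)\<^sup>2 * R \<omega>) / \<delta>"
    using intR R0 \<delta> by (intro integral_Markov_inequality_measure[where A="{}"]) auto
  also have "\<dots> \<le> ((real n)\<^sup>2 * (((l2_norm g)\<^sup>2 + \<sigma>\<^sup>2 / real n) * ?t)) / \<delta>"
    using ER \<delta> by (simp add: divide_right_mono mult_left_mono)
  also have "(real n)\<^sup>2 * (((l2_norm g)\<^sup>2 + \<sigma>\<^sup>2 / real n) * ?t) = real n * (\<sigma>\<^sup>2 + real n * (l2_norm g)\<^sup>2) * ?t"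
  proof -
    have "x\<^sup>2 * ((u + v / x) * w) = x * (v + x * u) * w" if "x \<noteq> 0" for x u v w :: real
      using that by (simp add: field_simps power2_eq_square)
    from this[of "real n"] show ?thesis using n by fastforce
  qed
  finally show ?thesis unfolding eq .
qed

abbreviation "noise_part n N \<omega> \<equiv> (\<Sum>j=1..N. real n * \<sigma>\<^sup>2 * (\<kappa> n j)\<^sup>2 * ((\<xi> j \<omega>)\<^sup>2 - 1))"

text \<open>
  Expanding the squares in the truncated statistic leaves the noise part, the shift and a term linear
  in the noise. Three errors of size \<open>\<delta>\<close> occur: truncating the statistic, truncating the shift, and
  dropping the linear term. The last is small by Chebyshev's inequality, its variance being at most
  \<open>4 n\<^sup>3 \<sigma>\<^sup>2 \<kappa>\<^sub>1\<^sup>4 \<parallel>g\<parallel>\<^sup>2\<close>.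
\<close>

lemma stat_approx:
  assumes g: "g \<in> L2" and n: "1 \<le> n" and \<delta>: "0 < \<delta>"
    and tail: "real n * (\<sigma>\<^sup>2 + real n * (l2_norm g)\<^sup>2) * (rho \<kappa> n - (\<Sum>j=1..N. (\<kappa> n j)\<^sup>2)) \<le> \<delta>"
  shows "prob {\<omega>\<in>space M. 3 * \<delta> < \<bar>(real n)\<^sup>2 * stat n g \<omega> - (noise_part n N \<omega> + signal n g)\<bar>}
    \<le> real n * (\<sigma>\<^sup>2 + real n * (l2_norm g)\<^sup>2) * (rho \<kappa> n - (\<Sum>j=1..N. (\<kappa> n j)\<^sup>2)) / \<delta>
      + 4 * real n ^ 3 * \<sigma>\<^sup>2 * ((\<kappa> n 1)\<^sup>2)\<^sup>2 * (l2_norm g)\<^sup>2 / \<delta>\<^sup>2"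
proof -
  let ?t = "rho \<kappa> n - (\<Sum>j=1..N. (\<kappa> n j)\<^sup>2)"
  define u where "u = \<sigma> / sqrt (real n)"
  have u: "u\<^sup>2 = \<sigma>\<^sup>2 / real n" by (simp add: u_def power_divide)
  define b where "b j = 2 * (real n)\<^sup>2 * (\<kappa> n j)\<^sup>2 * coef g j * u" for j
  define D where "D = (\<Sum>j=1..N. (\<kappa> n j)\<^sup>2 * (coef g j)\<^sup>2)"
  let ?L = "\<lambda>\<omega>. \<Sum>j=1..N. b j * \<xi> j \<omega>"
  let ?S = "\<lambda>\<omega>. \<Sum>j=1..N. (real n)\<^sup>2 * (\<kappa> n j)\<^sup>2 * ((obs \<sigma> \<phi> \<xi> n g \<omega> j)\<^sup>2 - \<sigma>\<^sup>2 / real n)"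
  let ?E1 = "{\<omega>\<in>space M. \<delta> < \<bar>(real n)\<^sup>2 * stat n g \<omega> - ?S \<omega>\<bar>}" and ?E2 = "{\<omega>\<in>space M. \<delta> \<le> \<bar>?L \<omega>\<bar>}"
  have t: "0 \<le> ?t" using partial_rho_le[OF n, of N] by simp
  have term_measurable: "random_variable borel (\<lambda>\<omega>. b j * \<xi> j \<omega>)"
    "random_variable borel (\<lambda>\<omega>. (real n)\<^sup>2 * (\<kappa> n j)\<^sup>2 * ((obs \<sigma> \<phi> \<xi> n g \<omega> j)\<^sup>2 - \<sigma>\<^sup>2 / real n))"
    if "j \<in> {1..N}" for j
  proof -
    have [measurable]: "random_variable borel (\<xi> j)" using that xi_measurable by simp
    show "random_variable borel (\<lambda>\<omega>. b j * \<xi> j \<omega>)"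
      "random_variable borel (\<lambda>\<omega>. (real n)\<^sup>2 * (\<kappa> n j)\<^sup>2 * ((obs \<sigma> \<phi> \<xi> n g \<omega> j)\<^sup>2 - \<sigma>\<^sup>2 / real n))"
      unfolding obs_def by measurable
  qed
  have L [measurable]: "random_variable borel ?L" by (intro borel_measurable_sum term_measurable)
  have S [measurable]: "random_variable borel ?S" by (intro borel_measurable_sum term_measurable)
  note st [measurable] = stat_measurable[OF g n]
  have expand: "?S \<omega> = noise_part n N \<omega> + ?L \<omega> + (real n)\<^sup>2 * D" for \<omega>
  proof -
    have "(real n)\<^sup>2 * (\<kappa> n j)\<^sup>2 * ((obs \<sigma> \<phi> \<xi> n g \<omega> j)\<^sup>2 - \<sigma>\<^sup>2 / real n) =
       real n * \<sigma>\<^sup>2 * (\<kappa> n j)\<^sup>2 * ((\<xi> j \<omega>)\<^sup>2 - 1) + b j * \<xi> j \<omega> + (real n)\<^sup>2 * ((\<kappa> n j)\<^sup>2 * (coef g j)\<^sup>2)" for j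
    proof -
      have *: "real n * \<sigma>\<^sup>2 = (real n)\<^sup>2 * u\<^sup>2"
        using n unfolding u by (simp add: power2_eq_square[of "real n"])
      show ?thesis unfolding * b_def obs_def u_def[symmetric] u[symmetric]
        by (simp add: power2_eq_square algebra_simps)
    qed
    then show ?thesis by (simp add: sum.distrib D_def sum_distrib_left)
  qed
  have sig: "0 \<le> signal n g - (real n)\<^sup>2 * D" "signal n g - (real n)\<^sup>2 * D \<le> \<delta>"
  proof -
    have n2: "0 < (real n)\<^sup>2" using n by simp
    have "signal n g - (real n)\<^sup>2 * D = (real n)\<^sup>2 * (signal n g / (real n)\<^sup>2 - D)"
      using n by (simp add: right_diff_distrib)
    moreover have "0 \<le> signal n g / (real n)\<^sup>2 - D" "signal n g / (real n)\<^sup>2 - D \<le> (l2_norm g)\<^sup>2 * ?t"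
      using signal_tail_le[OF g n, of N] by (auto simp: D_def)
    ultimately have "0 \<le> signal n g - (real n)\<^sup>2 * D" and
      *: "signal n g - (real n)\<^sup>2 * D \<le> (real n)\<^sup>2 * ((l2_norm g)\<^sup>2 * ?t)"
      using n2 by (auto intro: mult_left_mono)
    have "(real n)\<^sup>2 * ((l2_norm g)\<^sup>2 * ?t) \<le> real n * (\<sigma>\<^sup>2 + real n * (l2_norm g)\<^sup>2) * ?t"
    proof -
      have "x\<^sup>2 * (u * w) \<le> x * (v + x * u) * w" if "0 \<le> x" "0 \<le> v" "0 \<le> w" for x u v w :: real
        using that by (simp add: algebra_simps power2_eq_square)
      then show ?thesis using t by simp
    qed
    then show "signal n g - (real n)\<^sup>2 * D \<le> \<delta>" using * tail by linarith
    show "0 \<le> signal n g - (real n)\<^sup>2 * D" by fact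
  qed
  have E1: "prob ?E1 \<le> real n * (\<sigma>\<^sup>2 + real n * (l2_norm g)\<^sup>2) * ?t / \<delta>"
  proof (rule stat_truncation[OF g n \<delta>])
    have "real n * \<sigma>\<^sup>2 * ?t \<le> real n * (\<sigma>\<^sup>2 + real n * (l2_norm g)\<^sup>2) * ?t"
      using t by (intro mult_right_mono mult_left_mono) auto
    then show "real n * \<sigma>\<^sup>2 * ?t \<le> \<delta>" using tail by linarith
  qed
  have "\<delta> \<le> \<bar>?L \<omega>\<bar> \<longleftrightarrow> \<delta>\<^sup>2 \<le> (?L \<omega>)\<^sup>2" for \<omega>
    using \<delta> abs_le_square_iff[of \<delta> "?L \<omega>"] by simp
  then have "prob ?E2 = prob {\<omega>\<in>space M. \<delta>\<^sup>2 \<le> (?L \<omega>)\<^sup>2}"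
    by presburger
  also have "\<dots> \<le> expectation (\<lambda>\<omega>. (?L \<omega>)\<^sup>2) / \<delta>\<^sup>2"
    by (rule integral_Markov_inequality_measure[where A="{}"], rule xi_linear_second_moment) (use \<delta> in auto)
  also have "expectation (\<lambda>\<omega>. (?L \<omega>)\<^sup>2) = (\<Sum>j=1..N. (b j)\<^sup>2)"
    by (intro xi_linear_second_moment) auto
  also have "\<dots> \<le> (\<Sum>j=1..N. (4 * real n ^ 3 * \<sigma>\<^sup>2 * ((\<kappa> n 1)\<^sup>2)\<^sup>2) * (coef g j)\<^sup>2)"
  proof (rule sum_mono)
    fix j assume "j \<in> {1..N}"
    then have "((\<kappa> n j)\<^sup>2)\<^sup>2 \<le> ((\<kappa> n 1)\<^sup>2)\<^sup>2"
      by (intro power_mono kappa_sq_antimono[OF A1 n]) auto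
    have "(b j)\<^sup>2 = 4 * (real n)^4 * u\<^sup>2 * (coef g j)\<^sup>2 * ((\<kappa> n j)\<^sup>2)\<^sup>2"
      by (simp add: b_def power_mult_distrib flip: power_mult)
    also have "\<dots> \<le> 4 * (real n)^4 * u\<^sup>2 * (coef g j)\<^sup>2 * ((\<kappa> n 1)\<^sup>2)\<^sup>2"
      by (intro mult_left_mono) (fact, simp)
    also have "4 * (real n)^4 * u\<^sup>2 = 4 * real n ^ 3 * \<sigma>\<^sup>2"
      using n unfolding u by (simp add: eval_nat_numeral)
    finally show "(b j)\<^sup>2 \<le> (4 * real n ^ 3 * \<sigma>\<^sup>2 * ((\<kappa> n 1)\<^sup>2)\<^sup>2) * (coef g j)\<^sup>2"
      by (simp add: mult_ac)
  qed
  also have "\<dots> = (4 * real n ^ 3 * \<sigma>\<^sup>2 * ((\<kappa> n 1)\<^sup>2)\<^sup>2) * (\<Sum>j=1..N. (coef g j)\<^sup>2)"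
    by (simp add: sum_distrib_left)
  also have "\<dots> \<le> (4 * real n ^ 3 * \<sigma>\<^sup>2 * ((\<kappa> n 1)\<^sup>2)\<^sup>2) * (l2_norm g)\<^sup>2"
    by (intro mult_left_mono finite_sum_le_has_sum[OF parseval[OF basis g]]) auto
  finally have E2: "prob ?E2 \<le> 4 * real n ^ 3 * \<sigma>\<^sup>2 * ((\<kappa> n 1)\<^sup>2)\<^sup>2 * (l2_norm g)\<^sup>2 / \<delta>\<^sup>2"
    using \<delta> by (simp add: divide_right_mono)
  have "prob {\<omega>\<in>space M. 3 * \<delta> < \<bar>(real n)\<^sup>2 * stat n g \<omega> - (noise_part n N \<omega> + signal n g)\<bar>} \<le> prob (?E1 \<union> ?E2)"
  proof (rule finite_measure_mono)
    show "{\<omega>\<in>space M. 3 * \<delta> < \<bar>(real n)\<^sup>2 * stat n g \<omega> - (noise_part n N \<omega> + signal n g)\<bar>} \<subseteq> ?E1 \<union> ?E2"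
    proof safe
      fix \<omega> assume \<omega>: "\<omega> \<in> space M" "3 * \<delta> < \<bar>(real n)\<^sup>2 * stat n g \<omega> - (noise_part n N \<omega> + signal n g)\<bar>"
        "\<not> \<delta> \<le> \<bar>?L \<omega>\<bar>"
      then show "\<delta> < \<bar>(real n)\<^sup>2 * stat n g \<omega> - ?S \<omega>\<bar>"
        using sig expand[of \<omega>] by linarith
    qed
  qed measurable
  also have "\<dots> \<le> prob ?E1 + prob ?E2"
    by (intro measure_Un_le) measurable
  finally show ?thesis using E1 E2 by linarith
qed

end

section \<open>Uniform normal approximation of the type II error\<close>

context white_noise_test
begin

abbreviation "type1 \<equiv> type1_error M \<xi> \<sigma> \<phi> \<kappa>"
abbreviation "type2 \<equiv> type2_error M \<xi> \<sigma> \<phi> \<kappa>"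

lemma type1_eq:
  assumes "1 \<le> n"
  shows "type1 n x = 1 - type2 n x (\<lambda>_. 0)"
proof -
  have [measurable]: "random_variable borel (stat n (\<lambda>_. 0))"
    by (rule stat_measurable[OF L2_zero assms])
  have "{\<omega> \<in> space M. stat n (\<lambda>_. 0) \<omega> > x} = space M - {\<omega> \<in> space M. stat n (\<lambda>_. 0) \<omega> \<le> x}"
    by auto
  then show ?thesis unfolding type1_error_def type2_error_def by (simp add: prob_compl)
qed

text \<open>
  A truncation index that depends on \<open>n\<close> but not on the alternative: the lost mass \<open>1 / n\<^sup>3\<close> is
  negligible after multiplication by \<open>n\<^sup>2\<close>, and half of \<open>\<Sum>\<kappa>\<^sup>4\<close> is retained, which keeps the
  variance of the truncated noise away from zero.
\<close>

lemma truncation_exists: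
  assumes "1 \<le> n"
  shows "\<exists>N. rho \<kappa> n - (\<Sum>j=1..N. (\<kappa> n j)\<^sup>2) \<le> 1 / real n ^ 3 \<and>
    \<sigma> ^ 4 * A_coef \<sigma> \<kappa> n / (real n)\<^sup>2 / 2 \<le> (\<Sum>j=1..N. \<kappa> n j ^ 4)"
proof -
  let ?K = "\<sigma> ^ 4 * A_coef \<sigma> \<kappa> n / (real n)\<^sup>2"
  have K: "0 < ?K" using A_coef_has_sum(2)[OF A2 assms sigma] sigma assms by simp
  have "(\<lambda>N. \<Sum>j=1..N. (\<kappa> n j)\<^sup>2) \<longlonglongrightarrow> rho \<kappa> n"
    using rho_has_sum(1)[OF A3 assms] by (subst (asm) has_sum_from_1_iff_tendsto) auto
  then have "\<forall>\<^sub>F N in sequentially. rho \<kappa> n - 1 / real n ^ 3 < (\<Sum>j=1..N. (\<kappa> n j)\<^sup>2)"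
    using assms by (intro order_tendstoD(1)) auto
  moreover have "(\<lambda>N. \<Sum>j=1..N. \<kappa> n j ^ 4) \<longlonglongrightarrow> ?K"
    using A_coef_has_sum(1)[OF A2 assms sigma] by (subst (asm) has_sum_from_1_iff_tendsto) auto
  then have "\<forall>\<^sub>F N in sequentially. ?K / 2 < (\<Sum>j=1..N. \<kappa> n j ^ 4)"
    using K by (intro order_tendstoD(1)) auto
  ultimately have "\<forall>\<^sub>F N in sequentially. rho \<kappa> n - (\<Sum>j=1..N. (\<kappa> n j)\<^sup>2) \<le> 1 / real n ^ 3 \<and>
      ?K / 2 \<le> (\<Sum>j=1..N. \<kappa> n j ^ 4)"
    by eventually_elim auto
  then show ?thesis using eventually_happens by fastforce
qed

lemma powr_rate_tendsto_0: "(\<lambda>n. real n powr (2 * r - 1)) \<longlonglongrightarrow> 0"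
  using r by (intro tendsto_neg_powr filterlim_real_sequentially) auto

text \<open>
  At the scale \<open>s\<close>, the rescaled statistic is asymptotically normal with mean \<open>signal n g\<close> and standard
  deviation \<open>s n\<close>, uniformly over all thresholds and all alternatives in a ball of radius
  \<open>C * n powr - r\<close>. Uniformity in \<open>g\<close> covers full sequences and subsequences of alternatives, as well
  as the hypothesis \<open>g = 0\<close>, by a single statement.
\<close>

definition normal_scale :: "(nat \<Rightarrow> real) \<Rightarrow> bool" where
  "normal_scale s \<longleftrightarrow> (\<forall>C. \<forall>\<epsilon>>0. \<forall>\<^sub>F n in sequentially. \<forall>g\<in>L2. l2_norm g \<le> C * real n powr (- r) \<longrightarrow>
     (\<forall>x. \<bar>type2 n x g - std_normal_cdf (((real n)\<^sup>2 * x - signal n g) / s n)\<bar> \<le> \<epsilon>))"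

text \<open>
  The scale is the standard deviation of the truncated noise part, which lies between two positive
  constants by \<open>cond_A2\<close>. The weights are uniformly small relative to it, and the variance of the
  linear term vanishes, both at the rate \<open>n * n powr (2 r - 2) = n powr (2 r - 1)\<close>; this is where
  \<open>r < 1/2\<close> enters.
\<close>

lemma normal_approximation:
  "\<exists>s lo hi. normal_scale s \<and> 0 < lo \<and> (\<forall>n\<ge>1. lo \<le> s n \<and> s n \<le> hi)"
proof -
  obtain N where N: "\<And>n. 1 \<le> n \<Longrightarrow> rho \<kappa> n - (\<Sum>j=1..N n. (\<kappa> n j)\<^sup>2) \<le> 1 / real n ^ 3"
    "\<And>n. 1 \<le> n \<Longrightarrow> \<sigma> ^ 4 * A_coef \<sigma> \<kappa> n / (real n)\<^sup>2 / 2 \<le> (\<Sum>j=1..N n. \<kappa> n j ^ 4)"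
    using truncation_exists by metis
  obtain a A where a: "0 < a" and A: "0 < A"
    and aA: "\<And>n. 1 \<le> n \<Longrightarrow> a < A_coef \<sigma> \<kappa> n \<and> A_coef \<sigma> \<kappa> n < A"
    using A2 unfolding cond_A2_def by blast
  obtain B where B: "0 < B" "\<forall>\<^sub>F n in sequentially. (\<kappa> n 1)\<^sup>2 \<le> B * real n powr (2 * r - 2)"
    using kappa_sq_rate[OF A1 A2 A3 A5 sigma] by (metis (mono_tags, lifting) eventually_mono)
  define w where "w n j = real n * \<sigma>\<^sup>2 * (\<kappa> n j)\<^sup>2" for n j
  define v where "v n = (\<Sum>j=1..N n. (w n j)\<^sup>2)" for n
  define s where "s n = sqrt (2 * v n)" for n
  define lo hi where "lo = sqrt (\<sigma> ^ 8 * a)" and "hi = sqrt (2 * (\<sigma> ^ 8 * A))"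
  have v: "\<sigma> ^ 8 * a / 2 \<le> v n \<and> v n \<le> \<sigma> ^ 8 * A" if n: "1 \<le> n" for n
  proof -
    have v_eq: "v n = (real n)\<^sup>2 * \<sigma> ^ 4 * (\<Sum>j=1..N n. \<kappa> n j ^ 4)"
      by (simp add: v_def w_def power_mult_distrib sum_distrib_left flip: power_mult)
    have "(real n)\<^sup>2 * \<sigma> ^ 4 * (\<sigma> ^ 4 * A_coef \<sigma> \<kappa> n / (real n)\<^sup>2 / 2) \<le> v n"
      unfolding v_eq using N(2)[OF n] by (intro mult_left_mono) auto
    moreover have "(real n)\<^sup>2 * \<sigma> ^ 4 * (\<sigma> ^ 4 * A_coef \<sigma> \<kappa> n / (real n)\<^sup>2 / 2) = \<sigma> ^ 8 * A_coef \<sigma> \<kappa> n / 2"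
      using n by (simp flip: power_add)
    moreover have "\<sigma> ^ 8 * a / 2 \<le> \<sigma> ^ 8 * A_coef \<sigma> \<kappa> n / 2"
      using aA[OF n] by (intro divide_right_mono mult_left_mono) auto
    moreover have "v n \<le> (real n)\<^sup>2 * \<sigma> ^ 4 * (\<sigma> ^ 4 * A_coef \<sigma> \<kappa> n / (real n)\<^sup>2)"
      unfolding v_eq
      by (intro mult_left_mono finite_sum_le_has_sum[OF A_coef_has_sum(1)[OF A2 n sigma]]) auto
    moreover have "(real n)\<^sup>2 * \<sigma> ^ 4 * (\<sigma> ^ 4 * A_coef \<sigma> \<kappa> n / (real n)\<^sup>2) = \<sigma> ^ 8 * A_coef \<sigma> \<kappa> n"
      using n by (simp flip: power_add)
    moreover have "\<sigma> ^ 8 * A_coef \<sigma> \<kappa> n \<le> \<sigma> ^ 8 * A"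
      using aA[OF n] by (intro mult_left_mono) auto
    ultimately show ?thesis by (intro conjI) linarith+
  qed
  have lo: "0 < lo" using sigma a by (simp add: lo_def)
  have s: "lo \<le> s n \<and> s n \<le> hi" if "1 \<le> n" for n
    using v[OF that] by (simp add: lo_def hi_def s_def)
  have rate: "real n * real n powr (2 * r - 2) = real n powr (2 * r - 1)" if "1 \<le> n" for n
    using that powr_add[of "real n" 1 "2 * r - 2"] by (simp add: algebra_simps)
  \<comment> \<open>A bound for the normalised weights, since \<open>v n \<ge> lo\<^sup>2 / 2\<close>.\<close>
  define e where "e n = real n * \<sigma>\<^sup>2 * (\<kappa> n 1)\<^sup>2 / (lo / sqrt 2)" for n
  have e0: "e \<longlonglongrightarrow> 0"
  proof (rule Lim_null_comparison)
    show "\<forall>\<^sub>F n in sequentially. norm (e n) \<le> \<sigma>\<^sup>2 * B / (lo / sqrt 2) * real n powr (2 * r - 1)"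
      using B(2) eventually_ge_at_top[of 1]
    proof eventually_elim
      case (elim n)
      have "norm (e n) = \<sigma>\<^sup>2 / (lo / sqrt 2) * (real n * (\<kappa> n 1)\<^sup>2)"
        using lo by (simp add: e_def abs_mult)
      also have "\<dots> \<le> \<sigma>\<^sup>2 / (lo / sqrt 2) * (real n * (B * real n powr (2 * r - 2)))"
        using elim lo by (intro mult_left_mono) auto
      also have "\<dots> = \<sigma>\<^sup>2 * B / (lo / sqrt 2) * (real n * real n powr (2 * r - 2))"
        by simp
      finally show ?case using elim by (simp only: rate)
    qed
    show "(\<lambda>n. \<sigma>\<^sup>2 * B / (lo / sqrt 2) * real n powr (2 * r - 1)) \<longlonglongrightarrow> 0"
      by (intro tendsto_mult_right_zero powr_rate_tendsto_0)
  qed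
  have clt: "\<forall>\<^sub>F n in sequentially. \<forall>y. \<bar>prob {\<omega>\<in>space M. noise_part n (N n) \<omega> \<le> y}
      - std_normal_cdf (y / s n)\<bar> \<le> \<epsilon>" if "0 < \<epsilon>" for \<epsilon>
  proof -
    have "\<forall>\<^sub>F n in sequentially. \<forall>y.
        \<bar>prob {\<omega>\<in>space M. (\<Sum>j=1..N (Suc n). w (Suc n) j * ((\<xi> j \<omega>)\<^sup>2 - 1)) \<le> y}
        - std_normal_cdf (y / sqrt (2 * (\<Sum>j=1..N (Suc n). (w (Suc n) j)\<^sup>2)))\<bar> \<le> \<epsilon>"
    proof (rule chi_square_uniform_clt[where \<epsilon> = "\<lambda>n. e (Suc n)"])
      have sa: "0 < \<sigma> ^ 8 * a / 2" using sigma a by simp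
      then show pos: "0 < (\<Sum>j=1..N (Suc n). (w (Suc n) j)\<^sup>2)" for n
        using v[of "Suc n"] by (simp add: v_def)
      show "\<bar>w (Suc n) j\<bar> / sqrt (\<Sum>j=1..N (Suc n). (w (Suc n) j)\<^sup>2) \<le> e (Suc n)"
        if "j \<in> {1..N (Suc n)}" for n j
        unfolding e_def
      proof (intro frac_le)
        show "\<bar>w (Suc n) j\<bar> \<le> real (Suc n) * \<sigma>\<^sup>2 * (\<kappa> (Suc n) 1)\<^sup>2"
          unfolding w_def using kappa_sq_antimono[OF A1, of "Suc n" 1 j] that
          by (auto simp: abs_mult intro!: mult_left_mono)
        have "lo / sqrt 2 = sqrt (\<sigma> ^ 8 * a / 2)" by (simp add: lo_def real_sqrt_divide)
        then show "lo / sqrt 2 \<le> sqrt (\<Sum>j=1..N (Suc n). (w (Suc n) j)\<^sup>2)"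
          using v[of "Suc n"] by (simp add: v_def)
      qed (use lo in auto)
      show "(\<lambda>n. e (Suc n)) \<longlonglongrightarrow> 0" using e0 by (rule LIMSEQ_Suc)
    qed (rule that)
    then show ?thesis
      unfolding w_def[symmetric] s_def v_def by (subst (asm) eventually_sequentially_Suc)
  qed
  have "\<forall>\<^sub>F n in sequentially. \<forall>g\<in>L2. l2_norm g \<le> C * real n powr (- r) \<longrightarrow>
       (\<forall>x. \<bar>type2 n x g - std_normal_cdf (((real n)\<^sup>2 * x - signal n g) / s n)\<bar> \<le> \<epsilon>)"
    if \<epsilon>: "0 < \<epsilon>" for C \<epsilon>
  proof -
    \<comment> \<open>The error budget is four times \<open>\<epsilon> / 4\<close>: normal approximation, truncation, linear term, and the
        shift of the threshold by \<open>3 * \<delta>\<close>, which costs \<open>3 * \<delta> / lo\<close>.\<close>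
    define \<delta> where "\<delta> = \<epsilon> * lo / 12"
    have \<delta>: "0 < \<delta>" using \<epsilon> lo by (simp add: \<delta>_def)
    have "(\<lambda>n. (\<sigma>\<^sup>2 + C\<^sup>2) / real n) \<longlonglongrightarrow> 0"
      by (intro tendsto_divide_0[OF tendsto_const] filterlim_at_top_imp_at_infinity filterlim_real_sequentially)
    then have ev1: "\<forall>\<^sub>F n in sequentially. (\<sigma>\<^sup>2 + C\<^sup>2) / real n < min \<delta> (\<delta> * (\<epsilon> / 4))"
      using \<delta> \<epsilon> by (intro order_tendstoD(2)) auto
    have "(\<lambda>n. 4 * \<sigma>\<^sup>2 * B\<^sup>2 * C\<^sup>2 * real n powr (2 * r - 1)) \<longlonglongrightarrow> 0"
      by (intro tendsto_mult_right_zero powr_rate_tendsto_0)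
    then have ev2: "\<forall>\<^sub>F n in sequentially. 4 * \<sigma>\<^sup>2 * B\<^sup>2 * C\<^sup>2 * real n powr (2 * r - 1) < \<delta>\<^sup>2 * (\<epsilon> / 4)"
      using \<delta> \<epsilon> by (intro order_tendstoD(2)) auto
    have "0 < \<epsilon> / 4" using \<epsilon> by simp
    from ev1 ev2 clt[OF this] B(2) eventually_ge_at_top[of 1] show ?thesis
    proof eventually_elim
      case (elim n)
      note n = \<open>1 \<le> n\<close>
      let ?t = "rho \<kappa> n - (\<Sum>j=1..N n. (\<kappa> n j)\<^sup>2)"
      show ?case
      proof (intro ballI impI allI)
        fix g x assume g: "g \<in> L2" and norm: "l2_norm g \<le> C * real n powr (- r)"
        have norm2: "(l2_norm g)\<^sup>2 \<le> C\<^sup>2 * real n powr (- 2 * r)"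
        proof -
          have "(l2_norm g)\<^sup>2 \<le> (C * real n powr (- r))\<^sup>2"
            using norm l2_norm_nonneg by (intro power_mono)
          also have "\<dots> = C\<^sup>2 * (real n powr (- r) * real n powr (- r))"
            by (simp add: power2_eq_square)
          also have "real n powr (- r) * real n powr (- r) = real n powr (- 2 * r)"
            by (simp flip: powr_add)
          finally show ?thesis .
        qed
        have "real n powr (- 2 * r) \<le> real n powr 0"
          using n r by (intro powr_mono) auto
        then have norm2': "(l2_norm g)\<^sup>2 \<le> C\<^sup>2"
          using norm2 n mult_left_mono[of "real n powr (- 2 * r)" 1 "C\<^sup>2"] by simp
        have t0: "0 \<le> ?t" using partial_rho_le[OF n, of "N n"] by simp
        have tail: "real n * (\<sigma>\<^sup>2 + real n * (l2_norm g)\<^sup>2) * ?t \<le> (\<sigma>\<^sup>2 + C\<^sup>2) / real n"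
        proof -
          have "real n * (\<sigma>\<^sup>2 + real n * (l2_norm g)\<^sup>2) * ?t \<le>
              real n * (real n * \<sigma>\<^sup>2 + real n * C\<^sup>2) * (1 / real n ^ 3)"
            using n t0 N(1)[OF n] norm2' mult_right_mono[of 1 "real n" "\<sigma>\<^sup>2"]
            by (intro mult_mono add_mono) auto
          also have "\<dots> = (\<sigma>\<^sup>2 + C\<^sup>2) / real n"
            using n by (simp add: power3_eq_cube field_simps)
          finally show ?thesis .
        qed
        have linear: "4 * real n ^ 3 * \<sigma>\<^sup>2 * ((\<kappa> n 1)\<^sup>2)\<^sup>2 * (l2_norm g)\<^sup>2 \<le>
          4 * \<sigma>\<^sup>2 * B\<^sup>2 * C\<^sup>2 * real n powr (2 * r - 1)"
        proof -
          have "((\<kappa> n 1)\<^sup>2)\<^sup>2 \<le> (B * real n powr (2 * r - 2))\<^sup>2"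
            using elim by (intro power_mono) auto
          then have "4 * real n ^ 3 * \<sigma>\<^sup>2 * ((\<kappa> n 1)\<^sup>2)\<^sup>2 * (l2_norm g)\<^sup>2 \<le>
              4 * real n ^ 3 * \<sigma>\<^sup>2 * (B * real n powr (2 * r - 2))\<^sup>2 * (C\<^sup>2 * real n powr (- 2 * r))"
            using norm2 by (intro mult_mono mult_left_mono) auto
          also have "\<dots> = 4 * \<sigma>\<^sup>2 * B\<^sup>2 * C\<^sup>2 *
              (real n ^ 3 * (real n powr (2 * r - 2) * real n powr (2 * r - 2) * real n powr (- 2 * r)))"
            by (simp add: power_mult_distrib power2_eq_square mult_ac)
          also have "real n ^ 3 * (real n powr (2 * r - 2) * real n powr (2 * r - 2) * real n powr (- 2 * r))
              = real n powr (2 * r - 1)"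
          proof -
            have "real n ^ 3 = real n powr 3" using n by (simp add: powr_numeral)
            then show ?thesis by (simp only: powr_add[symmetric]) (simp add: algebra_simps)
          qed
          finally show ?thesis .
        qed
        have tail_\<delta>: "real n * (\<sigma>\<^sup>2 + real n * (l2_norm g)\<^sup>2) * ?t \<le> \<delta>"
          and tail_\<epsilon>: "real n * (\<sigma>\<^sup>2 + real n * (l2_norm g)\<^sup>2) * ?t \<le> \<delta> * (\<epsilon> / 4)"
          using tail elim(1) by linarith+
        have linear_\<epsilon>: "4 * real n ^ 3 * \<sigma>\<^sup>2 * ((\<kappa> n 1)\<^sup>2)\<^sup>2 * (l2_norm g)\<^sup>2 \<le> \<delta>\<^sup>2 * (\<epsilon> / 4)"
          using linear elim(2) by linarith
        have "prob {\<omega>\<in>space M. 3 * \<delta> < \<bar>(real n)\<^sup>2 * stat n g \<omega> - (noise_part n (N n) \<omega> + signal n g)\<bar>} \<le>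
          real n * (\<sigma>\<^sup>2 + real n * (l2_norm g)\<^sup>2) * ?t / \<delta>
          + 4 * real n ^ 3 * \<sigma>\<^sup>2 * ((\<kappa> n 1)\<^sup>2)\<^sup>2 * (l2_norm g)\<^sup>2 / \<delta>\<^sup>2"
          by (intro stat_approx g n \<delta> tail_\<delta>)
        also have "\<dots> \<le> \<delta> * (\<epsilon> / 4) / \<delta> + \<delta>\<^sup>2 * (\<epsilon> / 4) / \<delta>\<^sup>2"
          using \<delta> by (intro add_mono divide_right_mono tail_\<epsilon> linear_\<epsilon>) auto
        also have "\<dots> = \<epsilon> / 4 + \<epsilon> / 4" using \<delta> by simp
        finally have close: "prob {\<omega>\<in>space M. 3 * \<delta> <
            \<bar>(real n)\<^sup>2 * stat n g \<omega> - (noise_part n (N n) \<omega> + signal n g)\<bar>} \<le> \<epsilon> / 4 + \<epsilon> / 4" .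
        have sn: "0 < s n" "lo \<le> s n" using s[OF n] lo by auto
        have [measurable]: "random_variable borel (\<lambda>\<omega>. (real n)\<^sup>2 * stat n g \<omega>)"
          using stat_measurable[OF g n] by measurable
        have meas_noise: "random_variable borel (noise_part n (N n))"
        proof (rule borel_measurable_sum)
          fix j assume "j \<in> {1..N n}"
          then have [measurable]: "random_variable borel (\<xi> j)" using xi_measurable by simp
          show "random_variable borel (\<lambda>\<omega>. real n * \<sigma>\<^sup>2 * (\<kappa> n j)\<^sup>2 * ((\<xi> j \<omega>)\<^sup>2 - 1))"
            by measurable
        qed
        have "stat n g \<omega> \<le> x \<longleftrightarrow> (real n)\<^sup>2 * stat n g \<omega> \<le> (real n)\<^sup>2 * x" for \<omega>
          using n by simp
        then have "type2 n x g = prob {\<omega>\<in>space M. (real n)\<^sup>2 * stat n g \<omega> \<le> (real n)\<^sup>2 * x}"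
          unfolding type2_error_def by presburger
        moreover have "\<bar>prob {\<omega>\<in>space M. (real n)\<^sup>2 * stat n g \<omega> \<le> (real n)\<^sup>2 * x}
            - std_normal_cdf (((real n)\<^sup>2 * x - signal n g) / s n)\<bar> \<le> \<epsilon> / 4 + (\<epsilon> / 4 + \<epsilon> / 4) + 3 * \<delta> / s n"
          using elim(3) \<delta> close meas_noise sn by (intro cdf_perturbation) auto
        moreover have "3 * \<delta> / s n \<le> \<epsilon> / 4"
        proof -
          have "3 * \<delta> / s n \<le> 3 * \<delta> / lo" using sn \<delta> lo by (intro divide_left_mono) auto
          also have "\<dots> = \<epsilon> / 4" using lo by (simp add: \<delta>_def)
          finally show ?thesis .
        qed
        ultimately show "\<bar>type2 n x g - std_normal_cdf (((real n)\<^sup>2 * x - signal n g) / s n)\<bar> \<le> \<epsilon>"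
          by linarith
      qed
    qed
  qed
  then have "normal_scale s" unfolding normal_scale_def by blast
  with lo s show ?thesis by blast
qed

end

section \<open>Consistency in terms of the signal\<close>

lemma has_sum_initial_segment:
  fixes h :: "nat \<Rightarrow> real"
  shows "((\<lambda>j. if j \<le> L then h j else 0) has_sum (\<Sum>j=1..L. h j)) {1..}"
proof -
  have "((\<lambda>j. if j \<le> L then h j else 0) has_sum (\<Sum>j=1..L. h j)) {1..} \<longleftrightarrow>
      (h has_sum (\<Sum>j=1..L. h j)) {1..L}"
    by (intro has_sum_cong_neutral) auto
  then show ?thesis by (simp add: has_sum_finite)
qed

text \<open>
  The squared norm of \<open>g2\<close> is \<open>\<langle>g, g2\<rangle>\<close>, and each product of coefficients is split by Young's
  inequality according to where the energy is expected to be scarce. For \<open>j \<le> L\<close> the parameter \<open>c\<close>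
  charges \<open>g2\<close>; beyond \<open>L\<close> the parameter \<open>2\<close> charges \<open>g\<close> and leaves a quarter of the squared norm
  of \<open>g2\<close>, which is absorbed on the left.
\<close>

lemma orthogonal_component_bound:
  assumes basis: "orthonormal_basis \<phi>" and L2: "g \<in> L2" "g1 \<in> L2" "g2 \<in> L2"
    and "AE t in unit_leb. g t = g1 t + g2 t" "l2_inner g2 g1 = 0" and "0 < c"
  shows "3 / 4 * (l2_norm g2)\<^sup>2 \<le> c / 2 * (l2_norm g)\<^sup>2
    + (\<Sum>j=1..L. (l2_inner g2 (\<phi> j))\<^sup>2) / (2 * c)
    + ((l2_norm g)\<^sup>2 - (\<Sum>j=1..L. (l2_inner g (\<phi> j))\<^sup>2))"
proof -
  let ?a = "\<lambda>j. l2_inner g (\<phi> j)" and ?b = "\<lambda>j. l2_inner g2 (\<phi> j)"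
  have young: "x * y \<le> e / 2 * x\<^sup>2 + y\<^sup>2 / (2 * e)" if "0 < e" for x y e :: real
  proof -
    have "0 \<le> (e * x - y)\<^sup>2 / (2 * e)" using that by simp
    also have "\<dots> = e / 2 * x\<^sup>2 + y\<^sup>2 / (2 * e) - x * y"
      using that by (simp add: field_simps power2_eq_square)
    finally show ?thesis by simp
  qed
  have "(l2_norm g2)\<^sup>2 \<le> c / 2 * (l2_norm g)\<^sup>2 + 1 / 4 * (l2_norm g2)\<^sup>2
    + 1 / (2 * c) * (\<Sum>j=1..L. (?b j)\<^sup>2) + ((l2_norm g)\<^sup>2 + - (\<Sum>j=1..L. (?a j)\<^sup>2))"
  proof (rule has_sum_mono)
    show "((\<lambda>j. ?a j * ?b j) has_sum (l2_norm g2)\<^sup>2) {1..}"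
      by (rule orthogonal_decomposition_coeffs(2)) fact+
    show "((\<lambda>j. c / 2 * (?a j)\<^sup>2 + 1 / 4 * (?b j)\<^sup>2 + 1 / (2 * c) * (if j \<le> L then (?b j)\<^sup>2 else 0)
        + ((?a j)\<^sup>2 + - (if j \<le> L then (?a j)\<^sup>2 else 0))) has_sum
        (c / 2 * (l2_norm g)\<^sup>2 + 1 / 4 * (l2_norm g2)\<^sup>2
    + 1 / (2 * c) * (\<Sum>j=1..L. (?b j)\<^sup>2) + ((l2_norm g)\<^sup>2 + - (\<Sum>j=1..L. (?a j)\<^sup>2)))) {1..}"
      by (intro has_sum_add has_sum_cmult_right has_sum_uminusI parseval basis L2 has_sum_initial_segment)
    show "?a j * ?b j \<le> c / 2 * (?a j)\<^sup>2 + 1 / 4 * (?b j)\<^sup>2 + 1 / (2 * c) * (if j \<le> L then (?b j)\<^sup>2 else 0)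
        + ((?a j)\<^sup>2 + - (if j \<le> L then (?a j)\<^sup>2 else 0))" for j
    proof (cases "j \<le> L")
      case True
      moreover have "?a j * ?b j \<le> c / 2 * (?a j)\<^sup>2 + (?b j)\<^sup>2 / (2 * c)" "0 \<le> 1 / 4 * (?b j)\<^sup>2"
        using young[OF \<open>0 < c\<close>] by auto
      moreover have "1 / (2 * c) * (?b j)\<^sup>2 = (?b j)\<^sup>2 / (2 * c)" by simp
      ultimately show ?thesis by (simp only: if_True, linarith?)
    next
      case False
      moreover have "?a j * ?b j \<le> (?a j)\<^sup>2 + 1 / 4 * (?b j)\<^sup>2" "0 \<le> c / 2 * (?a j)\<^sup>2"
        using young[of 2 "?a j" "?b j"] \<open>0 < c\<close> by auto
      ultimately show ?thesis by (simp only: if_False, linarith?)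
    qed
  qed
  then show ?thesis by simp
qed

lemma tail_energy:
  assumes "orthonormal_basis \<phi>" "g \<in> L2"
  shows "(\<Sum>\<^sub>\<infinity>j\<in>{j. 1 \<le> j \<and> y < real j}. (l2_inner g (\<phi> j))\<^sup>2) =
    (l2_norm g)\<^sup>2 - (\<Sum>j=1..nat \<lfloor>y\<rfloor>. (l2_inner g (\<phi> j))\<^sup>2)"
proof -
  let ?a = "\<lambda>j. (l2_inner g (\<phi> j))\<^sup>2" and ?L = "nat \<lfloor>y\<rfloor>"
  have "((\<lambda>j. ?a j + - (if j \<le> ?L then ?a j else 0)) has_sum ((l2_norm g)\<^sup>2 + - (\<Sum>j=1..?L. ?a j))) {1..}"
    by (intro has_sum_add has_sum_uminusI parseval assms has_sum_initial_segment)
  moreover have "((\<lambda>j. ?a j + - (if j \<le> ?L then ?a j else 0)) has_sum S) {1..} \<longleftrightarrow>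
      (?a has_sum S) {j. 1 \<le> j \<and> y < real j}" for S
  proof (intro has_sum_cong_neutral)
    fix j assume "j \<in> {1..} - {j. 1 \<le> j \<and> y < real j}"
    then have "j \<le> ?L" by (auto simp: le_nat_floor)
    then show "?a j + - (if j \<le> ?L then ?a j else 0) = 0" by simp
  next
    fix j assume "j \<in> {1..} \<inter> {j. 1 \<le> j \<and> y < real j}"
    then have "1 \<le> j" "\<lfloor>y\<rfloor> < int j" by (auto simp: floor_less_iff)
    then have "\<not> j \<le> ?L" by linarith
    then show "?a j + - (if j \<le> ?L then ?a j else 0) = ?a j" by simp
  qed auto
  ultimately have "(?a has_sum ((l2_norm g)\<^sup>2 + - (\<Sum>j=1..?L. ?a j))) {j. 1 \<le> j \<and> y < real j}"
    by blast
  then show ?thesis by (simp add: infsumI)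
qed

context white_noise_test
begin

lemma signal_nonneg: "0 \<le> signal n g"
  unfolding scaled_signal_def by (intro mult_nonneg_nonneg infsum_nonneg) auto

lemma signal_le:
  assumes "g \<in> L2" "1 \<le> n" and K: "\<And>j. 1 \<le> j \<Longrightarrow> coef g j \<noteq> 0 \<Longrightarrow> (\<kappa> n j)\<^sup>2 \<le> K"
  shows "signal n g \<le> (real n)\<^sup>2 * (K * (l2_norm g)\<^sup>2)"
proof -
  have "signal n g / (real n)\<^sup>2 \<le> K * (l2_norm g)\<^sup>2"
  proof (rule has_sum_mono[OF signal_has_sum[OF assms(1,2)]])
    show "((\<lambda>j. K * (coef g j)\<^sup>2) has_sum K * (l2_norm g)\<^sup>2) {1..}"
      by (intro has_sum_cmult_right parseval basis assms)
    show "(\<kappa> n j)\<^sup>2 * (coef g j)\<^sup>2 \<le> K * (coef g j)\<^sup>2" if "j \<in> {1..}" for j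
      using K[of j] that by (cases "coef g j = 0") (auto intro: mult_right_mono)
  qed
  then show ?thesis using assms(2) by (simp add: pos_divide_le_eq mult.commute)
qed

text \<open>
  Up to a fixed multiple of \<open>k_idx\<close>, the weights are at least a constant times \<open>kappa_sq\<close> by the second
  part of \<open>cond_A5\<close> and monotonicity, hence at least of order \<open>n powr (2 r - 2)\<close>.
\<close>

lemma signal_ge_head:
  assumes "0 < C1"
  obtains b where "0 < b" "\<forall>\<^sub>F n in sequentially. \<forall>g\<in>L2.
    b * real n powr (2 * r) * (\<Sum>j=1..nat \<lfloor>C1 * real (k_idx \<kappa> n)\<rfloor>. (coef g j)\<^sup>2) \<le> signal n g"
proof -
  define c where "c = max C1 1 + 1"
  have c: "1 < c" "C1 \<le> c" by (auto simp: c_def)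
  obtain D where D: "0 < D" "\<And>n. 1 \<le> n \<Longrightarrow> D * kappa_sq \<kappa> n \<le> (\<kappa> n (nat \<lfloor>c * real (k_idx \<kappa> n)\<rfloor>))\<^sup>2"
    using A5 c(1) unfolding cond_A5_def by blast
  obtain a where a: "0 < a" "\<forall>\<^sub>F n in sequentially. a * real n powr (2 * r - 2) \<le> kappa_sq \<kappa> n"
    using kappa_sq_rate[OF A1 A2 A3 A5 sigma] by metis
  show ?thesis
  proof
    show "0 < D * a" using D a by simp
    show "\<forall>\<^sub>F n in sequentially. \<forall>g\<in>L2. D * a * real n powr (2 * r) *
        (\<Sum>j=1..nat \<lfloor>C1 * real (k_idx \<kappa> n)\<rfloor>. (coef g j)\<^sup>2) \<le> signal n g"
      using a(2) eventually_ge_at_top[of 1]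
    proof eventually_elim
      case (elim n)
      show ?case
      proof
        fix g assume g: "g \<in> L2"
        let ?L = "nat \<lfloor>C1 * real (k_idx \<kappa> n)\<rfloor>"
        have pow: "(real n)\<^sup>2 * real n powr (2 * r - 2) = real n powr (2 * r)"
          using elim(2) by (simp add: powr_diff powr_numeral)
        have "D * (a * real n powr (2 * r - 2)) * (\<Sum>j=1..?L. (coef g j)\<^sup>2) \<le>
            D * kappa_sq \<kappa> n * (\<Sum>j=1..?L. (coef g j)\<^sup>2)"
          using D elim by (intro mult_right_mono mult_left_mono sum_nonneg) auto
        also have "\<dots> = (\<Sum>j=1..?L. D * kappa_sq \<kappa> n * (coef g j)\<^sup>2)"
          by (simp add: sum_distrib_left)
        also have "\<dots> \<le> (\<Sum>j=1..?L. (\<kappa> n j)\<^sup>2 * (coef g j)\<^sup>2)"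
        proof (intro sum_mono mult_right_mono)
          fix j assume j: "j \<in> {1..?L}"
          have "D * kappa_sq \<kappa> n \<le> (\<kappa> n (nat \<lfloor>c * real (k_idx \<kappa> n)\<rfloor>))\<^sup>2" by (rule D(2)[OF elim(2)])
          also have "\<dots> \<le> (\<kappa> n j)\<^sup>2"
          proof (rule kappa_sq_antimono[OF A1 elim(2)])
            have "?L \<le> nat \<lfloor>c * real (k_idx \<kappa> n)\<rfloor>"
              using c(2) by (intro nat_mono floor_mono mult_right_mono) auto
            then show "j \<le> nat \<lfloor>c * real (k_idx \<kappa> n)\<rfloor>" using j by auto
          qed (use j in auto)
          finally show "D * kappa_sq \<kappa> n \<le> (\<kappa> n j)\<^sup>2" .
        qed auto
        also have "\<dots> \<le> signal n g / (real n)\<^sup>2"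
          by (rule signal_tail_le(2)[OF g elim(2)])
        finally have "(real n)\<^sup>2 * (D * (a * real n powr (2 * r - 2)) * (\<Sum>j=1..?L. (coef g j)\<^sup>2)) \<le>
           (real n)\<^sup>2 * (signal n g / (real n)\<^sup>2)"
          by (intro mult_left_mono) auto
        also have "(real n)\<^sup>2 * (D * (a * real n powr (2 * r - 2)) * (\<Sum>j=1..?L. (coef g j)\<^sup>2)) =
          D * a * ((real n)\<^sup>2 * real n powr (2 * r - 2)) * (\<Sum>j=1..?L. (coef g j)\<^sup>2)"
          by simp
        finally show "D * a * real n powr (2 * r) * (\<Sum>j=1..?L. (coef g j)\<^sup>2) \<le> signal n g"
          using elim(2) unfolding pow by simp
      qed
    qed
  qed
qed

lemma normal_scaleD:
  assumes "normal_scale s" "0 < \<epsilon>"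
  shows "\<forall>\<^sub>F n in sequentially. \<forall>g\<in>L2. l2_norm g \<le> C * real n powr (- r) \<longrightarrow>
     (\<forall>x. \<bar>type2 n x g - std_normal_cdf (((real n)\<^sup>2 * x - signal n g) / s n)\<bar> \<le> \<epsilon>)"
  using assms unfolding normal_scale_def by blast

text \<open>
  If the level tends to \<open>\<alpha>\<close>, the normalised threshold tends to the \<open>(1 - \<alpha>)\<close>-quantile \<open>z\<close>. The shift
  moves the argument of the normal distribution function to the left by at least \<open>q = \<eta> / hi\<close>, so the
  type II error eventually exceeds the value of that function at \<open>z - q / 2\<close> by at most \<open>\<epsilon>\<close>, and this
  value is strictly below \<open>1 - \<alpha>\<close>.
\<close>

lemma consistent_if_signal_bounded_below:
  assumes f: "\<And>n. 1 \<le> n \<Longrightarrow> f n \<in> L2" "\<And>n. 1 \<le> n \<Longrightarrow> l2_norm (f n) \<le> C * real n powr (- r)" and C: "0 \<le> C"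
    and \<eta>: "0 < \<eta>" "\<forall>\<^sub>F n in sequentially. \<eta> \<le> signal n (f n)"
  shows "consistent M \<xi> \<sigma> \<phi> \<kappa> f"
  unfolding consistent_def
proof (intro allI impI, elim conjE)
  fix \<alpha> :: real and x :: "nat \<Rightarrow> real"
  assume \<alpha>: "0 < \<alpha>" "\<alpha> < 1" and level: "(\<lambda>n. type1 n (x n)) \<sim>[sequentially] (\<lambda>_. \<alpha>)"
  obtain s lo hi where scale: "normal_scale s" and lo: "0 < lo"
    and s: "\<And>n. 1 \<le> n \<Longrightarrow> lo \<le> s n \<and> s n \<le> hi"
    using normal_approximation by blast
  have hi: "0 < hi" using lo s[of 1] by linarith
  obtain z where z: "std_normal_cdf z = 1 - \<alpha>"
  proof -
    have "\<forall>\<^sub>F x in at_bot. std_normal_cdf x < 1 - \<alpha>"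
      using std_normal.cdf_lim_at_bot \<alpha> by (intro order_tendstoD(2)) auto
    then obtain a where a: "std_normal_cdf a < 1 - \<alpha>" using eventually_happens by fastforce
    have "\<forall>\<^sub>F x in at_top. 1 - \<alpha> < std_normal_cdf x"
      using std_normal.cdf_lim_at_top_prob \<alpha> by (intro order_tendstoD(1)) auto
    then obtain b where b: "1 - \<alpha> < std_normal_cdf b" using eventually_happens by fastforce
    have "a \<le> b" using a b std_normal.cdf_nondecreasing[of b a] by linarith
    then show ?thesis
      using IVT[of std_normal_cdf a "1 - \<alpha>" b] a b isCont_std_normal_cdf that by auto
  qed
  \<comment> \<open>Half of \<open>q\<close> is given away to the deviation of the normalised threshold from \<open>z\<close>.\<close>
  define q where "q = \<eta> / hi"
  have q: "0 < q" using \<eta> hi by (simp add: q_def)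
  define dn up where "dn = std_normal_cdf (z - q / 2)" and "up = std_normal_cdf (z + q / 2)"
  have below: "dn < 1 - \<alpha>" and above: "1 - \<alpha> < up"
    using std_normal_cdf_strict[of "z - q / 2" z] std_normal_cdf_strict[of z "z + q / 2"] z q by (auto simp: dn_def up_def)
  define \<epsilon> where "\<epsilon> = min ((1 - \<alpha> - dn) / 2) ((up - (1 - \<alpha>)) / 2)"
  have \<epsilon>: "0 < \<epsilon>" using below above by (simp add: \<epsilon>_def)
  have "(\<lambda>n. type1 n (x n)) \<longlonglongrightarrow> \<alpha>"
    using level by (rule asymp_equivD_const)
  then have "\<forall>\<^sub>F n in sequentially. \<alpha> - \<epsilon> < type1 n (x n)"
    using \<epsilon> by (intro order_tendstoD(1)) auto
  then have "\<forall>\<^sub>F n in sequentially. ereal (type2 n (x n) (f n)) \<le> ereal (dn + \<epsilon>)"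
    using normal_scaleD[OF scale \<epsilon>, of C] \<eta>(2) eventually_ge_at_top[of 1]
  proof eventually_elim
    case (elim n)
    note n = \<open>1 \<le> n\<close>
    let ?z = "(real n)\<^sup>2 * x n / s n"
    have sn: "0 < s n" "s n \<le> hi" using s[OF n] lo by auto
    have "l2_norm (\<lambda>_. 0) \<le> C * real n powr (- r)" using C by (simp add: l2_norm_def)
    then have "\<bar>type2 n (x n) (\<lambda>_. 0) - std_normal_cdf (((real n)\<^sup>2 * x n - signal n (\<lambda>_. 0)) / s n)\<bar> \<le> \<epsilon>"
      using elim(2) L2_zero by blast
    then have "std_normal_cdf ?z \<le> type2 n (x n) (\<lambda>_. 0) + \<epsilon>"
      by (simp add: signal_zero abs_le_iff)
    also have "\<dots> < 1 - \<alpha> + 2 * \<epsilon>"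
      using elim(1) type1_eq[OF n, of "x n"] by linarith
    also have "\<dots> \<le> up"
    proof -
      have "\<epsilon> \<le> (up - (1 - \<alpha>)) / 2" unfolding \<epsilon>_def by (rule min.cobounded2)
      then show ?thesis by simp
    qed
    finally have "?z < z + q / 2"
      using std_normal.cdf_nondecreasing[of "z + q / 2" ?z] unfolding up_def by linarith
    moreover have "q \<le> signal n (f n) / s n"
      unfolding q_def using elim(3) sn \<eta>(1) by (intro frac_le) auto
    ultimately have "((real n)\<^sup>2 * x n - signal n (f n)) / s n \<le> z - q / 2"
      unfolding diff_divide_distrib by linarith
    then have "std_normal_cdf (((real n)\<^sup>2 * x n - signal n (f n)) / s n) \<le> dn"
      unfolding dn_def by (rule std_normal.cdf_nondecreasing)
    moreover have "\<bar>type2 n (x n) (f n) - std_normal_cdf (((real n)\<^sup>2 * x n - signal n (f n)) / s n)\<bar> \<le> \<epsilon>"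
      using elim(2) f n by blast
    ultimately show ?case by (simp add: abs_le_iff)
  qed
  then have "limsup (\<lambda>n. ereal (type2 n (x n) (f n))) \<le> ereal (dn + \<epsilon>)"
    by (rule Limsup_bounded)
  also have "\<dots> < ereal (1 - \<alpha>)"
  proof -
    have "\<epsilon> \<le> (1 - \<alpha> - dn) / 2" unfolding \<epsilon>_def by (rule min.cobounded1)
    then show ?thesis using below by simp
  qed
  finally show "limsup (\<lambda>n. ereal (type2 n (x n) (f n))) < ereal (1 - \<alpha>)" .
qed

text \<open>
  With \<open>z\<close> the normalised threshold and \<open>d\<close> the normalised shift, the sum of the error probabilities
  is asymptotically one minus the normal mass of \<open>(z - d, z]\<close>. If the shift vanishes, so does this
  mass, uniformly in the threshold, by the Lipschitz bound. Conversely, testing with threshold \<open>0\<close>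
  shows that the mass of \<open>(- d, 0]\<close> must vanish, which forces \<open>d\<close> to zero.
\<close>

lemma inconsistent_along_iff:
  assumes m: "strict_mono m" "\<And>i. 1 \<le> m i"
    and g: "\<And>i. g i \<in> L2" "\<And>i. l2_norm (g i) \<le> C * real (m i) powr (- r)" and C: "0 \<le> C"
  shows "inconsistent_along M \<xi> \<sigma> \<phi> \<kappa> m g \<longleftrightarrow> (\<lambda>i. signal (m i) (g i)) \<longlonglongrightarrow> 0"
proof -
  obtain s lo hi where scale: "normal_scale s" and lo: "0 < lo"
    and s: "\<And>n. 1 \<le> n \<Longrightarrow> lo \<le> s n \<and> s n \<le> hi"
    using normal_approximation by blast
  have hi: "0 < hi" using lo s[of 1] by linarith
  have sum: "\<forall>\<^sub>F i in sequentially. \<forall>x. \<bar>type1 (m i) x + type2 (m i) x (g i) -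
      (1 - std_normal_cdf ((real (m i))\<^sup>2 * x / s (m i))
       + std_normal_cdf ((real (m i))\<^sup>2 * x / s (m i) - signal (m i) (g i) / s (m i)))\<bar> \<le> 2 * \<epsilon>"
    if "0 < \<epsilon>" for \<epsilon>
    using eventually_subseq[OF m(1) normal_scaleD[OF scale that, of C]]
  proof eventually_elim
    case (elim i)
    show ?case
    proof
      fix x
      have "l2_norm (\<lambda>_. 0) \<le> C * real (m i) powr (- r)" using C by (simp add: l2_norm_def)
      then have "\<bar>type2 (m i) x (\<lambda>_. 0) - std_normal_cdf (((real (m i))\<^sup>2 * x - signal (m i) (\<lambda>_. 0)) / s (m i))\<bar> \<le> \<epsilon>"
        using elim L2_zero by blast
      moreover have "\<bar>type2 (m i) x (g i) - std_normal_cdf (((real (m i))\<^sup>2 * x - signal (m i) (g i)) / s (m i))\<bar> \<le> \<epsilon>"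
        using elim g by blast
      ultimately show "\<bar>type1 (m i) x + type2 (m i) x (g i) -
          (1 - std_normal_cdf ((real (m i))\<^sup>2 * x / s (m i))
           + std_normal_cdf ((real (m i))\<^sup>2 * x / s (m i) - signal (m i) (g i) / s (m i)))\<bar> \<le> 2 * \<epsilon>"
        unfolding type1_eq[OF m(2)] signal_zero diff_0_right diff_divide_distrib by linarith
    qed
  qed
  show ?thesis
  proof
    assume incons: "inconsistent_along M \<xi> \<sigma> \<phi> \<kappa> m g"
    show "(\<lambda>i. signal (m i) (g i)) \<longlonglongrightarrow> 0"
    proof (rule order_tendstoI)
      fix \<eta> :: real assume \<eta>: "0 < \<eta>"
      define \<delta> where "\<delta> = (std_normal_cdf 0 - std_normal_cdf (- (\<eta> / hi))) / 3"
      have \<delta>: "0 < \<delta>" using std_normal_cdf_strict[of "- (\<eta> / hi)" 0] \<eta> hi by (simp add: \<delta>_def)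
      have "1 \<le> liminf (\<lambda>i. ereal (type1 (m i) 0 + type2 (m i) 0 (g i)))"
        using incons unfolding inconsistent_along_def by (rule spec[where x = "\<lambda>_. 0"])
      moreover have "ereal (1 - \<delta>) < 1" using \<delta> by (simp add: one_ereal_def)
      ultimately have "ereal (1 - \<delta>) < liminf (\<lambda>i. ereal (type1 (m i) 0 + type2 (m i) 0 (g i)))"
        by (rule less_le_trans[rotated])
      from less_LiminfD[OF this] have "\<forall>\<^sub>F i in sequentially. ereal (1 - \<delta>) < ereal (type1 (m i) 0 + type2 (m i) 0 (g i))" .
      moreover have "0 < \<delta>" by fact
      from sum[OF this] have "\<forall>\<^sub>F i in sequentially. \<bar>type1 (m i) 0 + type2 (m i) 0 (g i) -
          (1 - std_normal_cdf 0 + std_normal_cdf (- (signal (m i) (g i) / s (m i))))\<bar> \<le> 2 * \<delta>"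
        by eventually_elim (drule spec[where x = 0], simp)
      ultimately show "\<forall>\<^sub>F i in sequentially. signal (m i) (g i) < \<eta>"
      proof eventually_elim
        case (elim i)
        have sm: "0 < s (m i)" "s (m i) \<le> hi" using s[OF m(2)] lo by (auto intro: less_le_trans)
        have "std_normal_cdf (- (\<eta> / hi)) = std_normal_cdf 0 - 3 * \<delta>" by (simp add: \<delta>_def field_simps)
        also have "\<dots> < std_normal_cdf (- (signal (m i) (g i) / s (m i)))"
          using elim by (simp add: abs_le_iff)
        finally have "- (\<eta> / hi) < - (signal (m i) (g i) / s (m i))"
          using std_normal.cdf_nondecreasing[of "- (signal (m i) (g i) / s (m i))" "- (\<eta> / hi)"] by linarith
        then have "signal (m i) (g i) / s (m i) < \<eta> / hi" by simp
        also have "\<dots> \<le> \<eta> / s (m i)" using sm \<eta> by (intro divide_left_mono) auto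
        finally show ?case using sm by (simp add: divide_less_cancel)
      qed
    next
      fix a :: real assume "a < 0"
      then show "\<forall>\<^sub>F i in sequentially. a < signal (m i) (g i)"
        by (intro always_eventually allI less_le_trans[OF _ signal_nonneg])
    qed
  next
    assume lim: "(\<lambda>i. signal (m i) (g i)) \<longlonglongrightarrow> 0"
    show "inconsistent_along M \<xi> \<sigma> \<phi> \<kappa> m g"
      unfolding inconsistent_along_def
    proof (rule allI, rule ereal_le_epsilon2)
      fix x :: "nat \<Rightarrow> real" and \<epsilon> :: real
      assume \<epsilon>: "0 < \<epsilon>"
      show "1 \<le> liminf (\<lambda>i. ereal (type1 (m i) (x i) + type2 (m i) (x i) (g i))) + ereal \<epsilon>"
      proof -
        have e4: "0 < \<epsilon> / 4" using \<epsilon> by simp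
        have "\<forall>\<^sub>F i in sequentially. signal (m i) (g i) < \<epsilon> / 2 * lo"
          using lim \<epsilon> lo by (intro order_tendstoD(2)) auto
        then have "\<forall>\<^sub>F i in sequentially. ereal (1 - \<epsilon>) \<le> ereal (type1 (m i) (x i) + type2 (m i) (x i) (g i))"
          using sum[OF e4]
        proof eventually_elim
          case (elim i)
          have sm: "0 < s (m i)" "lo \<le> s (m i)" using s[OF m(2)] lo by (auto intro: less_le_trans)
          let ?z = "(real (m i))\<^sup>2 * x i / s (m i)" and ?d = "signal (m i) (g i) / s (m i)"
          have "?d \<le> signal (m i) (g i) / lo" using sm lo signal_nonneg by (intro divide_left_mono) auto
          also have "\<dots> \<le> \<epsilon> / 2" using elim(1) lo by (simp add: pos_divide_le_eq)
          finally have "?d \<le> \<epsilon> / 2" .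
          moreover have "0 \<le> ?d" using sm signal_nonneg by simp
          ultimately have "std_normal_cdf ?z - std_normal_cdf (?z - ?d) \<le> \<epsilon> / 2"
            using std_normal_cdf_lipschitz[of "?z - ?d" ?z] by linarith
          then have "1 - \<epsilon> \<le> type1 (m i) (x i) + type2 (m i) (x i) (g i)"
            using elim(2)[rule_format, of "x i"] unfolding abs_le_iff by linarith
          then show ?case by simp
        qed
        then have "ereal (1 - \<epsilon>) \<le> liminf (\<lambda>i. ereal (type1 (m i) (x i) + type2 (m i) (x i) (g i)))"
          by (rule Liminf_bounded)
        then have "ereal (1 - \<epsilon>) + ereal \<epsilon> \<le> liminf (\<lambda>i. ereal (type1 (m i) (x i) + type2 (m i) (x i) (g i))) + ereal \<epsilon>"
          by (rule add_right_mono)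
        then show "1 \<le> liminf (\<lambda>i. ereal (type1 (m i) (x i) + type2 (m i) (x i) (g i))) + ereal \<epsilon>"
          by (simp add: one_ereal_def)
      qed
    qed
  qed
qed

end

section \<open>Pure consistency and small tails\<close>

context white_noise_test
begin

text \<open>
  The right-hand side of the theorem, with the tail energy in the form given by \<open>tail_energy\<close>.
\<close>

definition uniformly_small_tails :: "(nat \<Rightarrow> real \<Rightarrow> real) \<Rightarrow> bool" where
  "uniformly_small_tails f \<longleftrightarrow> (\<forall>\<epsilon>>0. \<exists>C1>0. \<exists>n0. \<forall>n>n0.
     (l2_norm (f n))\<^sup>2 - (\<Sum>j=1..nat \<lfloor>C1 * real (k_idx \<kappa> n)\<rfloor>. (coef (f n) j)\<^sup>2)
       \<le> \<epsilon> * real n powr (- 2 * r))"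

lemma powr_square: "(real n powr (- r))\<^sup>2 = real n powr (- 2 * r)"
  by (simp add: power2_eq_square flip: powr_add)

text \<open>
  Choosing tails of at most half the guaranteed energy leaves the other half in coordinates that the
  statistic sees with weights of full order.
\<close>

lemma consistent_if_small_tails:
  assumes f: "\<And>n. 1 \<le> n \<Longrightarrow> f n \<in> L2" and c: "0 < c" and C: "0 \<le> C"
    and norm: "\<And>n. 1 \<le> n \<Longrightarrow> c * real n powr (- r) \<le> l2_norm (f n) \<and> l2_norm (f n) \<le> C * real n powr (- r)"
    and tails: "uniformly_small_tails f"
  shows "consistent M \<xi> \<sigma> \<phi> \<kappa> f"
proof -
  have "0 < c\<^sup>2 / 2" using c by simp
  with tails obtain C1 n0 where C1: "0 < C1" and n0: "\<And>n. n0 < n \<Longrightarrow>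
      (l2_norm (f n))\<^sup>2 - (\<Sum>j=1..nat \<lfloor>C1 * real (k_idx \<kappa> n)\<rfloor>. (coef (f n) j)\<^sup>2)
       \<le> c\<^sup>2 / 2 * real n powr (- 2 * r)"
    unfolding uniformly_small_tails_def by blast
  obtain b where b: "0 < b" "\<forall>\<^sub>F n in sequentially. \<forall>g\<in>L2.
      b * real n powr (2 * r) * (\<Sum>j=1..nat \<lfloor>C1 * real (k_idx \<kappa> n)\<rfloor>. (coef g j)\<^sup>2) \<le> signal n g"
    using signal_ge_head[OF C1] by blast
  have "\<forall>\<^sub>F n in sequentially. b * (c\<^sup>2 / 2) \<le> signal n (f n)"
    using b(2) eventually_gt_at_top[of n0] eventually_ge_at_top[of 1]
  proof eventually_elim
    case (elim n)
    let ?H = "\<Sum>j=1..nat \<lfloor>C1 * real (k_idx \<kappa> n)\<rfloor>. (coef (f n) j)\<^sup>2"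
    have "(c * real n powr (- r))\<^sup>2 \<le> (l2_norm (f n))\<^sup>2"
      using norm[OF elim(3)] c by (intro power_mono) auto
    then have "c\<^sup>2 * real n powr (- 2 * r) \<le> (l2_norm (f n))\<^sup>2"
      by (simp add: power_mult_distrib powr_square)
    then have "c\<^sup>2 / 2 * real n powr (- 2 * r) \<le> ?H"
      using n0[OF elim(2)] by (simp add: field_simps)
    then have "b * real n powr (2 * r) * (c\<^sup>2 / 2 * real n powr (- 2 * r)) \<le> b * real n powr (2 * r) * ?H"
      using b(1) by (intro mult_left_mono) auto
    also have "\<dots> \<le> signal n (f n)" using elim(1) f[OF elim(3)] by blast
    also have "b * real n powr (2 * r) * (c\<^sup>2 / 2 * real n powr (- 2 * r)) =
        b * (c\<^sup>2 / 2) * (real n powr (2 * r) * real n powr (- 2 * r))"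
      by simp
    also have "real n powr (2 * r) * real n powr (- 2 * r) = 1"
      using elim(3) by (simp flip: powr_add)
    finally show ?case by simp
  qed
  moreover have "0 < b * (c\<^sup>2 / 2)" using b(1) c by simp
  ultimately show ?thesis
    using norm by (intro consistent_if_signal_bounded_below[OF f _ C]) blast+
qed

text \<open>
  An inconsistent \<open>f2\<close> has vanishing signal, hence little energy in the first \<open>C1 * k_idx\<close> coordinates,
  while \<open>f\<close> has little energy in the others. By \<open>orthogonal_component_bound\<close> such an orthogonal summand of
  \<open>f\<close> has squared norm at most \<open>c1\<^sup>2 / 2\<close> in units of \<open>n powr (- 2 r)\<close>, which contradicts the lower bound
  \<open>c1\<^sup>2\<close>.
\<close>

lemma no_inconsistent_component:
  assumes f: "\<And>n. 1 \<le> n \<Longrightarrow> f n \<in> L2" and C: "0 < C"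
    and norm: "\<And>n. 1 \<le> n \<Longrightarrow> l2_norm (f n) \<le> C * real n powr (- r)"
    and tails: "uniformly_small_tails f"
    and m: "strict_mono m" "\<And>i. 1 \<le> m i"
    and L2: "\<And>i. f1 i \<in> L2" "\<And>i. f2 i \<in> L2"
    and decomp: "\<And>i. AE t in unit_leb. f (m i) t = f1 i t + f2 i t" "\<And>i. l2_inner (f2 i) (f1 i) = 0"
    and c1: "0 < c1" "\<And>i. c1 * real (m i) powr (- r) < l2_norm (f2 i)"
  shows "\<not> inconsistent_along M \<xi> \<sigma> \<phi> \<kappa> m f2"
proof
  assume incons: "inconsistent_along M \<xi> \<sigma> \<phi> \<kappa> m f2"
  have norm2: "l2_norm (f2 i) \<le> C * real (m i) powr (- r)" for i
  proof -
    have "(l2_norm (f2 i))\<^sup>2 \<le> (l2_norm (f (m i)))\<^sup>2"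
      by (rule orthogonal_decomposition_coeffs(1)[OF basis f[OF m(2)] L2 decomp])
    then have "l2_norm (f2 i) \<le> l2_norm (f (m i))"
      using l2_norm_nonneg power2_le_imp_le by blast
    then show ?thesis using norm[OF m(2), of i] by linarith
  qed
  have sig: "(\<lambda>i. signal (m i) (f2 i)) \<longlonglongrightarrow> 0"
    using incons inconsistent_along_iff[OF m L2(2) norm2] C by simp
  have "0 < c1\<^sup>2 / 8" using c1 by simp
  with tails obtain C1 n0 where C1: "0 < C1" and n0: "\<And>n. n0 < n \<Longrightarrow>
      (l2_norm (f n))\<^sup>2 - (\<Sum>j=1..nat \<lfloor>C1 * real (k_idx \<kappa> n)\<rfloor>. (coef (f n) j)\<^sup>2)
       \<le> c1\<^sup>2 / 8 * real n powr (- 2 * r)"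
    unfolding uniformly_small_tails_def by blast
  obtain b where b: "0 < b" "\<forall>\<^sub>F n in sequentially. \<forall>g\<in>L2.
      b * real n powr (2 * r) * (\<Sum>j=1..nat \<lfloor>C1 * real (k_idx \<kappa> n)\<rfloor>. (coef g j)\<^sup>2) \<le> signal n g"
    using signal_ge_head[OF C1] by blast
  \<comment> \<open>With this parameter each of the three terms in \<open>orthogonal_component_bound\<close> is eventually at most
      \<open>c1\<^sup>2 / 8\<close> in units of \<open>n powr (- 2 r)\<close>.\<close>
  define c where "c = c1\<^sup>2 / (4 * C\<^sup>2)"
  have c: "0 < c" using c1 C by (simp add: c_def)
  have "0 < b * (c1\<^sup>2 / 8 * (2 * c))" using b(1) c1 c by simp
  then have "\<forall>\<^sub>F i in sequentially. signal (m i) (f2 i) < b * (c1\<^sup>2 / 8 * (2 * c))"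
    using sig by (intro order_tendstoD(2)) auto
  then have "\<forall>\<^sub>F i in sequentially. False"
    using eventually_subseq[OF m(1) b(2)] eventually_subseq[OF m(1) eventually_gt_at_top[of n0]]
  proof eventually_elim
    case (elim i)
    let ?L = "nat \<lfloor>C1 * real (k_idx \<kappa> (m i))\<rfloor>" and ?p = "real (m i) powr (- 2 * r)"
    have p: "0 < ?p" "real (m i) powr (2 * r) * ?p = 1"
      using m(2)[of i] by (auto simp flip: powr_add)
    let ?H = "\<Sum>j=1..?L. (coef (f2 i) j)\<^sup>2"
    have "b * real (m i) powr (2 * r) * ?H < b * (c1\<^sup>2 / 8 * (2 * c))"
      using elim(1,2) L2(2) by (meson le_less_trans)
    then have "b * real (m i) powr (2 * r) * ?H * ?p < b * (c1\<^sup>2 / 8 * (2 * c)) * ?p"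
      using p by (intro mult_strict_right_mono)
    also have "b * real (m i) powr (2 * r) * ?H * ?p = b * (?H * (real (m i) powr (2 * r) * ?p))"
      by simp
    finally have "b * ?H < b * ((c1\<^sup>2 / 8 * (2 * c)) * ?p)"
      unfolding p(2) by simp
    then have "?H < (c1\<^sup>2 / 8 * ?p) * (2 * c)"
      using b(1) by (simp only: mult_less_cancel_left_pos mult_ac)
    then have head: "?H / (2 * c) < c1\<^sup>2 / 8 * ?p"
      using c pos_divide_less_eq[of "2 * c" ?H "c1\<^sup>2 / 8 * ?p"] by simp
    have "(l2_norm (f (m i)))\<^sup>2 \<le> (C * real (m i) powr (- r))\<^sup>2"
      using norm[OF m(2)] l2_norm_nonneg by (intro power_mono)
    then have "c / 2 * (l2_norm (f (m i)))\<^sup>2 \<le> c / 2 * (C\<^sup>2 * ?p)"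
      using c by (intro mult_left_mono) (simp_all add: power_mult_distrib powr_square)
    also have "\<dots> = c1\<^sup>2 / 8 * ?p" using C by (simp add: c_def)
    finally have body: "c / 2 * (l2_norm (f (m i)))\<^sup>2 \<le> c1\<^sup>2 / 8 * ?p" .
    have "3 / 4 * (l2_norm (f2 i))\<^sup>2 \<le> c / 2 * (l2_norm (f (m i)))\<^sup>2 + ?H / (2 * c)
        + ((l2_norm (f (m i)))\<^sup>2 - (\<Sum>j=1..?L. (coef (f (m i)) j)\<^sup>2))"
      by (rule orthogonal_component_bound[OF basis f[OF m(2)] L2 decomp c])
    also have "\<dots> \<le> c1\<^sup>2 / 8 * ?p + c1\<^sup>2 / 8 * ?p + c1\<^sup>2 / 8 * ?p"
      using head body n0[OF elim(3)] by (intro add_mono) auto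
    finally have "(l2_norm (f2 i))\<^sup>2 \<le> c1\<^sup>2 / 2 * ?p" by simp
    moreover have "(c1 * real (m i) powr (- r))\<^sup>2 \<le> (l2_norm (f2 i))\<^sup>2"
      using c1(2)[of i] c1(1) by (intro power_mono) auto
    moreover have "(c1 * real (m i) powr (- r))\<^sup>2 = c1\<^sup>2 * ?p"
      by (simp add: power_mult_distrib powr_square)
    moreover have "0 < c1\<^sup>2 * ?p" using c1(1) p by simp
    ultimately show ?case by linarith
  qed
  then show False by simp
qed

text \<open>
  If the tails are not uniformly small, there are \<open>m 0 < m 1 < \<dots>\<close> such that \<open>f (m i)\<close> keeps energy
  \<open>\<epsilon>\<close>, in units of \<open>n powr (- 2 r)\<close>, beyond the index \<open>(i + 2) * k_idx\<close>. Cutting there gives an orthogonal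
  decomposition. The high-frequency part meets only weights bounded by a constant times
  \<open>(i + 2) powr - l * kappa_sq\<close>, so its signal tends to zero and it is inconsistent.
\<close>

lemma small_tails_if_pure:
  assumes A4: "cond_A4 \<kappa>" and f: "\<And>n. 1 \<le> n \<Longrightarrow> f n \<in> L2" and C: "0 < C"
    and norm: "\<And>n. 1 \<le> n \<Longrightarrow> l2_norm (f n) \<le> C * real n powr (- r)"
    and pure: "purely_rate_consistent M \<xi> \<sigma> \<phi> \<kappa> r f"
  shows "uniformly_small_tails f"
proof (rule ccontr)
  define tail where "tail C1 n = (l2_norm (f n))\<^sup>2 - (\<Sum>j=1..nat \<lfloor>C1 * real (k_idx \<kappa> n)\<rfloor>. (coef (f n) j)\<^sup>2)" for C1 n
  assume "\<not> uniformly_small_tails f"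
  then obtain \<epsilon> where \<epsilon>: "0 < \<epsilon>" and
    large: "\<And>C1 n0. 0 < C1 \<Longrightarrow> \<exists>n>n0. \<epsilon> * real n powr (- 2 * r) < tail C1 n"
    unfolding uniformly_small_tails_def tail_def by (meson not_le)
  \<comment> \<open>The multiple \<open>i + 2\<close> is \<open>1 + \<delta>\<close> with \<open>\<delta> = i + 1 > 0\<close> in \<open>cond_A4\<close>.\<close>
  have "\<exists>m. \<forall>i. (1 \<le> m i \<and> \<epsilon> * real (m i) powr (- 2 * r) < tail (real i + 2) (m i)) \<and> m i < m (Suc i)"
  proof (rule dependent_nat_choice)
    show "\<exists>n. 1 \<le> n \<and> \<epsilon> * real n powr (- 2 * r) < tail (real 0 + 2) n"
      using large[of 2 0] by (auto simp: Suc_le_eq)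
    show "\<exists>n'. (1 \<le> n' \<and> \<epsilon> * real n' powr (- 2 * r) < tail (real (Suc i) + 2) n') \<and> n < n'"
      if "1 \<le> n \<and> \<epsilon> * real n powr (- 2 * r) < tail (real i + 2) n" for n i
    proof -
      have "0 < real (Suc i) + 2" by simp
      from large[OF this] obtain n' where "n < n'" "\<epsilon> * real n' powr (- 2 * r) < tail (real (Suc i) + 2) n'"
        by blast
      moreover from this(1) have "1 \<le> n'" by simp
      ultimately show ?thesis by blast
    qed
  qed
  then obtain m where m1: "\<And>i. 1 \<le> m i"
    and m2: "\<And>i. \<epsilon> * real (m i) powr (- 2 * r) < tail (real i + 2) (m i)"
    and m3: "\<And>i. m i < m (Suc i)" by blast
  have mono: "strict_mono m" using m3 by (simp add: strict_mono_Suc_iff)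
  define L where "L i = nat \<lfloor>(real i + 2) * real (k_idx \<kappa> (m i))\<rfloor>" for i
  define f1 where "f1 i = (\<lambda>t. \<Sum>j=1..L i. coef (f (m i)) j * \<phi> j t)" for i
  define f2 where "f2 i = remainder_after \<phi> (L i) (f (m i))" for i
  have f1: "f1 i \<in> L2" for i unfolding f1_def by (rule partial_sum_L2[OF basis])
  have f2: "f2 i \<in> L2" for i unfolding f2_def by (rule remainder_after_L2[OF basis f[OF m1]])
  have f2_norm: "(l2_norm (f2 i))\<^sup>2 = tail (real i + 2) (m i)" for i
    unfolding f2_def tail_def L_def by (rule remainder_after_norm[OF basis f[OF m1]])
  have f2_le: "l2_norm (f2 i) \<le> C * real (m i) powr (- r)" for i
  proof -
    have "(l2_norm (f2 i))\<^sup>2 \<le> (l2_norm (f (m i)))\<^sup>2"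
      unfolding f2_norm tail_def by (simp add: sum_nonneg)
    then have "l2_norm (f2 i) \<le> l2_norm (f (m i))"
      using l2_norm_nonneg power2_le_imp_le by blast
    then show ?thesis using norm[OF m1, of i] by linarith
  qed
  obtain CA l where l: "1 < l" and A4': "\<And>\<delta> n. 0 < \<delta> \<Longrightarrow> 1 \<le> n \<Longrightarrow>
      (\<kappa> n (nat \<lfloor>(1 + \<delta>) * real (k_idx \<kappa> n)\<rfloor>))\<^sup>2 < CA * (1 + \<delta>) powr (- l) * kappa_sq \<kappa> n"
    using A4 unfolding cond_A4_def by blast
  obtain B where B: "0 < B" and "\<forall>\<^sub>F n in sequentially. kappa_sq \<kappa> n \<le> (\<kappa> n 1)\<^sup>2 \<and>
      (\<kappa> n 1)\<^sup>2 \<le> B * real n powr (2 * r - 2)"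
    by (rule kappa_sq_rate[OF A1 A2 A3 A5 sigma])
  then have kappa_upper: "\<forall>\<^sub>F n in sequentially. kappa_sq \<kappa> n \<le> B * real n powr (2 * r - 2)"
    by (auto elim: eventually_mono)
  have "(\<lambda>i. signal (m i) (f2 i)) \<longlonglongrightarrow> 0"
  proof (rule Lim_null_comparison)
    show "\<forall>\<^sub>F i in sequentially. norm (signal (m i) (f2 i)) \<le> \<bar>CA\<bar> * B * C\<^sup>2 * (real i + 2) powr (- l)"
      using eventually_subseq[OF mono kappa_upper]
    proof eventually_elim
      case (elim i)
      let ?n = "m i"
      let ?K = "\<bar>CA\<bar> * (real i + 2) powr (- l) * (B * real ?n powr (2 * r - 2))"
      have "signal ?n (f2 i) \<le> (real ?n)\<^sup>2 * (?K * (l2_norm (f2 i))\<^sup>2)"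
      proof (rule signal_le[OF f2 m1])
        fix j assume j: "1 \<le> j" "coef (f2 i) j \<noteq> 0"
        then have Lj: "L i \<le> j"
          unfolding f2_def remainder_after_coeff[OF basis f[OF m1] j(1)] by (auto split: if_splits)
        have k: "1 \<le> k_idx \<kappa> ?n" by (rule k_idx_properties(1)[OF A3 m1])
        have "1 \<le> L i"
        proof -
          have "1 * 1 \<le> (real i + 2) * real (k_idx \<kappa> ?n)" using k by (intro mult_mono) auto
          then show ?thesis unfolding L_def by (simp add: le_nat_iff le_floor_iff)
        qed
        then have "(\<kappa> ?n j)\<^sup>2 \<le> (\<kappa> ?n (L i))\<^sup>2"
          by (rule kappa_sq_antimono[OF A1 m1 _ Lj])
        also have "\<dots> \<le> CA * (real i + 2) powr (- l) * kappa_sq \<kappa> ?n"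
          using A4'[of "real i + 1" ?n] m1 by (simp add: L_def add_ac)
        also have "\<dots> \<le> ?K"
          using elim by (intro mult_mono) (auto simp: kappa_sq_def)
        finally show "(\<kappa> ?n j)\<^sup>2 \<le> ?K" .
      qed
      also have "\<dots> \<le> (real ?n)\<^sup>2 * (?K * (C * real ?n powr (- r))\<^sup>2)"
        using f2_le[of i] l2_norm_nonneg B by (intro mult_left_mono power_mono) auto
      also have "\<dots> = \<bar>CA\<bar> * B * C\<^sup>2 * (real i + 2) powr (- l) *
          ((real ?n)\<^sup>2 * (real ?n powr (2 * r - 2) * real ?n powr (- 2 * r)))"
        by (simp add: power_mult_distrib powr_square)
      also have "(real ?n)\<^sup>2 * (real ?n powr (2 * r - 2) * real ?n powr (- 2 * r)) = 1"
      proof -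
        have "(real ?n)\<^sup>2 = real ?n powr 2" using m1[of i] by (simp add: powr_numeral)
        then show ?thesis using m1[of i] by (simp only: powr_add[symmetric]) simp
      qed
      finally show ?case using signal_nonneg[of ?n "f2 i"] by simp
    qed
    have "filterlim (\<lambda>i. real i + 2) at_top sequentially"
      by (intro filterlim_tendsto_add_at_top[OF tendsto_const filterlim_real_sequentially, of 2, simplified add.commute])
    then have "(\<lambda>i. (real i + 2) powr (- l)) \<longlonglongrightarrow> 0"
      using l by (intro tendsto_neg_powr) auto
    then show "(\<lambda>i. \<bar>CA\<bar> * B * C\<^sup>2 * (real i + 2) powr (- l)) \<longlonglongrightarrow> 0"
      by (rule tendsto_mult_right_zero)
  qed
  then have incons: "inconsistent_along M \<xi> \<sigma> \<phi> \<kappa> m f2"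
    using inconsistent_along_iff[OF mono m1 f2 f2_le] C by simp
  have sum: "AE t in unit_leb. f (m i) t = f1 i t + f2 i t" for i
    by (simp add: f1_def f2_def remainder_after_def)
  have orth: "l2_inner (f2 i) (f1 i) = 0" for i
    using remainder_after_orthogonal[OF basis f[OF m1], of "\<lambda>j. coef (f (m i)) j" "L i"]
    by (simp add: f1_def f2_def l2_inner_commute[of _ "\<lambda>t. \<Sum>j = _.._. _ j t"])
  have lower: "sqrt \<epsilon> * real (m i) powr (- r) < l2_norm (f2 i)" for i
  proof (rule power2_less_imp_less[OF _ l2_norm_nonneg])
    show "(sqrt \<epsilon> * real (m i) powr (- r))\<^sup>2 < (l2_norm (f2 i))\<^sup>2"
      using m2[of i] \<epsilon> by (simp add: f2_norm power_mult_distrib powr_square)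
  qed
  have "0 < sqrt \<epsilon>" using \<epsilon> by simp
  with pure mono m1 f1 f2 sum orth lower incons show False
    unfolding purely_rate_consistent_def by blast
qed

end

theorem theorem4p8:
  fixes r \<sigma> c C :: real
    and M :: "'w measure"
    and \<xi> :: "nat \<Rightarrow> 'w \<Rightarrow> real"
    and \<phi> :: "nat \<Rightarrow> real \<Rightarrow> real"
    and \<kappa> :: "nat \<Rightarrow> nat \<Rightarrow> real"
    and f :: "nat \<Rightarrow> real \<Rightarrow> real"
    and \<theta> :: "nat \<Rightarrow> nat \<Rightarrow> real"
  assumes "0 < r" and "r < 1/2" and "0 < \<sigma>"
    and "orthonormal_basis \<phi>"
    and "iid_standard_normal M \<xi>"
    and "cond_A1 \<kappa>" and "cond_A2 \<sigma> \<kappa>" and "cond_A3 r \<kappa>" and "cond_A4 \<kappa>" and "cond_A5 \<kappa>"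
    and "\<And>n. n \<ge> 1 \<Longrightarrow> f n \<in> L2"
    and "\<And>n j. n \<ge> 1 \<Longrightarrow> j \<ge> 1 \<Longrightarrow> \<theta> n j = l2_inner (f n) (\<phi> j)"
    and "0 < c" and "c < C"
    and "\<And>n. n \<ge> 1 \<Longrightarrow> c * real n powr (- r) \<le> l2_norm (f n) \<and> l2_norm (f n) \<le> C * real n powr (- r)"
  shows "purely_rate_consistent M \<xi> \<sigma> \<phi> \<kappa> r f \<longleftrightarrow>
    (\<forall>\<epsilon>>0. \<exists>C1>0. \<exists>n0. \<forall>n>n0.
       (\<Sum>\<^sub>\<infinity>j\<in>{j. 1 \<le> j \<and> C1 * real (k_idx \<kappa> n) < real j}. (\<theta> n j)\<^sup>2)
         \<le> \<epsilon> * real n powr (- 2 * r))"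
proof -
  interpret prob_space M using assms(5) by (simp add: iid_standard_normal_def)
  interpret white_noise_test M \<xi> \<sigma> r \<phi> \<kappa>
    by unfold_locales (use assms in auto)
  have C: "0 < C" "0 \<le> C" using assms(13,14) by auto
  have norm: "l2_norm (f n) \<le> C * real n powr (- r)" if "1 \<le> n" for n
    using assms(15)[OF that] by simp
  have tail: "(\<Sum>\<^sub>\<infinity>j\<in>{j. 1 \<le> j \<and> y < real j}. (\<theta> n j)\<^sup>2) =
      (l2_norm (f n))\<^sup>2 - (\<Sum>j=1..nat \<lfloor>y\<rfloor>. (coef (f n) j)\<^sup>2)" if "n0 < n" for n n0 :: nat and y
  proof -
    have n: "1 \<le> n" using that by simp
    have "(\<Sum>\<^sub>\<infinity>j\<in>{j. 1 \<le> j \<and> y < real j}. (\<theta> n j)\<^sup>2) =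
        (\<Sum>\<^sub>\<infinity>j\<in>{j. 1 \<le> j \<and> y < real j}. (coef (f n) j)\<^sup>2)"
      using assms(12)[OF n] by (intro infsum_cong) auto
    also have "\<dots> = (l2_norm (f n))\<^sup>2 - (\<Sum>j=1..nat \<lfloor>y\<rfloor>. (coef (f n) j)\<^sup>2)"
      by (rule tail_energy[OF basis assms(11)[OF n]])
    finally show ?thesis .
  qed
  have rhs: "(\<forall>\<epsilon>>0. \<exists>C1>0. \<exists>n0. \<forall>n>n0.
       (\<Sum>\<^sub>\<infinity>j\<in>{j. 1 \<le> j \<and> C1 * real (k_idx \<kappa> n) < real j}. (\<theta> n j)\<^sup>2)
         \<le> \<epsilon> * real n powr (- 2 * r)) \<longleftrightarrow> uniformly_small_tails f"
    unfolding uniformly_small_tails_def using tail by simp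
  show ?thesis
    unfolding rhs
  proof
    assume "purely_rate_consistent M \<xi> \<sigma> \<phi> \<kappa> r f"
    with assms(9,11) C(1) norm show "uniformly_small_tails f"
      by (rule small_tails_if_pure)
  next
    assume tails: "uniformly_small_tails f"
    have "(\<lambda>n. l2_norm (f n)) \<in> \<Theta>(\<lambda>n. real n powr (- r))"
    proof (rule bigthetaI')
      show "\<forall>\<^sub>F n in sequentially. c * norm (real n powr (- r)) \<le> norm (l2_norm (f n)) \<and>
          norm (l2_norm (f n)) \<le> C * norm (real n powr (- r))"
        using eventually_ge_at_top[of 1]
        by eventually_elim (use assms(15) l2_norm_nonneg in auto)
    qed (use assms(13) C in auto)
    moreover have "consistent M \<xi> \<sigma> \<phi> \<kappa> f"
      using assms(11,13) C(2) assms(15) tails by (rule consistent_if_small_tails)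
    ultimately have rate: "rate_consistent M \<xi> \<sigma> \<phi> \<kappa> r f"
      unfolding rate_consistent_def by simp
    show "purely_rate_consistent M \<xi> \<sigma> \<phi> \<kappa> r f"
      unfolding purely_rate_consistent_def
    proof (intro conjI notI rate, elim exE conjE)
      fix m f1 f2 c1
      assume m: "strict_mono m" "\<forall>i. 1 \<le> m i"
        and parts: "\<forall>i. f1 i \<in> L2 \<and> f2 i \<in> L2 \<and>
          (AE t in unit_leb. f (m i) t = f1 i t + f2 i t) \<and> l2_inner (f2 i) (f1 i) = 0"
        and c1: "0 < c1" "\<forall>i. c1 * real (m i) powr (- r) < l2_norm (f2 i)"
        and incons: "inconsistent_along M \<xi> \<sigma> \<phi> \<kappa> m f2"
      have "\<not> inconsistent_along M \<xi> \<sigma> \<phi> \<kappa> m f2"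
        by (rule no_inconsistent_component[OF assms(11) C(1) norm tails m(1), of f1 f2 c1])
           (use m parts c1 in simp_all)
      with incons show False by contradiction
    qed
  qed
qed

end
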